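(* Let $m$ be an odd positive integer and let $Q=(q_{i,j})$ be an $m\times m$ matrix of functions satisfying $\overline{q_{i,j}(-x)}=q_{i,j}(x)$, $q_{i,j}(x+\pi)=q_{i,j}(x)$, $q_{i,j}\in L_2[0,\pi]$. Then the real component of the spectrum of $L(Q)$ contains the main part of $[0,\infty)$, in the sense that $$\lim_{n\to\infty}\frac{\operatorname{meas}([0,n]\setminus\sigma(L(Q)))}{\operatorname{meas}(\sigma(L(Q))\cap[0,n])}=0 .$$
   Context: $L(Q)$ is the operator generated in $L_2(\mathbb R;\mathbb C^m)$ by $-y''+Qy$; its spectrum is $\sigma(L(Q))=\bigcup_{t\in(-1,1]}\sigma(L_t(Q))$, where $L_t(Q)$ is the operator in $L_2([0,\pi];\mathbb C^m)$ generated by $-y''+Qy$ and $y(\pi)=e^{i\pi t}y(0)$, $y'(\pi)=e^{i\pi t}y'(0)$. The real component of the spectrum is $\sigma(L(Q))\cap\mathbb R$. $\operatorname{meas}$ denotes Lebesgue measure. *)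

theory Defs
  imports "HOL-Analysis.Analysis"
begin

text \<open>
  Elements of \<open>L\<^sub>2\<close> are represented by functions. All notions below that concern
  \<open>L\<^sub>2\<close> functions are understood modulo equality almost everywhere.
\<close>

definition L2 :: "real set \<Rightarrow> (real \<Rightarrow> 'b::euclidean_space) set" where
  "L2 S = {f. f \<in> borel_measurable (lebesgue_on S) \<and>
              integrable (lebesgue_on S) (\<lambda>x. (norm (f x))\<^sup>2)}"

definition L2_norm :: "(real \<Rightarrow> 'b::euclidean_space) \<Rightarrow> real" where
  "L2_norm f = sqrt (\<integral>x. (norm (f x))\<^sup>2 \<partial>lebesgue)"

text \<open>
  \<open>ac_deriv y z\<close>: the function \<open>y\<close> is locally absolutely continuous on the real line and
  its derivative, which exists almost everywhere, is \<open>z\<close>. Equivalently, \<open>z\<close> is locally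
  (Lebesgue) integrable and \<open>y\<close> is an indefinite integral of \<open>z\<close>.
\<close>

definition ac_deriv :: "(real \<Rightarrow> 'b::euclidean_space) \<Rightarrow> (real \<Rightarrow> 'b) \<Rightarrow> bool" where
  "ac_deriv y z \<longleftrightarrow>
     (\<forall>a b. a \<le> b \<longrightarrow> z absolutely_integrable_on {a..b} \<and> y b - y a = integral {a..b} z)"

text \<open>
  The (maximal) operator generated in \<open>L\<^sub>2(\<real>; \<complex>\<^sup>m)\<close> by \<open>-y'' + Q y\<close>, given by its graph: its
  domain consists of the \<open>y\<close> in \<open>L\<^sub>2\<close> such that \<open>y\<close> and \<open>y'\<close> are locally absolutely
  continuous and \<open>-y'' + Q y\<close> is in \<open>L\<^sub>2\<close>. In the graph, \<open>y\<close> is the continuous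
  representative, while the image \<open>f\<close> is any representative of its class.
\<close>

definition L_op :: "(real \<Rightarrow> complex ^ 'm ^ 'm) \<Rightarrow>
    ((real \<Rightarrow> complex ^ 'm) \<times> (real \<Rightarrow> complex ^ 'm)) set" where
  "L_op Q = {(y, f). y \<in> L2 UNIV \<and> f \<in> L2 UNIV \<and>
     (\<exists>y' y''. ac_deriv y y' \<and> ac_deriv y' y'' \<and>
        (AE x in lebesgue. f x = - y'' x + Q x *v y x))}"

text \<open>
  For an operator \<open>A\<close> in \<open>L\<^sub>2(\<real>; \<complex>\<^sup>m)\<close> with the given graph, \<open>\<mu>\<close> is in the resolvent set iff
  \<open>A - \<mu>\<close> is a bijection from the domain of \<open>A\<close> onto \<open>L\<^sub>2\<close> with bounded inverse. Here
  \<open>(A - \<mu>) y = f\<close> is expressed as \<open>A y = f + \<mu> y\<close>; injectivity is the case \<open>f = 0\<close> of the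
  norm bound.
\<close>

definition resolvent_set ::
    "((real \<Rightarrow> complex ^ 'm) \<times> (real \<Rightarrow> complex ^ 'm)) set \<Rightarrow> complex set" where
  "resolvent_set A = {\<mu>.
     (\<forall>f \<in> L2 UNIV. \<exists>y. (y, \<lambda>x. f x + \<mu> *s y x) \<in> A) \<and>
     (\<exists>C. \<forall>f \<in> L2 UNIV. \<forall>y. (y, \<lambda>x. f x + \<mu> *s y x) \<in> A \<longrightarrow> L2_norm y \<le> C * L2_norm f)}"

definition spectrum ::
    "((real \<Rightarrow> complex ^ 'm) \<times> (real \<Rightarrow> complex ^ 'm)) set \<Rightarrow> complex set" where
  "spectrum A = - resolvent_set A"

definition real_spectrum ::
    "((real \<Rightarrow> complex ^ 'm) \<times> (real \<Rightarrow> complex ^ 'm)) set \<Rightarrow> real set" where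
  "real_spectrum A = {x. complex_of_real x \<in> spectrum A}"

end

theory Submission
  imports Defs
begin

text \<open>
  Let \<open>\<mu> = s\<^sup>2\<close> be real and large. Two facts drive the proof. First, \<open>\<mu>\<close> belongs to the spectrum as
  soon as \<open>-y'' + Q y = \<mu> y\<close> has a nontrivial solution on \<open>[-\<pi>/2, \<pi>/2]\<close> whose data \<open>(y, y')\<close> at the
  right end are a multiple \<open>\<rho>\<close> of those at the left end with \<open>|\<rho>| = 1\<close>: one can string together
  arbitrarily many periods of it at a fixed cost (\<open>floquet_solution_in_spectrum\<close>). Second, by the
  symmetry of \<open>Q\<close>, the reflection \<open>x \<mapsto> cnj (y (-x))\<close> of a solution is again a solution.

  Let \<open>A\<close> be the matrix of size \<open>2m\<close> that maps the data \<open>(y, y'/s)\<close> at \<open>0\<close> to those at \<open>\<pi>/2\<close>. By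
  reflection, the data at \<open>-\<pi>/2\<close> are obtained from \<open>S (cnj A) S\<close> with \<open>S = diag(1, -1)\<close>. Writing
  \<open>\<rho> = exp (2it)\<close>, the required solution exists once
  \<open>F(t) = det (exp (it) S (cnj A) S - exp (-it) A)\<close> vanishes for some real \<open>t\<close>. Complex conjugation
  followed by conjugation with \<open>S\<close> turns the matrix in \<open>F(t)\<close> into its negative, and its size is
  even; hence \<open>F\<close> is real (\<open>floquet_det_real\<close>). For \<open>Q = 0\<close> one computes that \<open>F(0)\<close> is a positive
  multiple of \<open>sin (s\<pi>/2) ^ (2m)\<close>, whereas \<open>F(\<pi>/2)\<close> is a positive multiple of
  \<open>(-1) ^ m cos (s\<pi>/2) ^ (2m)\<close>. For odd \<open>m\<close> the signs differ. Since \<open>A\<close> deviates from the matrix for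
  \<open>Q = 0\<close> only by \<open>O(1/s)\<close> (\<open>schroedinger_solution\<close>), the signs persist as long as \<open>s\<close> is large and
  keeps a fixed distance from the integers, and the intermediate value theorem yields the zero
  (\<open>unimodular_multiplier_exists\<close>).

  Therefore, up to a bounded set, \<open>[0, n]\<close> can leave the spectrum only within the intervals
  \<open>[(k - \<epsilon>)\<^sup>2, (k + \<epsilon>)\<^sup>2]\<close> with \<open>k \<le> sqrt n + 1\<close>. Their total length is at most \<open>8 \<epsilon> (n + 1)\<close>, and
  \<open>\<epsilon>\<close> is arbitrary. The sets are measurable because the spectrum is closed
  (\<open>closed_real_spectrum\<close>), which a Neumann series shows.
\<close>

section \<open>Calculus of absolutely continuous functions\<close>

lemma ac_derivD:
  assumes "ac_deriv y z"
  shows "z absolutely_integrable_on {a..b}" and "a \<le> b \<Longrightarrow> y b - y a = integral {a..b} z"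
proof -
  show "a \<le> b \<Longrightarrow> y b - y a = integral {a..b} z"
    using assms by (simp add: ac_deriv_def)
  show "z absolutely_integrable_on {a..b}"
    using assms by (cases "a \<le> b") (auto simp: ac_deriv_def intro: absolutely_integrable_on_null)
qed

lemma ac_deriv_continuous:
  assumes "ac_deriv y z"
  shows "continuous_on S y"
proof -
  have "isCont y x" for x
  proof -
    have "continuous_on {x - 1..x + 1} (\<lambda>t. y (x - 1) + integral {x - 1..t} z)"
      by (intro continuous_intros indefinite_integral_continuous_1
          set_lebesgue_integral_eq_integral(1) ac_derivD[OF assms])
    then have "continuous_on {x - 1..x + 1} y"
    proof (rule continuous_on_eq)
      show "y (x - 1) + integral {x - 1..t} z = y t" if "t \<in> {x - 1..x + 1}" for t
        using ac_derivD(2)[OF assms, of "x - 1" t] that by (simp add: algebra_simps)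
    qed
    then show ?thesis
      by (rule continuous_on_interior) simp
  qed
  then show ?thesis
    using continuous_at_imp_continuous_on by blast
qed

lemma ac_deriv_AE_cong:
  assumes "ac_deriv y z" and ae: "AE x in lebesgue. z x = w x"
  shows "ac_deriv y w"
proof -
  have neg: "negligible {x. z x \<noteq> w x}"
  proof -
    obtain N where "negligible N" "{x. z x \<noteq> w x} \<subseteq> N"
      using ae by (auto simp: eventually_ae_filter_negligible)
    then show ?thesis by (rule negligible_subset)
  qed
  show ?thesis
    unfolding ac_deriv_def
  proof (intro allI impI conjI)
    fix a b :: real assume "a \<le> b"
    show "w absolutely_integrable_on {a..b}"
      by (rule absolutely_integrable_spike[OF ac_derivD(1)[OF assms(1)] neg]) auto
    have "integral {a..b} z = integral {a..b} w"
      by (rule integral_spike[OF neg]) auto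
    then show "y b - y a = integral {a..b} w"
      using ac_derivD(2)[OF assms(1) \<open>a \<le> b\<close>] by simp
  qed
qed

lemma ac_deriv_linear:
  assumes "ac_deriv y z" and "bounded_linear f"
  shows "ac_deriv (\<lambda>x. f (y x)) (\<lambda>x. f (z x))"
  unfolding ac_deriv_def
proof (intro allI impI conjI)
  fix a b :: real assume "a \<le> b"
  note z = ac_derivD(1)[OF assms(1), of a b]
  show "(\<lambda>x. f (z x)) absolutely_integrable_on {a..b}"
    using absolutely_integrable_linear[OF z assms(2)] by (simp add: o_def)
  have "f (y b) - f (y a) = f (integral {a..b} z)"
    using ac_derivD(2)[OF assms(1) \<open>a \<le> b\<close>] assms(2) linear_diff[OF bounded_linear.linear] by metis
  also have "\<dots> = integral {a..b} (\<lambda>x. f (z x))"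
    using integral_linear[OF set_lebesgue_integral_eq_integral(1)[OF z] assms(2)] by (simp add: o_def)
  finally show "f (y b) - f (y a) = integral {a..b} (\<lambda>x. f (z x))" .
qed

lemma ac_deriv_add:
  assumes "ac_deriv y z" and "ac_deriv u w"
  shows "ac_deriv (\<lambda>x. y x + u x) (\<lambda>x. z x + w x)"
  unfolding ac_deriv_def
proof (intro allI impI conjI)
  fix a b :: real assume "a \<le> b"
  show "(\<lambda>x. z x + w x) absolutely_integrable_on {a..b}"
    by (intro set_integral_add ac_derivD[OF assms(1)] ac_derivD[OF assms(2)])
  show "y b + u b - (y a + u a) = integral {a..b} (\<lambda>x. z x + w x)"
    using ac_derivD(2)[OF assms(1) \<open>a \<le> b\<close>] ac_derivD(2)[OF assms(2) \<open>a \<le> b\<close>]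
    by (subst Henstock_Kurzweil_Integration.integral_add)
       (auto intro!: set_lebesgue_integral_eq_integral(1) ac_derivD[OF assms(1)] ac_derivD[OF assms(2)]
         simp: algebra_simps)
qed

lemma ac_deriv_zero: "ac_deriv (\<lambda>x. c) (\<lambda>x. 0)"
  by (simp add: ac_deriv_def)

lemma ac_deriv_sum:
  assumes "\<And>i. i \<in> I \<Longrightarrow> ac_deriv (y i) (z i)"
  shows "ac_deriv (\<lambda>x. \<Sum>i\<in>I. y i x) (\<lambda>x. \<Sum>i\<in>I. z i x)"
  using assms
  by (induction I rule: infinite_finite_induct) (auto intro: ac_deriv_add ac_deriv_zero)

lemma ac_deriv_C1:
  assumes "\<And>x. (y has_vector_derivative z x) (at x)" and "continuous_on UNIV z"
  shows "ac_deriv y z"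
  unfolding ac_deriv_def
proof (intro allI impI conjI)
  fix a b :: real assume "a \<le> b"
  show "z absolutely_integrable_on {a..b}"
    using assms(2) absolutely_integrable_continuous_real continuous_on_subset by blast
  show "y b - y a = integral {a..b} z"
    by (metis \<open>a \<le> b\<close> assms(1) fundamental_theorem_of_calculus has_vector_derivative_at_within integral_unique)
qed

text \<open>
  Used for a function and for its derivative, this is the matching condition under which pieces
  of solutions of a second order equation form one function of the operator domain.
\<close>

lemma ac_deriv_glue:
  assumes yz: "ac_deriv y z" and uw: "ac_deriv u w" and "y c = u c"
  shows "ac_deriv (\<lambda>x. if x \<le> c then y x else u x) (\<lambda>x. if x \<le> c then z x else w x)"
    (is "ac_deriv ?Y ?Z")
proof -
  have left: "?Z absolutely_integrable_on {a..b} \<and> ?Y b - ?Y a = integral {a..b} ?Z"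
    if "a \<le> b" "b \<le> c" for a b
  proof -
    have "integral {a..b} ?Z = integral {a..b} z"
      using that by (intro integral_cong) auto
    moreover have "?Z absolutely_integrable_on {a..b} \<longleftrightarrow> z absolutely_integrable_on {a..b}"
      using that by (intro set_integrable_cong) auto
    ultimately show ?thesis
      using ac_derivD[OF yz] that by auto
  qed
  have right: "?Z absolutely_integrable_on {a..b} \<and> ?Y b - ?Y a = integral {a..b} ?Z"
    if "a \<le> b" "c \<le> a" for a b
  proof -
    have neg: "negligible {c}" by simp
    have "integral {a..b} ?Z = integral {a..b} w"
      using that by (intro integral_spike[OF neg]) auto
    moreover have "?Z absolutely_integrable_on {a..b}"
      by (rule absolutely_integrable_spike[OF ac_derivD(1)[OF uw] neg]) (use that in auto)
    moreover have "?Y a = u a" "?Y b = u b"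
      using that \<open>y c = u c\<close> by (auto dest: antisym)
    ultimately show ?thesis
      using ac_derivD[OF uw] that by auto
  qed
  show ?thesis
    unfolding ac_deriv_def
  proof (intro allI impI)
    fix a b :: real assume "a \<le> b"
    consider "b \<le> c" | "c \<le> a" | "a \<le> c" "c \<le> b" by linarith
    then show "?Z absolutely_integrable_on {a..b} \<and> ?Y b - ?Y a = integral {a..b} ?Z"
    proof cases
      case 3
      have Z: "?Z absolutely_integrable_on {a..b}"
        using left[OF 3(1) order_refl] right[OF 3(2) order_refl]
        by (intro absolutely_integrable_on_combine[where c = c, OF _ _ 3]) auto
      have "integral {a..b} ?Z = integral {a..c} ?Z + integral {c..b} ?Z"
        by (rule Henstock_Kurzweil_Integration.integral_combine[OF 3, symmetric])
           (rule set_lebesgue_integral_eq_integral(1)[OF Z])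
      also have "\<dots> = (?Y c - ?Y a) + (?Y b - ?Y c)"
        using left[OF 3(1) order_refl] right[OF 3(2) order_refl] by simp
      finally show ?thesis
        using Z by simp
    qed (use \<open>a \<le> b\<close> left right in auto)
  qed
qed

lemma ac_deriv_reflect:
  assumes "ac_deriv y z"
  shows "ac_deriv (\<lambda>x. y (- x)) (\<lambda>x. - z (- x))"
  unfolding ac_deriv_def
proof (intro allI impI conjI)
  fix a b :: real assume "a \<le> b"
  have "(\<lambda>x. z (- x)) absolutely_integrable_on {- (- a)..- (- b)}"
    by (subst absolutely_integrable_reflect_real) (rule ac_derivD[OF assms])
  then show "(\<lambda>x. - z (- x)) absolutely_integrable_on {a..b}"
    using set_integral_uminus[of lebesgue] by (simp add: set_integrable_def)
  have "y (- b) - y (- a) = - integral {- b..- a} z"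
    using ac_derivD(2)[OF assms, of "- b" "- a"] \<open>a \<le> b\<close> by (simp add: algebra_simps)
  also have "integral {- b..- a} z = integral {a..b} (\<lambda>x. z (- x))"
    using Henstock_Kurzweil_Integration.integral_reflect_real[of b a "\<lambda>x. z (- x)"] by simp
  finally show "y (- b) - y (- a) = integral {a..b} (\<lambda>x. - z (- x))"
    by simp
qed

lemma ac_deriv_shift:
  assumes "ac_deriv y z"
  shows "ac_deriv (\<lambda>x. y (x + c)) (\<lambda>x. z (x + c))"
  unfolding ac_deriv_def
proof (intro allI impI)
  fix a b :: real assume ab: "a \<le> b"
  have z: "z absolutely_integrable_on {a + c..b + c}"
    by (rule ac_derivD[OF assms])
  have im: "(\<lambda>x. x + c) ` {a..b} = {a + c..b + c}"
    by simp
  have der: "((\<lambda>x. x + c) has_field_derivative 1) (at x within {a..b})" for x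
    by (auto intro!: derivative_eq_intros)
  have "(\<lambda>x. \<bar>1\<bar> *\<^sub>R z (x + c)) absolutely_integrable_on {a..b} \<and>
        integral {a..b} (\<lambda>x. \<bar>1\<bar> *\<^sub>R z (x + c)) = integral {a + c..b + c} z"
    by (subst has_absolute_integral_change_of_variables_real[OF _ der]) (simp_all add: im z inj_on_def)
  then show "(\<lambda>x. z (x + c)) absolutely_integrable_on {a..b} \<and> y (b + c) - y (a + c) = integral {a..b} (\<lambda>x. z (x + c))"
    using ac_derivD(2)[OF assms, of "a + c" "b + c"] ab by simp
qed

text \<open>
  A bound on short increments adds up along a partition. With it the product rule below is
  obtained from integrals alone, without differentiability almost everywhere.
\<close>

lemma increment_bound_of_local:
  fixes r :: "real \<Rightarrow> 'b::real_normed_vector" and G :: "real \<Rightarrow> real"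
  assumes "\<delta> > 0" and "a \<le> b"
    and loc: "\<And>u v. a \<le> u \<Longrightarrow> u \<le> v \<Longrightarrow> v \<le> b \<Longrightarrow> v - u \<le> \<delta> \<Longrightarrow> norm (r v - r u) \<le> G v - G u"
  shows "norm (r b - r a) \<le> G b - G a"
proof -
  have "v - a \<le> real n * \<delta> \<Longrightarrow> a \<le> v \<Longrightarrow> v \<le> b \<Longrightarrow> norm (r v - r a) \<le> G v - G a" for n v
  proof (induction n arbitrary: v)
    case 0
    then show ?case using loc[of a a] \<open>\<delta> > 0\<close> \<open>a \<le> b\<close> by auto
  next
    case (Suc n)
    define u where "u = max a (v - \<delta>)"
    have u: "a \<le> u" "u \<le> v" "v - u \<le> \<delta>" "u - a \<le> real n * \<delta>"
      using Suc.prems \<open>\<delta> > 0\<close> by (auto simp: u_def algebra_simps max_def)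
    have "norm (r v - r a) \<le> norm (r v - r u) + norm (r u - r a)"
      by (rule norm_triangle_sub[of "r v - r a" "r u - r a", simplified, THEN order_trans]) simp
    also have "\<dots> \<le> (G v - G u) + (G u - G a)"
      using u Suc.prems by (intro add_mono loc Suc.IH) auto
    finally show ?case by simp
  qed
  moreover obtain n :: nat where "b - a \<le> real n * \<delta>"
    using real_arch_simple[of "(b - a) / \<delta>"] \<open>\<delta> > 0\<close> by (auto simp: field_simps)
  ultimately show ?thesis
    using \<open>a \<le> b\<close> by auto
qed

lemma absolutely_integrable_bilinear_continuous:
  fixes h :: "'a::euclidean_space \<Rightarrow> 'b::euclidean_space \<Rightarrow> 'c::euclidean_space"
  assumes "bounded_bilinear h" and "continuous_on {a..b::real} f" and "g absolutely_integrable_on {a..b}"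
  shows "(\<lambda>x. h (f x) (g x)) absolutely_integrable_on {a..b}"
proof -
  have "bilinear h"
    using assms(1) by (simp add: bilinear_conv_bounded_bilinear)
  moreover have "f \<in> borel_measurable (lebesgue_on {a..b})"
    by (rule continuous_imp_measurable_on_sets_lebesgue[OF assms(2)]) simp
  moreover have "bounded (f ` {a..b})"
    by (intro compact_imp_bounded compact_continuous_image assms(2)) simp
  ultimately show ?thesis
    using absolutely_integrable_bounded_measurable_product[OF _ _ _ _ assms(3)] by simp
qed

text \<open>
  The product rule. On an interval \<open>[u, v]\<close> the defect is the integral of
  \<open>h (p u - p t) (q' t) + h (p' t) (q v - q t)\<close>. If the interval is short, uniform continuity makes
  this at most \<open>\<epsilon>\<close> times the integral of \<open>|p'| + |q'|\<close>, up to a constant; summation over short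
  intervals shows that the defect on \<open>[a, b]\<close> is below every positive number.
\<close>

lemma ac_deriv_bilinear:
  fixes h :: "'a::euclidean_space \<Rightarrow> 'b::euclidean_space \<Rightarrow> 'c::euclidean_space"
  assumes h: "bounded_bilinear h" and p: "ac_deriv p p'" and q: "ac_deriv q q'"
  shows "ac_deriv (\<lambda>x. h (p x) (q x)) (\<lambda>x. h (p x) (q' x) + h (p' x) (q x))"
    (is "ac_deriv ?y ?z")
proof -
  interpret h: bounded_bilinear h by fact
  note flip = bounded_bilinear.flip[OF h]
  obtain B where B: "B > 0" "\<And>x y. norm (h x y) \<le> norm x * norm y * B"
    using h.pos_bounded by blast
  have ai1: "(\<lambda>t. h (f t) (q' t)) absolutely_integrable_on {u..v}" if "continuous_on {u..v} f" for f u v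
    by (rule absolutely_integrable_bilinear_continuous[OF h that ac_derivD(1)[OF q]])
  have ai2: "(\<lambda>t. h (p' t) (g t)) absolutely_integrable_on {u..v}" if "continuous_on {u..v} g" for g u v
    by (rule absolutely_integrable_bilinear_continuous[OF flip that ac_derivD(1)[OF p]])
  note ai = ai1 ai2
  have z: "?z absolutely_integrable_on {u..v}" for u v
    by (intro set_integral_add ai ac_deriv_continuous[OF p] ac_deriv_continuous[OF q])
  define g where "g t = norm (p' t) + norm (q' t)" for t
  have g: "g integrable_on {u..v}" for u v
    unfolding g_def
    by (intro set_lebesgue_integral_eq_integral(1) set_integral_add absolutely_integrable_norm[unfolded o_def] 
        ac_derivD[OF p] ac_derivD[OF q])
  show ?thesis
    unfolding ac_deriv_def
  proof (intro allI impI conjI z)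
    fix a b :: real assume "a \<le> b"
    define r where "r v = ?y v - integral {a..v} ?z" for v
    have small: "norm (r b - r a) \<le> \<epsilon> * (B * integral {a..b} g)" if "\<epsilon> > 0" for \<epsilon>
    proof -
      have "uniformly_continuous_on {a..b} (\<lambda>t. (p t, q t))"
        by (intro compact_uniformly_continuous continuous_on_Pair ac_deriv_continuous[OF p] ac_deriv_continuous[OF q]) auto
      then obtain \<delta> where "\<delta> > 0" and
        \<delta>: "\<And>s t. s \<in> {a..b} \<Longrightarrow> t \<in> {a..b} \<Longrightarrow> dist t s < \<delta> \<Longrightarrow> dist (p t, q t) (p s, q s) < \<epsilon>"
        using \<open>\<epsilon> > 0\<close> unfolding uniformly_continuous_on_def by meson
      have close: "norm (p s - p t) \<le> \<epsilon>" "norm (q s - q t) \<le> \<epsilon>"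
        if "s \<in> {a..b}" "t \<in> {a..b}" "\<bar>s - t\<bar> < \<delta>" for s t
        using \<delta>[of t s] dist_fst_le[of "(p s, q s)" "(p t, q t)"] dist_snd_le[of "(p s, q s)" "(p t, q t)"] that
        by (auto simp: dist_norm)
      define G where "G v = \<epsilon> * B * integral {a..v} g" for v
      have "norm (r b - r a) \<le> G b - G a"
      proof (rule increment_bound_of_local[of "\<delta> / 2"])
        fix u v assume uv: "a \<le> u" "u \<le> v" "v \<le> b" "v - u \<le> \<delta> / 2"
        note cp = ac_deriv_continuous[OF p] and cq = ac_deriv_continuous[OF q]
        have zint: "integral {a..v} ?z - integral {a..u} ?z = integral {u..v} ?z"
          using Henstock_Kurzweil_Integration.integral_combine[of a u v ?z]
            uv set_lebesgue_integral_eq_integral(1)[OF z] by (simp add: algebra_simps)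
        have gint: "integral {a..v} g - integral {a..u} g = integral {u..v} g"
          using Henstock_Kurzweil_Integration.integral_combine[of a u v g] uv g by (simp add: algebra_simps)
        have i1: "h (p u) (q v - q u) = integral {u..v} (\<lambda>t. h (p u) (q' t))"
          using ac_derivD(2)[OF ac_deriv_linear[OF q h.bounded_linear_right[of "p u"]] \<open>u \<le> v\<close>]
          by (simp add: h.diff_right)
        have i2: "h (p v - p u) (q v) = integral {u..v} (\<lambda>t. h (p' t) (q v))"
          using ac_derivD(2)[OF ac_deriv_linear[OF p h.bounded_linear_left[of "q v"]] \<open>u \<le> v\<close>]
          by (simp add: h.diff_left)
        let ?e = "\<lambda>t. h (p u - p t) (q' t) + h (p' t) (q v - q t)"
        have e: "?e integrable_on {u..v}"
          by (intro set_lebesgue_integral_eq_integral(1) set_integral_add ai continuous_intros cp cq)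
        have "r v - r u = h (p u) (q v - q u) + h (p v - p u) (q v) - integral {u..v} ?z"
          using zint by (simp add: r_def h.diff_left h.diff_right algebra_simps)
        also have "\<dots> = integral {u..v} (\<lambda>t. h (p u) (q' t) + h (p' t) (q v)) - integral {u..v} ?z"
          unfolding i1 i2
          by (subst Henstock_Kurzweil_Integration.integral_add)
             (auto intro!: ai set_lebesgue_integral_eq_integral(1) continuous_intros)
        also have "\<dots> = integral {u..v} ?e"
          by (subst Henstock_Kurzweil_Integration.integral_diff[symmetric])
             (auto intro!: ai z set_lebesgue_integral_eq_integral(1) set_integral_add continuous_intros simp: h.diff_left h.diff_right algebra_simps)
        also have "norm \<dots> \<le> integral {u..v} (\<lambda>t. \<epsilon> * B * g t)"
        proof (rule integral_norm_bound_integral[OF e])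
          show "(\<lambda>t. \<epsilon> * B * g t) integrable_on {u..v}"
            using g by (rule integrable_on_mult_right)
          fix t assume t: "t \<in> {u..v}"
          have "norm (?e t) \<le> norm (p u - p t) * norm (q' t) * B + norm (p' t) * norm (q v - q t) * B"
            by (rule norm_triangle_le, rule add_mono) (rule B)+
          also have "\<dots> \<le> \<epsilon> * norm (q' t) * B + norm (p' t) * \<epsilon> * B"
            using t uv \<open>\<delta> > 0\<close> \<open>B > 0\<close>
            by (intro add_mono mult_right_mono mult_left_mono close) auto
          finally show "norm (?e t) \<le> \<epsilon> * B * g t"
            by (simp add: g_def algebra_simps)
        qed
        also have "\<dots> = G v - G u"
          using gint by (simp add: G_def flip: right_diff_distrib)
        finally show "norm (r v - r u) \<le> G v - G u" .
      qed (use \<open>\<delta> > 0\<close> \<open>a \<le> b\<close> in auto)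
      then show ?thesis by (simp add: G_def)
    qed
    have "norm (r b - r a) \<le> 0"
    proof (rule field_le_epsilon)
      fix e :: real assume "e > 0"
      define K where "K = \<bar>B * integral {a..b} g\<bar> + 1"
      have K: "K > 0" "B * integral {a..b} g \<le> K" unfolding K_def by linarith+
      have "norm (r b - r a) \<le> e / K * (B * integral {a..b} g)"
        using \<open>e > 0\<close> K by (intro small) auto
      also have "\<dots> \<le> e / K * K"
        using K \<open>e > 0\<close> by (intro mult_left_mono) auto
      finally show "norm (r b - r a) \<le> 0 + e"
        using K by simp
    qed
    then show "?y b - ?y a = integral {a..b} ?z"
      by (simp add: r_def algebra_simps)
  qed
qed

section \<open>Solutions for large real spectral parameter\<close>

lemma bounded_bilinear_matrix_vector_mult:
  "bounded_bilinear ((*v) :: complex ^ 'n ^ 'k \<Rightarrow> complex ^ 'n \<Rightarrow> complex ^ 'k)"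
proof -
  have "(r *\<^sub>R A) *v x = r *\<^sub>R (A *v x)" "A *v (r *\<^sub>R x) = r *\<^sub>R (A *v x)"
    for r and A :: "complex ^ 'n ^ 'k" and x
    by (simp_all add: vec_eq_iff matrix_vector_mult_def scaleR_sum_right)
  then have "bilinear ((*v) :: complex ^ 'n ^ 'k \<Rightarrow> complex ^ 'n \<Rightarrow> complex ^ 'k)"
    by (simp add: bilinear_def linear_iff matrix_vector_mult_add_rdistrib matrix_vector_right_distrib)
  then show ?thesis
    by (simp add: bilinear_conv_bounded_bilinear)
qed

interpretation matvec: bounded_bilinear "(*v) :: complex ^ 'n ^ 'k \<Rightarrow> complex ^ 'n \<Rightarrow> complex ^ 'k"
  by (rule bounded_bilinear_matrix_vector_mult)

definition primitive :: "(real \<Rightarrow> 'b::euclidean_space) \<Rightarrow> real \<Rightarrow> 'b" where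
  "primitive g x = (if 0 \<le> x then integral {0..x} g else - integral {x..0} g)"

lemma primitive_0 [simp]: "primitive g 0 = 0"
  by (simp add: primitive_def)

lemma ac_deriv_primitive:
  assumes "\<And>a b. g absolutely_integrable_on {a..b}"
  shows "ac_deriv (primitive g) g"
  unfolding ac_deriv_def
proof (intro allI impI conjI assms)
  fix a b :: real assume "a \<le> b"
  note comb = Henstock_Kurzweil_Integration.integral_combine[OF _ _ set_lebesgue_integral_eq_integral(1)[OF assms]]
  consider "0 \<le> a" | "a < 0" "0 \<le> b" | "b < 0" by linarith
  then show "primitive g b - primitive g a = integral {a..b} g"
    using \<open>a \<le> b\<close> comb[of 0 a b] comb[of a 0 b] comb[of a b 0]
    by cases (auto simp: primitive_def algebra_simps)
qed

lemma norm_primitive_le: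
  assumes g: "\<And>a b. g absolutely_integrable_on {a..b}" and h: "h integrable_on UNIV"
    and le: "\<And>x. norm (g x) \<le> h x"
  shows "norm (primitive g x) \<le> integral UNIV h"
proof -
  have h0: "h x \<ge> 0" for x
    using le[of x] norm_ge_zero order_trans by blast
  have "norm (integral {a..b} g) \<le> integral UNIV h" for a b
  proof -
    have hab: "h integrable_on {a..b}"
      using h integrable_on_subinterval by blast
    have "norm (integral {a..b} g) \<le> integral {a..b} h"
      by (rule integral_norm_bound_integral) (use hab le set_lebesgue_integral_eq_integral(1)[OF g] in auto)
    also have "\<dots> \<le> integral UNIV h"
      by (rule integral_subset_le) (use hab h h0 in auto)
    finally show ?thesis .
  qed
  then show ?thesis by (simp add: primitive_def)
qed

lemma primitive_diff:
  assumes "\<And>a b. f absolutely_integrable_on {a..b}" "\<And>a b. g absolutely_integrable_on {a..b}"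
  shows "primitive f x - primitive g x = primitive (\<lambda>t. f t - g t) x"
proof -
  have "integral {a..b} (\<lambda>t. f t - g t) = integral {a..b} f - integral {a..b} g" for a b
    by (rule Henstock_Kurzweil_Integration.integral_diff) (intro set_lebesgue_integral_eq_integral(1) assms)+
  then show ?thesis by (simp add: primitive_def)
qed

lemma ac_deriv_scaleR:
  assumes "ac_deriv p p'" and "ac_deriv q q'"
  shows "ac_deriv (\<lambda>x. p x *\<^sub>R q x) (\<lambda>x. p x *\<^sub>R q' x + p' x *\<^sub>R q x)"
  by (rule ac_deriv_bilinear[OF bounded_bilinear_scaleR assms])

lemma ac_deriv_uminus: "ac_deriv y z \<Longrightarrow> ac_deriv (\<lambda>x. - y x) (\<lambda>x. - z x)"
  by (rule ac_deriv_linear[OF _ bounded_linear_minus[OF bounded_linear_ident]])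

lemma ac_deriv_sin: "ac_deriv (\<lambda>x. sin (s * x)) (\<lambda>x. s * cos (s * x))"
  by (rule ac_deriv_C1)
     (auto intro!: continuous_intros derivative_eq_intros simp flip: has_real_derivative_iff_has_vector_derivative)

lemma ac_deriv_cos: "ac_deriv (\<lambda>x. cos (s * x)) (\<lambda>x. - s * sin (s * x))"
  by (rule ac_deriv_C1)
     (auto intro!: continuous_intros derivative_eq_intros simp flip: has_real_derivative_iff_has_vector_derivative)

text \<open>
  Duhamel's formula. The kernel \<open>sin (s (x - t)) / s\<close> is expanded by the addition theorem, so that
  \<open>x\<close> does not occur under the integrals and the product rule suffices to differentiate.
\<close>

lemma ac_deriv_variation_of_constants:
  fixes g :: "real \<Rightarrow> 'b::euclidean_space" and a b :: 'b and s :: real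
  assumes g: "\<And>a b. g absolutely_integrable_on {a..b}" and "s > 0"
  defines "C \<equiv> primitive (\<lambda>t. cos (s * t) *\<^sub>R g t)" and "S \<equiv> primitive (\<lambda>t. sin (s * t) *\<^sub>R g t)"
  assumes y_def: "y = (\<lambda>x. cos (s * x) *\<^sub>R a + sin (s * x) *\<^sub>R b + (1 / s) *\<^sub>R (sin (s * x) *\<^sub>R C x - cos (s * x) *\<^sub>R S x))"
  assumes y'_def: "y' = (\<lambda>x. s *\<^sub>R (cos (s * x) *\<^sub>R b - sin (s * x) *\<^sub>R a) + (cos (s * x) *\<^sub>R C x + sin (s * x) *\<^sub>R S x))"
  shows "ac_deriv y y'" and "ac_deriv y' (\<lambda>x. g x - s\<^sup>2 *\<^sub>R y x)"
proof -
  have C: "ac_deriv C (\<lambda>t. cos (s * t) *\<^sub>R g t)" and S: "ac_deriv S (\<lambda>t. sin (s * t) *\<^sub>R g t)"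
    unfolding C_def S_def
    by (intro ac_deriv_primitive absolutely_integrable_bilinear_continuous[OF bounded_bilinear_scaleR _ g] continuous_intros)+
  have const: "ac_deriv (\<lambda>x. v) (\<lambda>x. 0)" for v :: 'b by (rule ac_deriv_zero)
  have scale: "ac_deriv f f' \<Longrightarrow> ac_deriv (\<lambda>x. r *\<^sub>R f x) (\<lambda>x. r *\<^sub>R f' x)" for r and f f' :: "real \<Rightarrow> 'b"
    by (rule ac_deriv_linear[OF _ bounded_linear_scaleR_right])
  note rules = ac_deriv_add ac_deriv_scaleR ac_deriv_sin ac_deriv_cos C S const scale ac_deriv_uminus
  have cs: "cos t * cos t + sin t * sin t = 1" for t :: real
    using sin_cos_squared_add3[of t] by simp
  have "ac_deriv y (\<lambda>x. (cos (s * x) *\<^sub>R 0 + (- s * sin (s * x)) *\<^sub>R a) + (sin (s * x) *\<^sub>R 0 + (s * cos (s * x)) *\<^sub>R b)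
     + (1 / s) *\<^sub>R ((sin (s * x) *\<^sub>R (cos (s * x) *\<^sub>R g x) + (s * cos (s * x)) *\<^sub>R C x)
       + - (cos (s * x) *\<^sub>R (sin (s * x) *\<^sub>R g x) + (- s * sin (s * x)) *\<^sub>R S x)))"
    unfolding y_def diff_conv_add_uminus by (intro rules)
  moreover have "\<dots> = y'"
  proof
    fix x
    let ?c = "cos (s * x)" and ?s = "sin (s * x)"
    have "(1 / s) *\<^sub>R ((?s *\<^sub>R (?c *\<^sub>R g x) + (s * ?c) *\<^sub>R C x) + - (?c *\<^sub>R (?s *\<^sub>R g x) + (- s * ?s) *\<^sub>R S x))
       = ?c *\<^sub>R C x + ?s *\<^sub>R S x"
      using \<open>s > 0\<close> by (simp add: scaleR_add_right mult.commute)
    then show "(?c *\<^sub>R 0 + (- s * ?s) *\<^sub>R a) + (?s *\<^sub>R 0 + (s * ?c) *\<^sub>R b)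
     + (1 / s) *\<^sub>R ((?s *\<^sub>R (?c *\<^sub>R g x) + (s * ?c) *\<^sub>R C x)
       + - (?c *\<^sub>R (?s *\<^sub>R g x) + (- s * ?s) *\<^sub>R S x)) = y' x"
      by (simp only: y'_def) (simp add: scaleR_diff_right)
  qed
  ultimately show "ac_deriv y y'" by (rule back_subst[of "ac_deriv y"])
  have "ac_deriv y' (\<lambda>x. s *\<^sub>R ((cos (s * x) *\<^sub>R 0 + (- s * sin (s * x)) *\<^sub>R b) + - (sin (s * x) *\<^sub>R 0 + (s * cos (s * x)) *\<^sub>R a))
     + ((cos (s * x) *\<^sub>R (cos (s * x) *\<^sub>R g x) + (- s * sin (s * x)) *\<^sub>R C x)
       + (sin (s * x) *\<^sub>R (sin (s * x) *\<^sub>R g x) + (s * cos (s * x)) *\<^sub>R S x)))"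
    unfolding y'_def diff_conv_add_uminus by (intro rules)
  moreover have "\<dots> = (\<lambda>x. g x - s\<^sup>2 *\<^sub>R y x)"
  proof
    fix x
    let ?c = "cos (s * x)" and ?s = "sin (s * x)"
    have 1: "?c *\<^sub>R (?c *\<^sub>R g x) + ?s *\<^sub>R (?s *\<^sub>R g x) = g x"
      using cs[of "s * x"] by (simp flip: scaleR_add_left)
    have 2: "s\<^sup>2 *\<^sub>R y x = s *\<^sub>R (s *\<^sub>R (?c *\<^sub>R a + ?s *\<^sub>R b)) + s *\<^sub>R (?s *\<^sub>R C x - ?c *\<^sub>R S x)"
      using \<open>s > 0\<close> by (simp add: y_def scaleR_add_right power2_eq_square mult.assoc)
    have "s *\<^sub>R ((?c *\<^sub>R 0 + (- s * ?s) *\<^sub>R b) + - (?s *\<^sub>R 0 + (s * ?c) *\<^sub>R a))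
     + ((?c *\<^sub>R (?c *\<^sub>R g x) + (- s * ?s) *\<^sub>R C x) + (?s *\<^sub>R (?s *\<^sub>R g x) + (s * ?c) *\<^sub>R S x))
     = (?c *\<^sub>R (?c *\<^sub>R g x) + ?s *\<^sub>R (?s *\<^sub>R g x)) - (s *\<^sub>R (s *\<^sub>R (?c *\<^sub>R a + ?s *\<^sub>R b)) + s *\<^sub>R (?s *\<^sub>R C x - ?c *\<^sub>R S x))"
      by (simp add: scaleR_add_right scaleR_diff_right)
    then show "s *\<^sub>R ((?c *\<^sub>R 0 + (- s * ?s) *\<^sub>R b) + - (?s *\<^sub>R 0 + (s * ?c) *\<^sub>R a))
     + ((?c *\<^sub>R (?c *\<^sub>R g x) + (- s * ?s) *\<^sub>R C x) + (?s *\<^sub>R (?s *\<^sub>R g x) + (s * ?c) *\<^sub>R S x)) = g x - s\<^sup>2 *\<^sub>R y x"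
      unfolding 1 2 .
  qed
  ultimately show "ac_deriv y' (\<lambda>x. g x - s\<^sup>2 *\<^sub>R y x)"
    by (rule back_subst[of "ac_deriv y'"])
qed

text \<open>
  With \<open>g = W y\<close>, Duhamel's formula is a fixed point equation for \<open>y\<close>. Its linear part carries the
  factor \<open>1 / s\<close> and is controlled by the \<open>L\<^sub>1\<close> norm of \<open>W\<close>, so for large \<open>s\<close> it is a contraction of
  the bounded continuous functions on the line. The same estimate, applied to the fixed point,
  gives the distance \<open>O(1/s)\<close> to the solution for \<open>W = 0\<close>.
\<close>

lemma schroedinger_solution:
  fixes W :: "real \<Rightarrow> complex ^ 'm ^ 'm"
  assumes W: "W absolutely_integrable_on UNIV"
  obtains K where "K \<ge> 0" and
    "\<And>s a b. s > 0 \<Longrightarrow> K \<le> s \<Longrightarrow> \<exists>y y'. ac_deriv y y' \<and> ac_deriv y' (\<lambda>x. W x *v y x - s\<^sup>2 *\<^sub>R y x) \<and>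
     y 0 = a \<and> y' 0 = s *\<^sub>R b \<and>
     (\<forall>x. norm (y x - (cos (s * x) *\<^sub>R a + sin (s * x) *\<^sub>R b)) \<le> K / s * (norm a + norm b)) \<and>
     (\<forall>x. norm (y' x - s *\<^sub>R (cos (s * x) *\<^sub>R b - sin (s * x) *\<^sub>R a)) \<le> K * (norm a + norm b))"
proof -
  obtain B where B: "B > 0" "\<And>(A :: complex ^ 'm ^ 'm) x. norm (A *v x) \<le> norm A * norm x * B"
    using matvec.pos_bounded by blast
  have nW: "(\<lambda>t. norm (W t)) integrable_on UNIV"
    using absolutely_integrable_norm[OF W] by (auto simp: o_def dest: set_lebesgue_integral_eq_integral(1))
  \<comment> \<open>the bound for the integral operators with kernels \<open>cos (s t) W t\<close> and \<open>sin (s t) W t\<close>\<close>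
  define I where "I = B * integral UNIV (\<lambda>t. norm (W t))"
  have "I \<ge> 0" using B(1) by (simp add: I_def integral_nonneg nW)
  define F where "F \<phi> y = primitive (\<lambda>t. \<phi> t *\<^sub>R (W t *v y t))" for \<phi> :: "real \<Rightarrow> real" and y :: "real \<Rightarrow> complex ^ 'm"
  have ai: "(\<lambda>t. W t *v y t) absolutely_integrable_on {a..b}" if "continuous_on UNIV y" for a b y
    by (rule absolutely_integrable_bilinear_continuous[OF bounded_bilinear.flip[OF bounded_bilinear_matrix_vector_mult]])
       (use that continuous_on_subset absolutely_integrable_on_subinterval[OF W] in auto)
  have ai': "(\<lambda>t. \<phi> t *\<^sub>R (W t *v y t)) absolutely_integrable_on {a..b}" if "continuous_on UNIV y" "continuous_on UNIV \<phi>" for a b y \<phi>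
    by (rule absolutely_integrable_bilinear_continuous[OF bounded_bilinear_scaleR continuous_on_subset[OF that(2)] ai[OF that(1)]]) simp
  have F_bound: "norm (F \<phi> y x) \<le> I * M"
    if "continuous_on UNIV y" "continuous_on UNIV \<phi>" "\<And>x. \<bar>\<phi> x\<bar> \<le> 1" "\<And>x. norm (y x) \<le> M" for \<phi> y M x
  proof -
    have "norm (F \<phi> y x) \<le> integral UNIV (\<lambda>t. norm (W t) * (M * B))"
      unfolding F_def
    proof (rule norm_primitive_le)
      show "(\<lambda>t. norm (W t) * (M * B)) integrable_on UNIV"
        using nW by (rule integrable_on_mult_left)
      fix t
      have "M \<ge> 0" using that(4)[of 0] norm_ge_zero order_trans by blast
      have "norm (\<phi> t *\<^sub>R (W t *v y t)) \<le> 1 * (norm (W t) * norm (y t) * B)"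
        unfolding norm_scaleR by (intro mult_mono that B) auto
      also have "\<dots> \<le> 1 * (norm (W t) * M * B)"
        using B(1) \<open>M \<ge> 0\<close> by (intro mult_mono that) auto
      finally show "norm (\<phi> t *\<^sub>R (W t *v y t)) \<le> norm (W t) * (M * B)" by (simp add: mult.assoc)
    qed (rule ai'[OF that(1,2)])
    then show ?thesis by (simp add: I_def mult.commute mult.left_commute)
  qed
  have F_diff: "F \<phi> y x - F \<phi> z x = F \<phi> (\<lambda>t. y t - z t) x"
    if "continuous_on UNIV y" "continuous_on UNIV z" "continuous_on UNIV \<phi>" for \<phi> y z x
    unfolding F_def by (subst primitive_diff) (use that in \<open>auto intro!: ai' simp: matvec.diff_right scaleR_diff_right\<close>)
  have F_cont: "continuous_on UNIV (F \<phi> y)" if "continuous_on UNIV y" "continuous_on UNIV \<phi>" for \<phi> y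
    unfolding F_def by (rule ac_deriv_continuous[OF ac_deriv_primitive[OF ai'[OF that]]])
  \<comment> \<open>one factor 2 for the two integrals in \<open>G\<close>, one for the Lipschitz constant \<open>1/2\<close>\<close>
  define K where "K = 4 * I"
  show thesis
  proof (rule that[of K])
    show "0 \<le> K" using \<open>I \<ge> 0\<close> by (simp add: K_def)
    fix s :: real and a b :: "complex ^ 'm"
    assume s: "s > 0" "K \<le> s"
    define c where "c x = cos (s * x)" for x
    define d where "d x = sin (s * x)" for x
    have cd: "continuous_on UNIV c" "continuous_on UNIV d" "\<And>x. \<bar>c x\<bar> \<le> 1" "\<And>x. \<bar>d x\<bar> \<le> 1"
      by (auto simp: c_def d_def intro!: continuous_intros)
    define y0 where "y0 x = c x *\<^sub>R a + d x *\<^sub>R b" for x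
    define G where "G y x = d x *\<^sub>R F c y x - c x *\<^sub>R F d y x" for y x
    define H where "H y x = c x *\<^sub>R F c y x + d x *\<^sub>R F d y x" for y x
    define T where "T y x = y0 x + (1 / s) *\<^sub>R G y x" for y x
    have prod_le: "norm (p *\<^sub>R u) \<le> N" if "\<bar>p\<bar> \<le> 1" "norm u \<le> N" for p u and N :: real
      using mult_mono[OF that] by (simp add: that)
    have G_bound: "norm (G y x) \<le> 2 * I * M" and H_bound: "norm (H y x) \<le> 2 * I * M"
      if "continuous_on UNIV y" "\<And>x. norm (y x) \<le> M" for y M x
    proof -
      have "norm (d x *\<^sub>R F c y x) + norm (c x *\<^sub>R F d y x) \<le> I * M + I * M"
           "norm (c x *\<^sub>R F c y x) + norm (d x *\<^sub>R F d y x) \<le> I * M + I * M"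
        by (intro add_mono prod_le cd F_bound that)+
      then show "norm (G y x) \<le> 2 * I * M" "norm (H y x) \<le> 2 * I * M"
        using norm_triangle_ineq4[of "d x *\<^sub>R F c y x" "c x *\<^sub>R F d y x"]
          norm_triangle_ineq[of "c x *\<^sub>R F c y x" "d x *\<^sub>R F d y x"] by (auto simp: G_def H_def)
    qed
    have y0_bound: "norm (y0 x) \<le> norm a + norm b" for x
      unfolding y0_def by (rule norm_triangle_le) (intro add_mono prod_le cd order_refl)
    have T_bcont: "T (apply_bcontfun y) \<in> bcontfun" for y :: "real \<Rightarrow>\<^sub>C (complex ^ 'm)"
    proof (rule bcontfun_normI)
      show "continuous_on UNIV (T (apply_bcontfun y))"
        unfolding T_def G_def y0_def by (intro continuous_intros cd F_cont continuous_on_apply_bcontfun)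
      show "norm (T (apply_bcontfun y) x) \<le> norm a + norm b + (1 / s) * (2 * I * norm y)" for x
        unfolding T_def
        by (rule norm_triangle_le, rule add_mono[OF y0_bound])
           (use s G_bound[of "apply_bcontfun y" "norm y" x] in \<open>auto simp: norm_bounded field_simps\<close>)
    qed
    define \<T> where "\<T> y = Bcontfun (T (apply_bcontfun y))" for y :: "real \<Rightarrow>\<^sub>C (complex ^ 'm)"
    have app: "apply_bcontfun (\<T> y) = T (apply_bcontfun y)" for y
      by (simp add: \<T>_def Bcontfun_inverse T_bcont)
    have "\<exists>!y. \<T> y = y"
    proof (rule banach_fix_type[of "1 / 2"])
      show "\<forall>y z. dist (\<T> y) (\<T> z) \<le> 1 / 2 * dist y z"
      proof (intro allI dist_bound)
        fix y z :: "real \<Rightarrow>\<^sub>C (complex ^ 'm)" and x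
        have cont: "continuous_on UNIV (apply_bcontfun y)" "continuous_on UNIV (apply_bcontfun z)"
          by (rule continuous_on_apply_bcontfun)+
        have "T (apply_bcontfun y) x - T (apply_bcontfun z) x
           = (1 / s) *\<^sub>R (d x *\<^sub>R (F c (apply_bcontfun y) x - F c (apply_bcontfun z) x) - c x *\<^sub>R (F d (apply_bcontfun y) x - F d (apply_bcontfun z) x))"
          by (simp add: T_def G_def scaleR_diff_right)
        also have "\<dots> = (1 / s) *\<^sub>R G (\<lambda>t. apply_bcontfun y t - apply_bcontfun z t) x"
          by (simp add: F_diff cont cd G_def)
        finally have "dist (\<T> y x) (\<T> z x) = (1 / s) * norm (G (\<lambda>t. apply_bcontfun y t - apply_bcontfun z t) x)"
          using s by (simp add: app dist_norm)
        also have "\<dots> \<le> (1 / s) * (2 * I * dist y z)"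
          using s dist_bounded[of y _ z]
          by (intro mult_left_mono G_bound continuous_intros cont) (auto simp: dist_norm)
        also have "\<dots> = (K / s) * (1 / 2 * dist y z)"
          by (simp add: K_def)
        also have "\<dots> \<le> 1 * (1 / 2 * dist y z)"
          using s by (intro mult_right_mono) auto
        finally show "dist (\<T> y x) (\<T> z x) \<le> 1 / 2 * dist y z" by simp
      qed
    qed auto
    then obtain Y where Y: "\<T> Y = Y" by blast
    define y where "y = apply_bcontfun Y"
    have y: "y x = T y x" for x
      using Y app[of Y] by (simp add: y_def)
    have cy: "continuous_on UNIV y" unfolding y_def by (rule continuous_on_apply_bcontfun)
    define y' where "y' x = s *\<^sub>R (c x *\<^sub>R b - d x *\<^sub>R a) + H y x" for x
    have yM: "norm (y x) \<le> norm Y" for x by (simp add: y_def norm_bounded)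
    have Ys: "(1 / s) * (2 * I * norm Y) \<le> norm Y / 2"
    proof -
      have "(1 / s) * (2 * I * norm Y) = (K / s) * (norm Y / 2)" by (simp add: K_def)
      also have "\<dots> \<le> 1 * (norm Y / 2)" using s by (intro mult_right_mono) auto
      finally show ?thesis by simp
    qed
    have "norm Y \<le> norm a + norm b + norm Y / 2"
    proof (rule norm_bound)
      fix x
      have "norm (T y x) \<le> (norm a + norm b) + (1 / s) * (2 * I * norm Y)"
        unfolding T_def
        by (rule norm_triangle_le, rule add_mono[OF y0_bound])
           (use s G_bound[OF cy yM, of x] in \<open>auto simp: field_simps\<close>)
      then show "norm (Y x) \<le> norm a + norm b + norm Y / 2"
        using y[of x] Ys by (simp add: y_def)
    qed
    then have Y2: "norm Y \<le> 2 * (norm a + norm b)" by simp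
    have IY: "2 * I * norm Y \<le> K * (norm a + norm b)"
      using mult_left_mono[OF Y2, of "2 * I"] \<open>I \<ge> 0\<close> by (simp add: K_def algebra_simps)
    have aci: "\<And>a b. (\<lambda>t. W t *v y t) absolutely_integrable_on {a..b}"
      by (rule ai[OF cy])
    have y_eq: "(\<lambda>x. cos (s * x) *\<^sub>R a + sin (s * x) *\<^sub>R b + (1 / s) *\<^sub>R (sin (s * x) *\<^sub>R primitive (\<lambda>t. cos (s * t) *\<^sub>R (W t *v y t)) x
         - cos (s * x) *\<^sub>R primitive (\<lambda>t. sin (s * t) *\<^sub>R (W t *v y t)) x)) = y"
    proof
      fix x
      show "cos (s * x) *\<^sub>R a + sin (s * x) *\<^sub>R b + (1 / s) *\<^sub>R (sin (s * x) *\<^sub>R primitive (\<lambda>t. cos (s * t) *\<^sub>R (W t *v y t)) x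
         - cos (s * x) *\<^sub>R primitive (\<lambda>t. sin (s * t) *\<^sub>R (W t *v y t)) x) = y x"
        unfolding y[of x] by (simp add: T_def y0_def G_def F_def c_def d_def)
    qed
    have y'_eq: "(\<lambda>x. s *\<^sub>R (cos (s * x) *\<^sub>R b - sin (s * x) *\<^sub>R a) + (cos (s * x) *\<^sub>R primitive (\<lambda>t. cos (s * t) *\<^sub>R (W t *v y t)) x
         + sin (s * x) *\<^sub>R primitive (\<lambda>t. sin (s * t) *\<^sub>R (W t *v y t)) x)) = y'"
      by (simp add: fun_eq_iff y'_def H_def F_def c_def d_def)
    note ode = ac_deriv_variation_of_constants[OF aci s(1) y_eq[symmetric] y'_eq[symmetric]]
    show "\<exists>y y'. ac_deriv y y' \<and> ac_deriv y' (\<lambda>x. W x *v y x - s\<^sup>2 *\<^sub>R y x) \<and>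
     y 0 = a \<and> y' 0 = s *\<^sub>R b \<and>
     (\<forall>x. norm (y x - (cos (s * x) *\<^sub>R a + sin (s * x) *\<^sub>R b)) \<le> K / s * (norm a + norm b)) \<and>
     (\<forall>x. norm (y' x - s *\<^sub>R (cos (s * x) *\<^sub>R b - sin (s * x) *\<^sub>R a)) \<le> K * (norm a + norm b))"
    proof (rule exI[of _ y], rule exI[of _ y'], intro conjI allI ode)
      show "y 0 = a"
        unfolding y[of 0] by (simp add: T_def y0_def G_def F_def c_def d_def)
      show "y' 0 = s *\<^sub>R b"
        by (simp add: y'_def H_def F_def c_def d_def)
      fix x
      have "norm (y x - y0 x) = (1 / s) * norm (G y x)"
        unfolding y[of x] using s by (simp add: T_def)
      also have "\<dots> \<le> (1 / s) * (K * (norm a + norm b))"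
        using s order_trans[OF G_bound[OF cy yM] IY] by (intro mult_left_mono) auto
      finally show "norm (y x - (cos (s * x) *\<^sub>R a + sin (s * x) *\<^sub>R b)) \<le> K / s * (norm a + norm b)"
        by (simp add: y0_def c_def d_def)
      show "norm (y' x - s *\<^sub>R (cos (s * x) *\<^sub>R b - sin (s * x) *\<^sub>R a)) \<le> K * (norm a + norm b)"
        using order_trans[OF H_bound[OF cy yM] IY] by (simp add: y'_def c_def d_def)
    qed
  qed
qed

section \<open>A real determinant and unimodular multipliers\<close>

definition conj_mat :: "complex ^ 'n ^ 'k \<Rightarrow> complex ^ 'n ^ 'k" where
  "conj_mat A = (\<chi> i j. cnj (A $ i $ j))"

text \<open>
  The diagonal of \<open>S = diag(1, -1)\<close>: the reflection \<open>x \<mapsto> -x\<close> keeps the values of a function, which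
  are indexed by \<open>Inl\<close>, and changes the sign of its derivatives, indexed by \<open>Inr\<close>.
\<close>

definition flip_sign :: "'m + 'm \<Rightarrow> complex" where
  "flip_sign k = (case k of Inl _ \<Rightarrow> 1 | Inr _ \<Rightarrow> - 1)"

text \<open>
  The matrix \<open>S (cnj A) S\<close>. If \<open>A\<close> transports data from \<open>0\<close> to \<open>h\<close>, then this matrix transports them
  from \<open>0\<close> to \<open>-h\<close> when the equation is invariant under \<open>y \<mapsto> (x \<mapsto> cnj (y (-x)))\<close>.
\<close>

definition time_reverse :: "complex ^ ('m::finite + 'm) ^ ('m + 'm) \<Rightarrow> complex ^ ('m + 'm) ^ ('m + 'm)" where
  "time_reverse A = (\<chi> i j. flip_sign i * cnj (A $ i $ j) * flip_sign j)"

text \<open>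
  For \<open>c = cos (\<omega> h)\<close> and \<open>s = sin (\<omega> h)\<close> this transports the data \<open>(y, y'/\<omega>)\<close> of solutions of
  \<open>-y'' = \<omega>\<^sup>2 y\<close> from \<open>0\<close> to \<open>h\<close>.
\<close>

definition rotation_block :: "real \<Rightarrow> real \<Rightarrow> complex ^ ('m::finite + 'm) ^ ('m + 'm)" where
  "rotation_block c s = (\<chi> i j. case i of
     Inl p \<Rightarrow> (case j of Inl q \<Rightarrow> if p = q then complex_of_real c else 0 | Inr q \<Rightarrow> if p = q then complex_of_real s else 0)
   | Inr p \<Rightarrow> (case j of Inl q \<Rightarrow> if p = q then - complex_of_real s else 0 | Inr q \<Rightarrow> if p = q then complex_of_real c else 0))"

lemma flip_sign_square [simp]: "flip_sign k * flip_sign k = 1" "cnj (flip_sign k) = flip_sign k"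
  by (auto simp: flip_sign_def split: sum.split)

lemma det_cnj:
  fixes A :: "complex ^ 'n ^ 'n"
  shows "det (\<chi> i j. cnj (A $ i $ j)) = cnj (det A)"
  by (simp add: det_def)

lemma det_flip:
  fixes A :: "complex ^ ('m::finite + 'm) ^ ('m + 'm)"
  shows "det (\<chi> i j. flip_sign i * A $ i $ j * flip_sign j) = det A"
proof -
  let ?P = "(\<Prod>i\<in>(UNIV::('m + 'm) set). flip_sign i)"
  have "det (\<chi> i j. flip_sign i * A $ i $ j * flip_sign j)
      = det (\<chi> i. flip_sign i *s (\<chi> j. A $ i $ j * flip_sign j))"
    by (simp add: vector_scalar_mult_def mult.assoc)
  also have "\<dots> = ?P * det (\<chi> i j. A $ i $ j * flip_sign j)"
    by (rule det_rows_mul)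
  also have "det (\<chi> i j. A $ i $ j * flip_sign j) = det (transpose (\<chi> i j. A $ i $ j * flip_sign j))"
    by (simp add: det_transpose)
  also have "transpose (\<chi> i j. A $ i $ j * flip_sign j) = (\<chi> i. flip_sign i *s (transpose A $ i))"
    by (simp add: transpose_def vec_eq_iff vector_scalar_mult_def mult.commute)
  also have "det \<dots> = ?P * det (transpose A)"
    by (subst det_rows_mul) (simp add: vec_lambda_eta)
  also have "?P * (?P * det (transpose A)) = (?P * ?P) * det A"
    by (simp add: det_transpose)
  also have "?P * ?P = 1"
    by (simp flip: prod.distrib)
  finally show ?thesis by simp
qed

lemma det_uminus_even:
  fixes A :: "complex ^ ('m::finite + 'm) ^ ('m + 'm)"
  shows "det (- A) = det A"
proof -
  have "det (- A) = det (\<chi> i. (- 1) *s (A $ i))"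
    by (rule arg_cong[of _ _ det]) (simp add: vec_eq_iff)
  also have "\<dots> = (\<Prod>i\<in>(UNIV::('m + 'm) set). - 1) * det A"
    by (subst det_rows_mul) (simp add: vec_lambda_eta)
  also have "(\<Prod>i\<in>(UNIV::('m + 'm) set). - 1 :: complex) = 1"
    by simp
  finally show ?thesis by simp
qed

text \<open>
  Zeros \<open>t\<close> correspond to vectors with \<open>A v = cis (2 t) *s (time_reverse A *v v)\<close>. Dividing the
  multiplier symmetrically between the two terms is what makes the determinant real.
\<close>

definition floquet_det :: "complex ^ ('m::finite + 'm) ^ ('m + 'm) \<Rightarrow> real \<Rightarrow> complex" where
  "floquet_det A t = det (\<chi> i j. cis t * time_reverse A $ i $ j - cis (- t) * A $ i $ j)"

text \<open>
  Conjugating the entries and then conjugating with \<open>S\<close> exchanges the two terms of the matrix, that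
  is, multiplies it by \<open>-1\<close>, which an even-dimensional determinant does not notice.
\<close>

lemma floquet_det_real: "cnj (floquet_det A t) = floquet_det A t"
proof -
  let ?M = "\<chi> i j. cis t * time_reverse A $ i $ j - cis (- t) * A $ i $ j"
  let ?N = "\<chi> i j. cnj (?M $ i $ j)"
  have "cnj (floquet_det A t) = det ?N"
    by (simp add: floquet_det_def flip: det_cnj)
  also have "\<dots> = det (\<chi> i j. flip_sign i * ?N $ i $ j * flip_sign j)"
    by (rule det_flip[symmetric])
  also have "(\<chi> i j. flip_sign i * ?N $ i $ j * flip_sign j) = - ?M"
  proof -
    have "flip_sign i * (cis (- t) * (flip_sign i * a * flip_sign j) - cis t * b) * flip_sign j
       = - (cis t * (flip_sign i * b * flip_sign j) - cis (- t) * a)" for a b and i j :: "'a + 'a"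
      by (simp add: flip_sign_def algebra_simps split: sum.split)
    then show ?thesis
      by (simp add: vec_eq_iff time_reverse_def cis_cnj)
  qed
  also have "det (- ?M) = floquet_det A t"
    by (simp add: det_uminus_even floquet_det_def)
  finally show ?thesis .
qed

lemma continuous_on_det:
  fixes f :: "'a::topological_space \<Rightarrow> complex ^ 'n ^ 'n"
  assumes "continuous_on S f"
  shows "continuous_on S (\<lambda>x. det (f x))"
  unfolding det_def by (intro continuous_intros assms)

lemma det_uniform_close:
  fixes R \<epsilon> :: real
  assumes "\<epsilon> > 0"
  shows "\<exists>\<eta>>0. \<forall>X Y :: complex ^ 'n ^ 'n. norm X \<le> R \<longrightarrow> norm Y \<le> R \<longrightarrow> norm (X - Y) < \<eta> \<longrightarrow>
     norm (det X - det Y) < \<epsilon>"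
proof -
  have "uniformly_continuous_on (cball 0 R) (det :: complex ^ 'n ^ 'n \<Rightarrow> complex)"
    by (intro compact_uniformly_continuous continuous_on_det continuous_on_id) auto
  then obtain \<eta> where "\<eta> > 0" "\<And>X Y :: complex ^ 'n ^ 'n. X \<in> cball 0 R \<Longrightarrow> Y \<in> cball 0 R \<Longrightarrow> dist Y X < \<eta> \<Longrightarrow> dist (det Y) (det X) < \<epsilon>"
    using \<open>\<epsilon> > 0\<close> unfolding uniformly_continuous_on_def by meson
  then show ?thesis
    by (intro exI[of _ \<eta>]) (auto simp: dist_norm)
qed

lemma norm_mat_le_entries:
  fixes X :: "complex ^ 'n ^ 'k"
  assumes "\<And>i j. norm (X $ i $ j) \<le> b"
  shows "norm X \<le> real CARD('k) * real CARD('n) * b"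
proof -
  have "norm X \<le> (\<Sum>i\<in>UNIV. norm (X $ i))"
    by (simp add: norm_vec_def L2_set_le_sum)
  also have "\<dots> \<le> (\<Sum>i\<in>(UNIV::'k set). \<Sum>j\<in>(UNIV::'n set). b)"
  proof (rule sum_mono)
    fix i
    have "norm (X $ i) \<le> (\<Sum>j\<in>UNIV. norm (X $ i $ j))"
      by (simp add: norm_vec_def L2_set_le_sum)
    also have "\<dots> \<le> (\<Sum>j\<in>(UNIV::'n set). b)"
      by (intro sum_mono assms)
    finally show "norm (X $ i) \<le> (\<Sum>j\<in>(UNIV::'n set). b)" .
  qed
  finally show ?thesis by simp
qed

lemma sum_UNIV_Plus:
  "(\<Sum>k\<in>(UNIV::('a::finite + 'b::finite) set). f k) = (\<Sum>p\<in>UNIV. f (Inl p)) + (\<Sum>p\<in>UNIV. f (Inr p))"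
  by (subst UNIV_Plus_UNIV[symmetric], subst sum.Plus) simp_all

text \<open>
  Only the sign matters. The rotation by a right angle is the square of a real matrix, the rotation
  by half of it, so that its determinant is a square of a real number; and it is invertible.
\<close>

lemma det_rotation_quarter:
  "\<exists>d>0. det (rotation_block 0 1 :: complex ^ ('m::finite + 'm) ^ ('m + 'm)) = complex_of_real d"
proof -
  let ?r = "1 / sqrt 2 :: real"
  let ?H = "rotation_block ?r ?r :: complex ^ ('m + 'm) ^ ('m + 'm)"
  let ?J = "rotation_block 0 1 :: complex ^ ('m + 'm) ^ ('m + 'm)"
  have mult: "rotation_block a b ** (rotation_block c d :: complex ^ ('m + 'm) ^ ('m + 'm)) = rotation_block (a * c - b * d) (a * d + b * c)"
    for a b c d
    by (auto simp: vec_eq_iff matrix_matrix_mult_def rotation_block_def sum_UNIV_Plus if_distrib[of "\<lambda>x. _ * x"] cong: if_cong split: sum.split)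
  have "?J = ?H ** ?H"
    by (simp add: mult field_simps)
  then have det_J: "det ?J = (det ?H)\<^sup>2"
    by (simp add: det_mul power2_eq_square)
  have "cnj (det ?H) = det ?H"
    by (subst det_cnj[symmetric], rule arg_cong[of _ _ det])
       (auto simp: vec_eq_iff rotation_block_def split: sum.split)
  then obtain h where h: "det ?H = complex_of_real h"
    by (metis Reals_cases Reals_cnj_iff)
  have "?J ** rotation_block 0 (- 1) = mat 1"
    by (auto simp: mult) (auto simp: vec_eq_iff rotation_block_def mat_def split: sum.split)
  then have "det ?J * det (rotation_block 0 (- 1) :: complex ^ ('m + 'm) ^ ('m + 'm)) = 1"
    by (metis det_I det_mul)
  then have "det ?J \<noteq> 0" by auto
  then show ?thesis
    using h det_J by (intro exI[of _ "h\<^sup>2"]) auto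
qed

text \<open>
  At \<open>t = 0\<close> the matrix is a multiple of the rotation by a right angle, at \<open>t = \<pi>/2\<close> a multiple
  \<open>2 \<i> c\<close> of the identity. The sign of \<open>(2 \<i> c) ^ (2 m)\<close> is the only place where the parity of the
  dimension enters.
\<close>

lemma floquet_det_free:
  defines "N \<equiv> 2 * CARD('m::finite)"
  shows "\<exists>d>0. \<forall>c s. floquet_det (rotation_block c s :: complex ^ ('m + 'm) ^ ('m + 'm)) 0 = complex_of_real ((2 * s) ^ N * d)"
    and "floquet_det (rotation_block c s :: complex ^ ('m + 'm) ^ ('m + 'm)) (pi / 2) = complex_of_real ((- 1) ^ CARD('m) * (2 * c) ^ N)"
proof -
  obtain d where d: "d > 0" "det (rotation_block 0 1 :: complex ^ ('m + 'm) ^ ('m + 'm)) = complex_of_real d"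
    using det_rotation_quarter by blast
  have "floquet_det (rotation_block c s :: complex ^ ('m + 'm) ^ ('m + 'm)) 0 = complex_of_real ((2 * s) ^ N * d)" for c s
  proof -
    have "floquet_det (rotation_block c s :: complex ^ ('m + 'm) ^ ('m + 'm)) 0
        = det (\<chi> i. (- 2 * complex_of_real s) *s ((rotation_block 0 1 :: complex ^ ('m + 'm) ^ ('m + 'm)) $ i))"
      unfolding floquet_det_def
      by (rule arg_cong[of _ _ det])
         (auto simp: vec_eq_iff rotation_block_def time_reverse_def flip_sign_def split: sum.split)
    also have "\<dots> = (- 2 * complex_of_real s) ^ N * complex_of_real d"
      by (subst det_rows_mul) (simp add: vec_lambda_eta d N_def card_UNIV_sum flip: mult_2)
    also have "\<dots> = complex_of_real ((2 * s) ^ N * d)"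
      by (simp add: N_def power_mult power_mult_distrib)
    finally show ?thesis .
  qed
  then show "\<exists>d>0. \<forall>c s. floquet_det (rotation_block c s :: complex ^ ('m + 'm) ^ ('m + 'm)) 0 = complex_of_real ((2 * s) ^ N * d)"
    using d(1) by blast
  have "floquet_det (rotation_block c s :: complex ^ ('m + 'm) ^ ('m + 'm)) (pi / 2)
      = det (\<chi> i. (2 * \<i> * complex_of_real c) *s ((mat 1 :: complex ^ ('m + 'm) ^ ('m + 'm)) $ i))"
    unfolding floquet_det_def
    by (rule arg_cong[of _ _ det])
       (auto simp: vec_eq_iff rotation_block_def time_reverse_def flip_sign_def mat_def split: sum.split)
  also have "\<dots> = (2 * \<i> * complex_of_real c) ^ N"
    by (subst det_rows_mul) (simp add: vec_lambda_eta N_def card_UNIV_sum flip: mult_2)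
  also have "\<dots> = complex_of_real ((- 1) ^ CARD('m) * (2 * c) ^ N)"
    by (simp add: N_def power_mult power_mult_distrib power_minus[of "4 * _"])
  finally show "floquet_det (rotation_block c s :: complex ^ ('m + 'm) ^ ('m + 'm)) (pi / 2) = complex_of_real ((- 1) ^ CARD('m) * (2 * c) ^ N)" .
qed

text \<open>
  By uniform continuity of the determinant, the opposite signs of the unperturbed real function at
  \<open>0\<close> and \<open>\<pi>/2\<close> survive a small perturbation, so it has a zero in between. The bound \<open>\<delta>\<close> keeps both
  unperturbed values away from \<open>0\<close>, uniformly in \<open>c\<close> and \<open>s\<close>.
\<close>

lemma unimodular_multiplier_exists:
  fixes \<delta> :: real
  assumes odd: "odd CARD('m::finite)" and "\<delta> > 0"
  obtains \<eta> where "\<eta> > 0" and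
    "\<And>c s. \<And>A :: complex ^ ('m + 'm) ^ ('m + 'm).
      \<delta> \<le> \<bar>c\<bar> \<Longrightarrow> \<bar>c\<bar> \<le> 1 \<Longrightarrow> \<delta> \<le> \<bar>s\<bar> \<Longrightarrow> \<bar>s\<bar> \<le> 1 \<Longrightarrow>
      (\<And>i j. norm (A $ i $ j - rotation_block c s $ i $ j) \<le> \<eta>) \<Longrightarrow>
      \<exists>v \<rho>. v \<noteq> 0 \<and> norm \<rho> = 1 \<and> A *v v = \<rho> *s (time_reverse A *v v)"
proof -
  let ?N = "2 * CARD('m)"
  obtain d where d: "d > 0"
    "\<And>c s. floquet_det (rotation_block c s :: complex ^ ('m + 'm) ^ ('m + 'm)) 0 = complex_of_real ((2 * s) ^ ?N * d)"
    using floquet_det_free(1)[where 'm = 'm] by blast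
  \<comment> \<open>a lower bound for the modulus of both unperturbed values\<close>
  define \<epsilon> where "\<epsilon> = (2 * \<delta>) ^ ?N * min d 1"
  have "\<epsilon> > 0" using \<open>\<delta> > 0\<close> d by (simp add: \<epsilon>_def)
  define K where "K = real CARD('m + 'm) * real CARD('m + 'm)"
  have "K > 0" by (simp add: K_def)
  obtain \<eta> where "\<eta> > 0" and
    \<eta>: "\<And>X Y :: complex ^ ('m + 'm) ^ ('m + 'm). norm X \<le> K * 4 \<Longrightarrow> norm Y \<le> K * 4 \<Longrightarrow> norm (X - Y) < \<eta> \<Longrightarrow> norm (det X - det Y) < \<epsilon>"
    using det_uniform_close[OF \<open>\<epsilon> > 0\<close>, of "K * 4"] by blast
  define \<eta>' where "\<eta>' = min 1 (\<eta> / (4 * K))"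
  have \<eta>': "\<eta>' > 0" "\<eta>' \<le> 1" "K * (2 * \<eta>') < \<eta>"
    using \<open>\<eta> > 0\<close> \<open>K > 0\<close> by (auto simp: \<eta>'_def min_def field_simps)
  show thesis
  proof (rule that[OF \<eta>'(1)])
    fix c s and A :: "complex ^ ('m + 'm) ^ ('m + 'm)"
    assume c: "\<delta> \<le> \<bar>c\<bar>" "\<bar>c\<bar> \<le> 1" and s: "\<delta> \<le> \<bar>s\<bar>" "\<bar>s\<bar> \<le> 1"
      and close: "\<And>i j. norm (A $ i $ j - rotation_block c s $ i $ j) \<le> \<eta>'"
    let ?R = "rotation_block c s :: complex ^ ('m + 'm) ^ ('m + 'm)"
    have flip1: "norm (flip_sign k) = 1" for k :: "'m + 'm"
      by (auto simp: flip_sign_def split: sum.split)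
    have R1: "norm (?R $ i $ j) \<le> 1" for i j
      using c s by (auto simp: rotation_block_def split: sum.split)
    have A2: "norm (A $ i $ j) \<le> 2" for i j
      using norm_triangle_ineq[of "A $ i $ j - ?R $ i $ j" "?R $ i $ j"] close R1[of i j] \<eta>'
      by (smt (verit) diff_add_cancel)
    have near: "norm (floquet_det A t - floquet_det ?R t) < \<epsilon>" for t
      unfolding floquet_det_def
    proof (rule \<eta>)
      show "norm (\<chi> i j. cis t * time_reverse A $ i $ j - cis (- t) * A $ i $ j) \<le> K * 4"
        unfolding K_def
      proof (rule norm_mat_le_entries)
        fix i j
        have "norm (cis t * time_reverse A $ i $ j - cis (- t) * A $ i $ j) \<le> 2 + 2"
          by (rule norm_triangle_le_diff, rule add_mono)
             (use A2 in \<open>auto simp: norm_mult time_reverse_def flip1\<close>)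
        then show "norm ((\<chi> i j. cis t * time_reverse A $ i $ j - cis (- t) * A $ i $ j) $ i $ j) \<le> 4"
          by simp
      qed
      show "norm (\<chi> i j. cis t * time_reverse ?R $ i $ j - cis (- t) * ?R $ i $ j) \<le> K * 4"
        unfolding K_def
      proof (rule norm_mat_le_entries)
        fix i j
        have "norm (cis t * time_reverse ?R $ i $ j - cis (- t) * ?R $ i $ j) \<le> 1 + 1"
          by (rule norm_triangle_le_diff, rule add_mono)
             (use R1 in \<open>auto simp: norm_mult time_reverse_def flip1\<close>)
        then show "norm ((\<chi> i j. cis t * time_reverse ?R $ i $ j - cis (- t) * ?R $ i $ j) $ i $ j) \<le> 4"
          by simp
      qed
      have "norm ((\<chi> i j. cis t * time_reverse A $ i $ j - cis (- t) * A $ i $ j) -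
          (\<chi> i j. cis t * time_reverse ?R $ i $ j - cis (- t) * ?R $ i $ j)) \<le> K * (2 * \<eta>')"
        unfolding K_def
      proof (rule norm_mat_le_entries)
        fix i j
        have tri: "norm ((x - y) - (z - w)) \<le> norm (x - z) + norm (y - w)" for x y z w :: complex
          using norm_triangle_ineq4[of "x - z" "y - w"] by (simp add: algebra_simps)
        have "norm (time_reverse A $ i $ j - time_reverse ?R $ i $ j) = norm (A $ i $ j - ?R $ i $ j)"
          by (simp add: time_reverse_def norm_mult flip1 flip: right_diff_distrib left_diff_distrib complex_cnj_diff)
        then have "norm ((cis t * time_reverse A $ i $ j - cis (- t) * A $ i $ j) -
            (cis t * time_reverse ?R $ i $ j - cis (- t) * ?R $ i $ j)) \<le> \<eta>' + \<eta>'"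
          using close
          by (intro order_trans[OF tri] add_mono) (simp_all add: norm_mult flip: right_diff_distrib)
        then show "norm (((\<chi> i j. cis t * time_reverse A $ i $ j - cis (- t) * A $ i $ j) -
          (\<chi> i j. cis t * time_reverse ?R $ i $ j - cis (- t) * ?R $ i $ j)) $ i $ j) \<le> 2 * \<eta>'"
          by simp
      qed
      also note \<eta>'(3)
      finally show "norm ((\<chi> i j. cis t * time_reverse A $ i $ j - cis (- t) * A $ i $ j) -
          (\<chi> i j. cis t * time_reverse ?R $ i $ j - cis (- t) * ?R $ i $ j)) < \<eta>" .
    qed
    have near_Re: "\<bar>Re (floquet_det A t) - Re (floquet_det ?R t)\<bar> < \<epsilon>" for t
      using near[of t] abs_Re_le_cmod[of "floquet_det A t - floquet_det ?R t"] by simp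
    have "\<epsilon> \<le> (2 * s) ^ ?N * d" "\<epsilon> \<le> (2 * c) ^ ?N"
    proof -
      have pow: "(2 * \<delta>) ^ ?N \<le> (2 * x) ^ ?N" if "\<delta> \<le> \<bar>x\<bar>" for x
      proof -
        have "(2 * \<delta>) ^ ?N \<le> (2 * \<bar>x\<bar>) ^ ?N"
          using that \<open>\<delta> > 0\<close> by (intro power_mono) auto
        then show ?thesis by (simp add: power_mult_distrib power_even_abs)
      qed
      show "\<epsilon> \<le> (2 * s) ^ ?N * d"
        unfolding \<epsilon>_def using pow[OF s(1)] d \<open>\<delta> > 0\<close> by (intro mult_mono) auto
      have "\<epsilon> \<le> (2 * c) ^ ?N * 1"
        unfolding \<epsilon>_def using pow[OF c(1)] d \<open>\<delta> > 0\<close> by (intro mult_mono) auto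
      then show "\<epsilon> \<le> (2 * c) ^ ?N" by simp
    qed
    then have "Re (floquet_det A 0) \<ge> 0" "Re (floquet_det A (pi / 2)) \<le> 0"
      using near_Re[of 0] near_Re[of "pi / 2"] odd
      unfolding d(2) floquet_det_free(2)[where 'm = 'm] by (auto simp: uminus_power_if)
    moreover have "continuous_on {0..pi / 2} (\<lambda>t. Re (floquet_det A t))"
      unfolding floquet_det_def
      by (intro continuous_intros continuous_on_det)
    ultimately obtain t where "Re (floquet_det A t) = 0"
      using IVT2'[of "\<lambda>t. Re (floquet_det A t)" "pi / 2" 0 0] by auto
    then have "floquet_det A t = 0"
      using floquet_det_real[of A t] by (simp add: complex_eq_iff)
    let ?M = "\<chi> i j. cis t * time_reverse A $ i $ j - cis (- t) * A $ i $ j"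
    have "\<not> invertible ?M"
      using \<open>floquet_det A t = 0\<close> by (simp add: floquet_det_def invertible_det_nz)
    then have "\<nexists>B. B ** ?M = mat 1"
      by (simp add: invertible_left_inverse)
    then obtain v where v: "v \<noteq> 0" "?M *v v = 0"
      unfolding matrix_left_invertible_ker by blast
    have "?M *v v = cis t *s (time_reverse A *v v) - cis (- t) *s (A *v v)"
      (is "_ = ?rhs")
    proof (rule vec_eq_iff[THEN iffD2, rule_format])
      fix i
      have "(?M *v v) $ i = (\<Sum>j\<in>UNIV. cis t * (time_reverse A $ i $ j * v $ j) - cis (- t) * (A $ i $ j * v $ j))"
        unfolding matrix_vector_mult_def vec_lambda_beta by (rule sum.cong) (simp_all only: left_diff_distrib mult.assoc)
      also have "\<dots> = ?rhs $ i"
        by (simp only: matrix_vector_mult_def vec_lambda_beta vector_minus_component vector_smult_component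
            sum_subtractf sum_distrib_left)
      finally show "(?M *v v) $ i = ?rhs $ i" .
    qed
    then have "cis t *s (cis t *s (time_reverse A *v v)) = cis t *s (cis (- t) *s (A *v v))"
      using v by simp
    then have "A *v v = cis (2 * t) *s (time_reverse A *v v)"
      by (simp add: vector_smult_assoc cis_mult vector_smult_lid)
    then show "\<exists>v \<rho>. v \<noteq> 0 \<and> norm \<rho> = 1 \<and> A *v v = \<rho> *s (time_reverse A *v v)"
      using v by (intro exI[of _ v] exI[of _ "cis (2 * t)"]) auto
  qed
qed

section \<open>Periodic potentials and Floquet solutions\<close>

lemma absolutely_integrable_shift:
  fixes f :: "real \<Rightarrow> 'b::euclidean_space"
  shows "f absolutely_integrable_on {a + c..b + c} \<longleftrightarrow> (\<lambda>x. f (x + c)) absolutely_integrable_on {a..b}"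
proof -
  have der: "((\<lambda>x. x + c) has_field_derivative 1) (at x within {a..b})" for x
    by (auto intro!: derivative_eq_intros)
  show ?thesis
    using absolutely_integrable_change_of_variables_real[of "{a..b}", OF _ der, of f] by (simp add: inj_on_def)
qed

lemma absolutely_integrable_AE_cong:
  fixes f g :: "real \<Rightarrow> 'b::euclidean_space"
  assumes "AE x in lebesgue. f x = g x"
  shows "f absolutely_integrable_on S \<longleftrightarrow> g absolutely_integrable_on S"
proof -
  obtain N where "negligible N" "{x. f x \<noteq> g x} \<subseteq> N"
    using assms by (auto simp: eventually_ae_filter_negligible)
  then have "g x = f x" if "x \<notin> N" for x
    using that by force
  then show ?thesis
    using \<open>negligible N\<close> by (intro absolutely_integrable_spike_eq) auto
qed

lemma periodic_locally_integrable:
  fixes f :: "real \<Rightarrow> 'b::euclidean_space"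
  assumes f: "f absolutely_integrable_on {0..p}" and "p > 0" and per: "AE x in lebesgue. f (x + p) = f x"
  shows "f absolutely_integrable_on {a..b}"
proof -
  have step: "f absolutely_integrable_on {c + p..d + p} \<longleftrightarrow> f absolutely_integrable_on {c..d}" for c d
    unfolding absolutely_integrable_shift by (rule absolutely_integrable_AE_cong[OF per])
  have right: "f absolutely_integrable_on {0..real n * p}" for n
  proof (induction n)
    case (Suc n)
    have "f absolutely_integrable_on {p..real (Suc n) * p}"
      using step[of 0 "real n * p"] Suc by (simp add: algebra_simps)
    then show ?case
      using f \<open>p > 0\<close> by (rule_tac absolutely_integrable_on_combine[where c = p]) simp_all
  qed (simp add: absolutely_integrable_negligible)
  have all: "f absolutely_integrable_on {- (real k * p)..real n * p}" for k n
  proof (induction k arbitrary: n)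
    case (Suc k)
    show ?case
      using step[of "- (real (Suc k) * p)" "real n * p"] Suc[of "Suc n"] by (simp add: algebra_simps)
  qed (use right in simp)
  obtain k n :: nat where "- a / p \<le> real k" "b / p \<le> real n"
    using real_arch_simple by meson
  then have "{a..b} \<subseteq> {- (real k * p)..real n * p}"
    using \<open>p > 0\<close> by (auto simp: field_simps)
  then show ?thesis
    using absolutely_integrable_on_subinterval[OF all] by blast
qed

lemma power2_norm_vec: "(norm (x :: 'a::euclidean_space ^ 'n))\<^sup>2 = (\<Sum>i\<in>UNIV. (norm (x $ i))\<^sup>2)"
  by (simp add: power2_norm_eq_inner inner_vec_def)

lemma L2_imp_absolutely_integrable:
  assumes f: "f \<in> L2 S" and S: "S \<in> lmeasurable"
  shows "f absolutely_integrable_on S" and "(\<lambda>x. (norm (f x))\<^sup>2) absolutely_integrable_on S"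
proof -
  have meas: "S \<in> sets lebesgue" "f \<in> borel_measurable (lebesgue_on S)"
    and int: "integrable (lebesgue_on S) (\<lambda>x. (norm (f x))\<^sup>2)"
    using f S by (auto simp: L2_def)
  show sq: "(\<lambda>x. (norm (f x))\<^sup>2) absolutely_integrable_on S"
    using int meas by (simp add: set_integrable_def integrable_restrict_space)
  show "f absolutely_integrable_on S"
  proof (rule measurable_bounded_by_integrable_imp_absolutely_integrable[OF meas(2,1)])
    show "(\<lambda>x. 1 + (norm (f x))\<^sup>2) integrable_on S"
      using S by (intro integrable_add set_lebesgue_integral_eq_integral(1)[OF sq] integrable_on_const)
    show "norm (f x) \<le> 1 + (norm (f x))\<^sup>2" for x
      using sum_power2_ge_zero[of "norm (f x) - 1" 0] by (simp add: power2_eq_square algebra_simps) (smt (verit) norm_ge_zero)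
  qed
qed

lemma absolutely_integrable_entries:
  fixes Q :: "real \<Rightarrow> complex ^ 'n ^ 'k"
  assumes "\<And>i j. (\<lambda>x. Q x $ i $ j) absolutely_integrable_on S"
  shows "Q absolutely_integrable_on S"
proof (rule absolutely_integrable_componentwise)
  fix b :: "complex ^ 'n ^ 'k" assume "b \<in> Basis"
  then obtain i j e where "b = axis i (axis j e)"
    by (auto simp: Basis_vec_def)
  then have "(\<lambda>x. Q x \<bullet> b) = (\<lambda>z. z \<bullet> e) \<circ> (\<lambda>x. Q x $ i $ j)"
    by (simp add: inner_axis fun_eq_iff)
  then show "(\<lambda>x. Q x \<bullet> b) absolutely_integrable_on S"
    using absolutely_integrable_linear[OF assms bounded_linear_inner_left] by metis
qed

lemma potential_locally_L2:
  fixes Q :: "real \<Rightarrow> complex ^ 'm ^ 'm"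
  assumes per: "AE x in lebesgue. Q (x + pi) = Q x"
    and L2: "\<And>i j. (\<lambda>x. Q x $ i $ j) \<in> L2 {0..pi}"
  shows "Q absolutely_integrable_on {a..b}" and "(\<lambda>x. (norm (Q x))\<^sup>2) absolutely_integrable_on {a..b}"
proof -
  have "Q absolutely_integrable_on {0..pi}"
    by (intro absolutely_integrable_entries L2_imp_absolutely_integrable[OF L2]) simp
  then show "Q absolutely_integrable_on {a..b}"
    by (rule periodic_locally_integrable[OF _ pi_gt_zero per])
  have "(\<lambda>x. (norm (Q x))\<^sup>2) absolutely_integrable_on {0..pi}"
    unfolding power2_norm_vec by (intro absolutely_integrable_sum L2_imp_absolutely_integrable[OF L2]) simp_all
  moreover have "AE x in lebesgue. (norm (Q (x + pi)))\<^sup>2 = (norm (Q x))\<^sup>2"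
    using per by eventually_elim simp
  ultimately show "(\<lambda>x. (norm (Q x))\<^sup>2) absolutely_integrable_on {a..b}"
    by (rule periodic_locally_integrable[OF _ pi_gt_zero])
qed

definition cnj_vec :: "complex ^ 'n \<Rightarrow> complex ^ 'n" where
  "cnj_vec z = (\<chi> i. cnj (z $ i))"

lemma bounded_linear_cnj_vec: "bounded_linear (cnj_vec :: complex ^ 'n \<Rightarrow> _)"
  unfolding linear_conv_bounded_linear[symmetric] by (rule linearI) (simp_all add: cnj_vec_def vec_eq_iff)

lemma bounded_linear_scalar_mult: "bounded_linear ((*s) c :: complex ^ 'n \<Rightarrow> _)"
  unfolding linear_conv_bounded_linear[symmetric] by (rule linearI) (simp_all add: vec_eq_iff algebra_simps)

lemma cnj_vec_mult: "cnj_vec (A *v z) = conj_mat A *v cnj_vec z"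
  by (simp add: cnj_vec_def conj_mat_def matrix_vector_mult_def vec_eq_iff)

lemma mult_scalar_vec: "A *v (c *s z) = c *s (A *v z)" for A :: "complex ^ 'n ^ 'k"
  by (simp add: vec_eq_iff matrix_vector_mult_def sum_distrib_left mult.left_commute)

text \<open>
  The equation is solved on the right half of the period only; the left half is supplied by the
  symmetry. The boundary condition for the combination of basis solutions with coefficients \<open>v\<close> is
  then \<open>A v = \<rho> *s (time_reverse A *v v)\<close>, where \<open>A\<close> is close to a rotation.
\<close>

lemma floquet_solution_exists:
  fixes Q :: "real \<Rightarrow> complex ^ 'm ^ 'm"
  assumes odd: "odd CARD('m)"
    and pt: "AE x in lebesgue. conj_mat (Q (- x)) = Q x"
    and Q: "Q absolutely_integrable_on {0..pi / 2}"
    and "\<delta> > 0"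
  obtains s0 where "s0 > 0" and
    "\<And>s. s0 \<le> s \<Longrightarrow> \<delta> \<le> \<bar>cos (s * pi / 2)\<bar> \<Longrightarrow> \<delta> \<le> \<bar>sin (s * pi / 2)\<bar> \<Longrightarrow>
    \<exists>u u' w \<rho>. norm \<rho> = 1 \<and> ac_deriv u u' \<and> ac_deriv u' w \<and>
      (AE x in lebesgue. x \<in> {- pi / 2..pi / 2} \<longrightarrow> w x = Q x *v u x - complex_of_real (s\<^sup>2) *s u x) \<and>
      u (pi / 2) = \<rho> *s u (- pi / 2) \<and> u' (pi / 2) = \<rho> *s u' (- pi / 2) \<and> (u 0 \<noteq> 0 \<or> u' 0 \<noteq> 0)"
proof -
  let ?h = "pi / 2"
  \<comment> \<open>cutting off makes the potential integrable over the line without changing it on \<open>[0, \<pi>/2]\<close>\<close>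
  define W where "W x = (if x \<in> {0..?h} then Q x else 0)" for x
  have W: "W absolutely_integrable_on UNIV"
    unfolding W_def absolutely_integrable_restrict_UNIV by (rule Q)
  obtain K where "K \<ge> 0" and
    sol: "\<And>s a b. s > 0 \<Longrightarrow> K \<le> s \<Longrightarrow> \<exists>y y'. ac_deriv y y' \<and> ac_deriv y' (\<lambda>x. W x *v y x - s\<^sup>2 *\<^sub>R y x) \<and>
     y 0 = a \<and> y' 0 = s *\<^sub>R b \<and>
     (\<forall>x. norm (y x - (cos (s * x) *\<^sub>R a + sin (s * x) *\<^sub>R b)) \<le> K / s * (norm a + norm b)) \<and>
     (\<forall>x. norm (y' x - s *\<^sub>R (cos (s * x) *\<^sub>R b - sin (s * x) *\<^sub>R a)) \<le> K * (norm a + norm b))"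
    using schroedinger_solution[OF W] by blast
  obtain \<eta> where "\<eta> > 0" and
    mult: "\<And>c s. \<And>A :: complex ^ ('m + 'm) ^ ('m + 'm). \<delta> \<le> \<bar>c\<bar> \<Longrightarrow> \<bar>c\<bar> \<le> 1 \<Longrightarrow> \<delta> \<le> \<bar>s\<bar> \<Longrightarrow> \<bar>s\<bar> \<le> 1 \<Longrightarrow>
      (\<And>i j. norm (A $ i $ j - rotation_block c s $ i $ j) \<le> \<eta>) \<Longrightarrow>
      \<exists>v \<rho>. v \<noteq> 0 \<and> norm \<rho> = 1 \<and> A *v v = \<rho> *s (time_reverse A *v v)"
    using unimodular_multiplier_exists[OF odd \<open>\<delta> > 0\<close>] by blast
  define s0 where "s0 = max 1 (max K (K / \<eta>))"
  show thesis
  proof (rule that[of s0])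
    show "s0 > 0" by (simp add: s0_def)
    fix s assume "s0 \<le> s" and c: "\<delta> \<le> \<bar>cos (s * pi / 2)\<bar>" and d: "\<delta> \<le> \<bar>sin (s * pi / 2)\<bar>"
    have "s > 0" "K \<le> s" and "K / \<eta> \<le> s"
      using \<open>s0 \<le> s\<close> by (auto simp: s0_def)
    then have s: "s > 0" "K \<le> s" "K / s \<le> \<eta>"
      using \<open>\<eta> > 0\<close> by (simp_all add: pos_divide_le_eq mult.commute)
    define a b :: "'m + 'm \<Rightarrow> complex ^ 'm" where
      "a j = (case j of Inl q \<Rightarrow> axis q 1 | Inr q \<Rightarrow> 0)" and
      "b j = (case j of Inl q \<Rightarrow> 0 | Inr q \<Rightarrow> axis q 1)" for j
    have ab: "norm (a j) + norm (b j) = 1" for j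
      by (simp add: a_def b_def split: sum.split)
    let ?sol = "\<lambda>j y y'. ac_deriv y y' \<and> ac_deriv y' (\<lambda>x. W x *v y x - s\<^sup>2 *\<^sub>R y x) \<and>
     y 0 = a j \<and> y' 0 = s *\<^sub>R b j \<and>
     (\<forall>x. norm (y x - (cos (s * x) *\<^sub>R a j + sin (s * x) *\<^sub>R b j)) \<le> K / s) \<and>
     (\<forall>x. norm (y' x - s *\<^sub>R (cos (s * x) *\<^sub>R b j - sin (s * x) *\<^sub>R a j)) \<le> K)"
    have "\<forall>j. \<exists>y y'. ?sol j y y'"
    proof
      show "\<exists>y y'. ?sol j y y'" for j
        using sol[OF s(1,2), of "a j" "b j"] unfolding ab by simp
    qed
    from choice[OF this] obtain Y where "\<forall>j. \<exists>y'. ?sol j (Y j) y'"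
      by blast
    from choice[OF this] obtain Y' where YY': "\<And>j. ?sol j (Y j) (Y' j)"
      by blast
    have Y: "ac_deriv (Y j) (Y' j)" and Y': "ac_deriv (Y' j) (\<lambda>x. W x *v Y j x - s\<^sup>2 *\<^sub>R Y j x)"
      and Y0: "Y j 0 = a j" and Y'0: "Y' j 0 = s *\<^sub>R b j"
      and Y_bd: "norm (Y j x - (cos (s * x) *\<^sub>R a j + sin (s * x) *\<^sub>R b j)) \<le> K / s"
      and Y'_bd: "norm (Y' j x - s *\<^sub>R (cos (s * x) *\<^sub>R b j - sin (s * x) *\<^sub>R a j)) \<le> K" for j x
      using YY'[of j] by blast+
    define A :: "complex ^ ('m + 'm) ^ ('m + 'm)" where
      "A = (\<chi> i j. case i of Inl p \<Rightarrow> Y j ?h $ p | Inr p \<Rightarrow> Y' j ?h $ p / complex_of_real s)"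
    have close: "norm (A $ i $ j - rotation_block (cos (s * ?h)) (sin (s * ?h)) $ i $ j) \<le> \<eta>" for i j
    proof (cases i)
      case (Inl p)
      have "A $ i $ j - rotation_block (cos (s * ?h)) (sin (s * ?h)) $ i $ j
          = (Y j ?h - (cos (s * ?h) *\<^sub>R a j + sin (s * ?h) *\<^sub>R b j)) $ p"
        using Inl by (auto simp: A_def rotation_block_def a_def b_def axis_def scaleR_conv_of_real[where 'a = complex] split: sum.split)
      also have "norm \<dots> \<le> K / s"
        by (rule order_trans[OF Finite_Cartesian_Product.norm_nth_le Y_bd])
      finally show ?thesis using s(3) by simp
    next
      case (Inr p)
      have "A $ i $ j - rotation_block (cos (s * ?h)) (sin (s * ?h)) $ i $ j
          = (Y' j ?h - s *\<^sub>R (cos (s * ?h) *\<^sub>R b j - sin (s * ?h) *\<^sub>R a j)) $ p / complex_of_real s"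
        using Inr s(1) by (auto simp: A_def rotation_block_def a_def b_def axis_def scaleR_conv_of_real[where 'a = complex] field_simps split: sum.split)
      also have "norm \<dots> \<le> K / s"
        unfolding norm_divide norm_of_real abs_of_pos[OF s(1)]
        by (rule divide_right_mono[OF order_trans[OF Finite_Cartesian_Product.norm_nth_le Y'_bd]]) (use s(1) in simp)
      finally show ?thesis using s(3) by simp
    qed
    obtain v \<rho> where v: "v \<noteq> 0" and \<rho>: "norm \<rho> = 1" and eig: "A *v v = \<rho> *s (time_reverse A *v v)"
      using mult[of "cos (s * ?h)" "sin (s * ?h)" A] c d close by auto
    \<comment> \<open>\<open>uL\<close> is the reflected solution with the same data at \<open>0\<close>; the signs undo those of the derivative\<close>
    define uR where "uR x = (\<Sum>j\<in>UNIV. v $ j *s Y j x)" for x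
    define uR' where "uR' x = (\<Sum>j\<in>UNIV. v $ j *s Y' j x)" for x
    define wR where "wR x = (\<Sum>j\<in>UNIV. v $ j *s (W x *v Y j x - s\<^sup>2 *\<^sub>R Y j x))" for x
    define uL where "uL x = (\<Sum>j\<in>UNIV. (flip_sign j * v $ j) *s cnj_vec (Y j (- x)))" for x
    define uL' where "uL' x = (\<Sum>j\<in>UNIV. (flip_sign j * v $ j) *s cnj_vec (- Y' j (- x)))" for x
    define wL where "wL x = (\<Sum>j\<in>UNIV. (flip_sign j * v $ j) *s cnj_vec (- (- (W (- x) *v Y j (- x) - s\<^sup>2 *\<^sub>R Y j (- x)))))" for x
    have R: "ac_deriv uR uR'" "ac_deriv uR' wR"
      unfolding uR_def uR'_def wR_def
      by (intro ac_deriv_sum ac_deriv_linear[OF _ bounded_linear_scalar_mult] Y Y')+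
    have L: "ac_deriv uL uL'" "ac_deriv uL' wL"
      unfolding uL_def uL'_def wL_def
      by (intro ac_deriv_sum ac_deriv_linear[OF _ bounded_linear_scalar_mult] ac_deriv_linear[OF _ bounded_linear_cnj_vec]
            ac_deriv_reflect ac_deriv_uminus Y Y')+
    have R0: "uR 0 $ p = v $ Inl p" "uR' 0 $ p = complex_of_real s * v $ Inr p" for p
      by (simp_all add: uR_def uR'_def Y0 Y'0 a_def b_def sum_UNIV_Plus axis_def scaleR_conv_of_real[where 'a = complex] if_distrib[of "\<lambda>x. _ * x"] mult.commute cong: if_cong)
    have L0: "uL 0 $ p = v $ Inl p" "uL' 0 $ p = complex_of_real s * v $ Inr p" for p
      by (simp_all add: uL_def uL'_def Y0 Y'0 a_def b_def sum_UNIV_Plus axis_def cnj_vec_def flip_sign_def scaleR_conv_of_real[where 'a = complex] if_distrib[of "\<lambda>x. _ * x"] if_distrib[of cnj] mult.commute cong: if_cong)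
    define u where "u x = (if x \<le> 0 then uL x else uR x)" for x
    define u' where "u' x = (if x \<le> 0 then uL' x else uR' x)" for x
    define w where "w x = (if x \<le> 0 then wL x else wR x)" for x
    have "uL 0 = uR 0" "uL' 0 = uR' 0"
      by (simp_all add: vec_eq_iff R0 L0)
    then have ac: "ac_deriv u u'" "ac_deriv u' w"
      unfolding u_def u'_def w_def by (auto intro!: ac_deriv_glue L R)
    have scal: "s\<^sup>2 *\<^sub>R z = complex_of_real (s\<^sup>2) *s z" for z :: "complex ^ 'm"
      by (simp add: vec_eq_iff scaleR_conv_of_real[where 'a = complex])
    have eqR: "wR x = Q x *v uR x - complex_of_real (s\<^sup>2) *s uR x" if "0 < x" "x \<le> ?h" for x
    proof -
      have "wR x = (\<Sum>j\<in>UNIV. Q x *v (v $ j *s Y j x) - s\<^sup>2 *\<^sub>R (v $ j *s Y j x))"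
        unfolding wR_def mult_scalar_vec using that
        by (intro sum.cong) (auto simp: W_def vec_eq_iff algebra_simps)
      then show ?thesis
        unfolding scal[symmetric] uR_def matvec.sum_right scaleR_sum_right sum_subtractf .
    qed
    have eqL: "wL x = Q x *v uL x - complex_of_real (s\<^sup>2) *s uL x" if "x \<le> 0" "- ?h \<le> x" "conj_mat (Q (- x)) = Q x" for x
    proof -
      have "wL x = (\<Sum>j\<in>UNIV. Q x *v ((flip_sign j * v $ j) *s cnj_vec (Y j (- x))) - s\<^sup>2 *\<^sub>R ((flip_sign j * v $ j) *s cnj_vec (Y j (- x))))"
        unfolding wL_def mult_scalar_vec
      proof (rule sum.cong)
        fix j
        have "cnj_vec (- (- (W (- x) *v Y j (- x) - s\<^sup>2 *\<^sub>R Y j (- x)))) = Q x *v cnj_vec (Y j (- x)) - s\<^sup>2 *\<^sub>R cnj_vec (Y j (- x))"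
          using that
          by (simp add: W_def cnj_vec_mult linear_diff[OF bounded_linear.linear[OF bounded_linear_cnj_vec]]
              linear_cmul[OF bounded_linear.linear[OF bounded_linear_cnj_vec]])
        then show "(flip_sign j * v $ j) *s cnj_vec (- (- (W (- x) *v Y j (- x) - s\<^sup>2 *\<^sub>R Y j (- x))))
          = (flip_sign j * v $ j) *s (Q x *v cnj_vec (Y j (- x))) - s\<^sup>2 *\<^sub>R ((flip_sign j * v $ j) *s cnj_vec (Y j (- x)))"
          by (simp add: vec_eq_iff right_diff_distrib)
      qed simp
      then show ?thesis
        unfolding scal[symmetric] uL_def matvec.sum_right scaleR_sum_right sum_subtractf .
    qed
    have eq: "AE x in lebesgue. x \<in> {- pi / 2..pi / 2} \<longrightarrow> w x = Q x *v u x - complex_of_real (s\<^sup>2) *s u x"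
      using pt by eventually_elim (auto simp: w_def u_def eqL eqR)
    have bdR: "uR ?h $ p = (A *v v) $ Inl p" "uR' ?h $ p = complex_of_real s * (A *v v) $ Inr p" for p
      using s(1) by (simp_all add: uR_def uR'_def A_def matrix_vector_mult_def sum_distrib_left mult.commute)
    have bdL: "uL (- ?h) $ p = (time_reverse A *v v) $ Inl p" "uL' (- ?h) $ p = complex_of_real s * (time_reverse A *v v) $ Inr p" for p
    proof -
      have "uL (- ?h) $ p = (\<Sum>j\<in>UNIV. flip_sign j * v $ j * cnj (Y j ?h $ p))"
        by (simp add: uL_def cnj_vec_def)
      also have "\<dots> = (time_reverse A *v v) $ Inl p"
        unfolding matrix_vector_mult_def vec_lambda_beta
        by (rule sum.cong) (auto simp: time_reverse_def A_def flip_sign_def)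
      finally show "uL (- ?h) $ p = (time_reverse A *v v) $ Inl p" .
      have "uL' (- ?h) $ p = (\<Sum>j\<in>UNIV. flip_sign j * v $ j * - cnj (Y' j ?h $ p))"
        by (simp add: uL'_def cnj_vec_def)
      also have "\<dots> = complex_of_real s * (time_reverse A *v v) $ Inr p"
        unfolding matrix_vector_mult_def vec_lambda_beta sum_distrib_left
        by (rule sum.cong) (use s(1) in \<open>auto simp: time_reverse_def A_def flip_sign_def split: sum.split\<close>)
      finally show "uL' (- ?h) $ p = complex_of_real s * (time_reverse A *v v) $ Inr p" .
    qed
    have ends: "u ?h = uR ?h" "u' ?h = uR' ?h" "u (- pi / 2) = uL (- ?h)" "u' (- pi / 2) = uL' (- ?h)"
    proof -
      have "\<not> ?h \<le> 0" "- ?h \<le> 0" "- pi / 2 = - ?h"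
        using pi_half_gt_zero by linarith+
      then show "u ?h = uR ?h" "u' ?h = uR' ?h" "u (- pi / 2) = uL (- ?h)" "u' (- pi / 2) = uL' (- ?h)"
        by (simp_all only: u_def u'_def if_True if_False)
    qed
    have bd: "u ?h = \<rho> *s u (- pi / 2)" "u' ?h = \<rho> *s u' (- pi / 2)"
      unfolding ends by (simp_all add: vec_eq_iff bdR bdL eig mult.left_commute)
    have "u 0 \<noteq> 0 \<or> u' 0 \<noteq> 0"
    proof (rule ccontr)
      assume "\<not> (u 0 \<noteq> 0 \<or> u' 0 \<noteq> 0)"
      then have "v $ k = 0" for k
        using L0 s(1) by (cases k) (auto simp: u_def u'_def vec_eq_iff)
      then show False using v by (simp add: vec_eq_iff)
    qed
    then show "\<exists>u u' w \<rho>. norm \<rho> = 1 \<and> ac_deriv u u' \<and> ac_deriv u' w \<and>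
      (AE x in lebesgue. x \<in> {- pi / 2..pi / 2} \<longrightarrow> w x = Q x *v u x - complex_of_real (s\<^sup>2) *s u x) \<and>
      u (pi / 2) = \<rho> *s u (- pi / 2) \<and> u' (pi / 2) = \<rho> *s u' (- pi / 2) \<and> (u 0 \<noteq> 0 \<or> u' 0 \<noteq> 0)"
      using \<rho> ac eq bd by blast
  qed
qed

section \<open>Floquet solutions with unimodular multiplier lie in the spectrum\<close>

text \<open>
  With values in \<open>[0, \<infinity>]\<close>, decompositions of the squared norm need no integrability assumptions.
\<close>

definition sq_norm :: "(real \<Rightarrow> 'b::euclidean_space) \<Rightarrow> ennreal" where
  "sq_norm f = (\<integral>\<^sup>+ x. ennreal ((norm (f x))\<^sup>2) \<partial>lebesgue)"

lemma L2_UNIV_iff: "f \<in> L2 UNIV \<longleftrightarrow> f \<in> borel_measurable lebesgue \<and> sq_norm f < \<infinity>"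
  by (auto simp: L2_def lebesgue_on_UNIV_eq integrable_iff_bounded sq_norm_def)

lemma L2_norm_nonneg: "L2_norm f \<ge> 0"
  by (simp add: L2_norm_def)

lemma sq_norm_eq_L2_norm:
  assumes "f \<in> L2 UNIV"
  shows "sq_norm f = ennreal ((L2_norm f)\<^sup>2)"
  using assms unfolding sq_norm_def L2_norm_def
  by (subst nn_integral_eq_integral) (auto simp: L2_def lebesgue_on_UNIV_eq)

lemma norm_scalar_mult: "norm (c *s z) = norm c * norm z" for z :: "complex ^ 'n"
  by (simp add: norm_vec_def norm_mult L2_set_right_distrib)

lemma sq_norm_scalar_mult:
  fixes f :: "real \<Rightarrow> complex ^ 'n"
  assumes "f \<in> borel_measurable lebesgue"
  shows "sq_norm (\<lambda>x. c *s f x) = ennreal ((norm c)\<^sup>2) * sq_norm f"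
  unfolding sq_norm_def using assms
  by (subst nn_integral_cmult[symmetric]) (auto simp: norm_scalar_mult power_mult_distrib ennreal_mult)

lemma power2_norm_add_le: "(norm (a + b))\<^sup>2 \<le> 2 * (norm a)\<^sup>2 + 2 * (norm b)\<^sup>2"
  for a b :: "'a::real_normed_vector"
proof -
  have "(norm (a + b))\<^sup>2 \<le> (norm a + norm b)\<^sup>2"
    by (intro power_mono norm_triangle_ineq) simp
  also have "\<dots> \<le> 2 * (norm a)\<^sup>2 + 2 * (norm b)\<^sup>2"
    using sum_squares_bound[of "norm a" "norm b"] by (simp add: power2_sum)
  finally show ?thesis .
qed

lemma sq_norm_add_le:
  assumes "f \<in> borel_measurable lebesgue" "g \<in> borel_measurable lebesgue"
  shows "sq_norm (\<lambda>x. f x + g x) \<le> 2 * sq_norm f + 2 * sq_norm g"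
proof -
  have "sq_norm (\<lambda>x. f x + g x) \<le> (\<integral>\<^sup>+ x. 2 * ennreal ((norm (f x))\<^sup>2) + 2 * ennreal ((norm (g x))\<^sup>2) \<partial>lebesgue)"
    unfolding sq_norm_def
  proof (intro nn_integral_mono)
    fix x
    have "ennreal ((norm (f x + g x))\<^sup>2) \<le> ennreal (2 * (norm (f x))\<^sup>2 + 2 * (norm (g x))\<^sup>2)"
      by (intro ennreal_leI power2_norm_add_le)
    then show "ennreal ((norm (f x + g x))\<^sup>2) \<le> 2 * ennreal ((norm (f x))\<^sup>2) + 2 * ennreal ((norm (g x))\<^sup>2)"
      by (simp add: ennreal_mult)
  qed
  also have "\<dots> = 2 * sq_norm f + 2 * sq_norm g"
    unfolding sq_norm_def using assms by (subst nn_integral_add) (auto simp: nn_integral_cmult)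
  finally show ?thesis .
qed

lemma L2_add_scalar_mult:
  fixes f g :: "real \<Rightarrow> complex ^ 'n"
  assumes "f \<in> L2 UNIV" "g \<in> L2 UNIV"
  shows "(\<lambda>x. f x + c *s g x) \<in> L2 UNIV"
proof -
  have meas: "f \<in> borel_measurable lebesgue" "g \<in> borel_measurable lebesgue" "(\<lambda>x. c *s g x) \<in> borel_measurable lebesgue"
    using assms borel_measurable_continuous_on[OF linear_continuous_on[OF bounded_linear_scalar_mult], of g]
    by (auto simp: L2_UNIV_iff)
  have "sq_norm (\<lambda>x. f x + c *s g x) \<le> 2 * sq_norm f + 2 * (ennreal ((norm c)\<^sup>2) * sq_norm g)"
    using sq_norm_add_le[OF meas(1,3)] by (simp add: sq_norm_scalar_mult meas)
  also have "\<dots> < \<infinity>"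
    using assms by (auto simp: L2_UNIV_iff ennreal_mult_less_top)
  finally show ?thesis
    using meas by (auto simp: L2_UNIV_iff)
qed

lemma measurable_of_locally_integrable:
  fixes g :: "real \<Rightarrow> 'b::euclidean_space"
  assumes "\<And>a b. g absolutely_integrable_on {a..b}"
  shows "g \<in> borel_measurable lebesgue"
proof (rule borel_measurable_LIMSEQ_metric)
  show "(\<lambda>x. indicator {- real n..real n} x *\<^sub>R g x) \<in> borel_measurable lebesgue" for n
    using assms[of "- real n" "real n"] by (simp add: set_integrable_def borel_measurable_integrable)
  fix x
  obtain N where N: "\<bar>x\<bar> \<le> real N" using real_arch_simple by blast
  have "\<forall>\<^sub>F n in sequentially. indicator {- real n..real n} x *\<^sub>R g x = g x"
    using eventually_ge_at_top[of N] by eventually_elim (use N in \<open>auto simp: indicator_def\<close>)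
  then show "(\<lambda>n. indicator {- real n..real n} x *\<^sub>R g x) \<longlonglongrightarrow> g x"
    by (rule tendsto_eventually)
qed

lemma sq_norm_finite_of_compact_support:
  assumes h: "h absolutely_integrable_on {c..d}" and le: "\<And>x. x \<in> {c..d} \<Longrightarrow> (norm (f x))\<^sup>2 \<le> h x"
    and zero: "\<And>x. x \<notin> {c..d} \<Longrightarrow> f x = 0"
  shows "sq_norm f < \<infinity>"
proof -
  have "sq_norm f \<le> (\<integral>\<^sup>+ x. ennreal (norm (indicator {c..d} x *\<^sub>R h x)) \<partial>lebesgue)"
    unfolding sq_norm_def
  proof (intro nn_integral_mono ennreal_leI)
    show "(norm (f x))\<^sup>2 \<le> norm (indicator {c..d} x *\<^sub>R h x)" for x
      using le[of x] zero[of x] by (cases "x \<in> {c..d}") (auto simp: indicator_def abs_le_iff)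
  qed
  also have "\<dots> < \<infinity>"
    using h by (simp add: set_integrable_def integrable_iff_bounded)
  finally show ?thesis .
qed

lemma AE_lebesgue_shift:
  fixes P :: "real \<Rightarrow> bool"
  assumes "AE x in lebesgue. P x"
  shows "AE x in lebesgue. P (x + c)"
proof -
  obtain N where N: "negligible N" "{x. \<not> P x} \<subseteq> N"
    using assms by (auto simp: eventually_ae_filter_negligible)
  have "negligible ((+) (- c) ` N)"
    using N(1) by (rule negligible_translation)
  moreover have "{x. \<not> P (x + c)} \<subseteq> (+) (- c) ` N"
  proof
    fix x assume "x \<in> {x. \<not> P (x + c)}"
    then have "x + c \<in> N" using N(2) by auto
    then show "x \<in> (+) (- c) ` N" by (rule rev_image_eqI) simp
  qed
  ultimately show ?thesis
    by (auto simp: eventually_ae_filter_negligible)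
qed

text \<open>
  The function \<open>g\<close> is cut open at \<open>\<alpha>\<close>, one period of \<open>u\<close> is inserted, and the part to the right is
  moved by one period and multiplied by \<open>\<rho>\<close>.
\<close>

definition insert_cell :: "real \<Rightarrow> real \<Rightarrow> complex \<Rightarrow> (real \<Rightarrow> complex ^ 'n) \<Rightarrow> (real \<Rightarrow> complex ^ 'n) \<Rightarrow> real \<Rightarrow> complex ^ 'n" where
  "insert_cell \<alpha> p \<rho> u g x = (if x \<le> \<alpha> then g x else if x \<le> \<alpha> + p then u x else \<rho> *s g (x - p))"

lemma ac_deriv_insert_cell:
  assumes "ac_deriv g g'" "ac_deriv u u'" "p > 0" "g \<alpha> = u \<alpha>" "u (\<alpha> + p) = \<rho> *s u \<alpha>"
  shows "ac_deriv (insert_cell \<alpha> p \<rho> u g) (insert_cell \<alpha> p \<rho> u' g')"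
proof -
  have "ac_deriv (\<lambda>x. \<rho> *s g (x - p)) (\<lambda>x. \<rho> *s g' (x - p))"
    using ac_deriv_linear[OF ac_deriv_shift[OF assms(1), of "- p"] bounded_linear_scalar_mult] by simp
  from ac_deriv_glue[OF assms(1) ac_deriv_glue[OF assms(2) this, of "\<alpha> + p"], of \<alpha>]
  show ?thesis
    using assms(3-5) unfolding insert_cell_def[abs_def] by simp
qed

lemma sq_norm_insert_cell:
  assumes [measurable]: "g \<in> borel_measurable lebesgue" "u \<in> borel_measurable lebesgue" and "p > 0" "norm \<rho> = 1"
  shows "sq_norm (insert_cell \<alpha> p \<rho> u g) = sq_norm g + sq_norm (\<lambda>x. indicator {\<alpha><..\<alpha> + p} x *\<^sub>R u x)"
proof -
  define l r c where "l x = ennreal ((norm (g x))\<^sup>2) * indicator {..\<alpha>} x"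
    and "r x = ennreal ((norm (g x))\<^sup>2) * indicator {\<alpha><..} x"
    and "c x = ennreal ((norm (indicator {\<alpha><..\<alpha> + p} x *\<^sub>R u x))\<^sup>2)" for x
  have [measurable]: "{..\<alpha>} \<in> sets lebesgue" "{\<alpha><..} \<in> sets lebesgue" "{\<alpha><..\<alpha> + p} \<in> sets lebesgue"
    by simp_all
  have [measurable]: "l \<in> borel_measurable lebesgue" "r \<in> borel_measurable lebesgue" "c \<in> borel_measurable lebesgue"
    unfolding l_def r_def c_def by measurable
  have "(\<lambda>x. - p + 1 * x) \<in> lebesgue \<rightarrow>\<^sub>M lebesgue"
    using lebesgue_affine_measurable[of "\<lambda>_. 1" "- p :: real"] by simp
  then have "(\<lambda>x. r (- p + 1 * x)) \<in> borel_measurable lebesgue"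
    by (rule measurable_compose) measurable
  then have [measurable]: "(\<lambda>x. r (x - p)) \<in> borel_measurable lebesgue"
    by simp
  have "sq_norm (insert_cell \<alpha> p \<rho> u g) = (\<integral>\<^sup>+ x. (l x + c x) + r (x - p) \<partial>lebesgue)"
    unfolding sq_norm_def
    by (intro nn_integral_cong)
       (use assms(3,4) in \<open>auto simp: l_def r_def c_def insert_cell_def norm_scalar_mult indicator_def\<close>)
  also have "\<dots> = (\<integral>\<^sup>+ x. l x + c x \<partial>lebesgue) + (\<integral>\<^sup>+ x. r (x - p) \<partial>lebesgue)"
    by (rule nn_integral_add) measurable
  also have "(\<integral>\<^sup>+ x. l x + c x \<partial>lebesgue) = integral\<^sup>N lebesgue l + integral\<^sup>N lebesgue c"
    by (rule nn_integral_add) measurable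
  also have "(\<integral>\<^sup>+ x. r (x - p) \<partial>lebesgue) = integral\<^sup>N lebesgue r"
    using nn_integral_real_affine_lebesgue[of r 1 "- p"] by simp
  also have "(integral\<^sup>N lebesgue l + integral\<^sup>N lebesgue c) + integral\<^sup>N lebesgue r
     = (\<integral>\<^sup>+ x. l x + r x \<partial>lebesgue) + integral\<^sup>N lebesgue c"
    by (subst nn_integral_add) (auto simp: ac_simps)
  also have "(\<integral>\<^sup>+ x. l x + r x \<partial>lebesgue) = sq_norm g"
    unfolding sq_norm_def by (intro nn_integral_cong) (auto simp: l_def r_def indicator_def)
  finally show ?thesis by (simp add: sq_norm_def c_def)
qed

lemma ac_deriv_has_vector_derivative:
  assumes ac: "ac_deriv y z" and z: "continuous_on UNIV z"
  shows "(y has_vector_derivative z x) (at x)"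
proof -
  have "((\<lambda>t. integral {x - 1..t} z) has_vector_derivative z x) (at x within {x - 1..x + 1})"
    using continuous_on_subset[OF z] by (intro integral_has_vector_derivative) auto
  then have "((\<lambda>t. y (x - 1) + integral {x - 1..t} z) has_vector_derivative z x) (at x within {x - 1..x + 1})"
    by (auto intro: derivative_eq_intros)
  then have "(y has_vector_derivative z x) (at x within {x - 1..x + 1})"
  proof (rule has_vector_derivative_transform[rotated 2])
    show "y t = y (x - 1) + integral {x - 1..t} z" if "t \<in> {x - 1..x + 1}" for t
      using ac_derivD(2)[OF ac, of "x - 1" t] that by (simp add: algebra_simps)
  qed simp
  then show ?thesis
    by (simp add: at_within_Icc_at)
qed

lemma continuous_on_Icc_bounded:
  fixes f :: "real \<Rightarrow> 'b::real_normed_vector"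
  assumes "continuous_on {c..d} f"
  obtains M where "M \<ge> 0" "\<And>x. x \<in> {c..d} \<Longrightarrow> norm (f x) \<le> M"
proof -
  have "bounded (f ` {c..d})"
    using assms by (intro compact_imp_bounded compact_continuous_image) auto
  then obtain M where "M > 0" "\<forall>y\<in>f ` {c..d}. norm y \<le> M"
    unfolding bounded_pos by blast
  then show thesis
    by (intro that[of M]) auto
qed

lemma ac_deriv_cut_off:
  assumes "ac_deriv q q'" "c \<le> d" "q c = 0" "q d = 0"
  shows "ac_deriv (\<lambda>x. if x \<le> c then 0 else if x \<le> d then q x else 0) (\<lambda>x. if x \<le> c then 0 else if x \<le> d then q' x else 0)"
  using assms by (intro ac_deriv_glue ac_deriv_zero) auto

lemma schroedinger_residual_locally_integrable:
  fixes Q :: "real \<Rightarrow> complex ^ 'm ^ 'm"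
  assumes Q: "\<And>a b. Q absolutely_integrable_on {a..b}" and ac: "ac_deriv y y'" "ac_deriv y' z"
  shows "(\<lambda>x. Q x *v y x - z x - \<mu> *s y x) absolutely_integrable_on {a..b}"
proof -
  have "(\<lambda>x. Q x *v y x) absolutely_integrable_on {a..b}"
    by (rule absolutely_integrable_bilinear_continuous[OF bounded_bilinear.flip[OF bounded_bilinear_matrix_vector_mult]
        ac_deriv_continuous[OF ac(1)] Q])
  moreover have "(\<lambda>x. \<mu> *s y x) absolutely_integrable_on {a..b}"
    by (intro absolutely_integrable_continuous_real
        continuous_on_compose2[OF linear_continuous_on[OF bounded_linear_scalar_mult] ac_deriv_continuous[OF ac(1)]]) auto
  ultimately show ?thesis
    using ac_derivD(1)[OF ac(2)] by (intro set_integral_diff)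
qed

text \<open>
  A compactly supported function with prescribed data at \<open>\<alpha>\<close>: the Taylor polynomial \<open>a + t b\<close>, with
  \<open>t = x - \<alpha>\<close>, times \<open>(1 - t\<^sup>2)\<^sup>2\<close>, which vanishes to second order at \<open>t = -1\<close> and \<open>t = 1\<close>.
\<close>

lemma compact_support_initial_data:
  fixes Q :: "real \<Rightarrow> complex ^ 'm ^ 'm"
  assumes Q2: "\<And>a b. (\<lambda>x. (norm (Q x))\<^sup>2) absolutely_integrable_on {a..b}"
  obtains y y' z where "ac_deriv y y'" "ac_deriv y' z" "y \<alpha> = a" "y' \<alpha> = b"
    "sq_norm y < \<infinity>" "sq_norm (\<lambda>x. Q x *v y x - z x - \<mu> *s y x) < \<infinity>"
proof -
  obtain B where B: "B > 0" "\<And>(A :: complex ^ 'm ^ 'm) x. norm (A *v x) \<le> norm A * norm x * B"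
    using matvec.pos_bounded by blast
  define q where "q x = (1 - (x - \<alpha>)\<^sup>2)\<^sup>2 *\<^sub>R a + ((x - \<alpha>) * (1 - (x - \<alpha>)\<^sup>2)\<^sup>2) *\<^sub>R b" for x
  define q' where "q' x = (- 4 * (x - \<alpha>) * (1 - (x - \<alpha>)\<^sup>2)) *\<^sub>R a + (1 - 6 * (x - \<alpha>)\<^sup>2 + 5 * (x - \<alpha>) ^ 4) *\<^sub>R b" for x
  define q'' where "q'' x = (- 4 + 12 * (x - \<alpha>)\<^sup>2) *\<^sub>R a + (- 12 * (x - \<alpha>) + 20 * (x - \<alpha>) ^ 3) *\<^sub>R b" for x
  have ac: "ac_deriv q q'" "ac_deriv q' q''"
  proof -
    have "(q has_vector_derivative q' x) (at x)" "(q' has_vector_derivative q'' x) (at x)" for x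
      unfolding q_def q'_def q''_def
      by (rule derivative_eq_intros refl | simp add: algebra_simps power2_eq_square power4_eq_xxxx power3_eq_cube)+
    then show "ac_deriv q q'" "ac_deriv q' q''"
      by (auto intro!: ac_deriv_C1 continuous_intros simp: q'_def[abs_def] q''_def[abs_def])
  qed
  let ?c = "\<alpha> - 1" and ?d = "\<alpha> + 1"
  let ?cut = "\<lambda>f x. if x \<le> ?c then 0 else if x \<le> ?d then f x else (0 :: complex ^ 'm)"
  have q0: "q ?c = 0" "q ?d = 0" "q' ?c = 0" "q' ?d = 0"
    by (simp_all add: q_def q'_def)
  have cont: "continuous_on {?c..?d} q" "continuous_on {?c..?d} (\<lambda>x. q'' x + \<mu> *s q x)"
    by (auto simp: q_def q''_def intro!: continuous_intros
        continuous_on_compose2[OF linear_continuous_on[OF bounded_linear_scalar_mult]])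
  obtain M where M: "M \<ge> 0" "\<And>x. x \<in> {?c..?d} \<Longrightarrow> norm (q x) \<le> M"
    using continuous_on_Icc_bounded[OF cont(1)] by blast
  obtain M' where M': "M' \<ge> 0" "\<And>x. x \<in> {?c..?d} \<Longrightarrow> norm (q'' x + \<mu> *s q x) \<le> M'"
    using continuous_on_Icc_bounded[OF cont(2)] by blast
  show thesis
  proof (rule that[of "?cut q" "?cut q'" "?cut q''"])
    show "ac_deriv (?cut q) (?cut q')" "ac_deriv (?cut q') (?cut q'')"
      using ac q0 by (intro ac_deriv_cut_off; simp)+
    show "?cut q \<alpha> = a" "?cut q' \<alpha> = b"
      by (simp_all add: q_def q'_def)
    show "sq_norm (?cut q) < \<infinity>"
    proof (rule sq_norm_finite_of_compact_support)
      show "(\<lambda>x. M\<^sup>2) absolutely_integrable_on {?c..?d}"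
        by simp
      show "(norm (?cut q x))\<^sup>2 \<le> M\<^sup>2" if "x \<in> {?c..?d}" for x
        using M(2)[OF that] M(1) by (auto intro: power_mono)
    qed auto
    show "sq_norm (\<lambda>x. Q x *v ?cut q x - ?cut q'' x - \<mu> *s ?cut q x) < \<infinity>"
    proof (rule sq_norm_finite_of_compact_support)
      show "(\<lambda>x. (2 * (M * B)\<^sup>2) * (norm (Q x))\<^sup>2 + 2 * M'\<^sup>2) absolutely_integrable_on {?c..?d}"
        by (intro set_integral_add set_integrable_mult_right Q2) simp
      show "(norm (Q x *v ?cut q x - ?cut q'' x - \<mu> *s ?cut q x))\<^sup>2 \<le> (2 * (M * B)\<^sup>2) * (norm (Q x))\<^sup>2 + 2 * M'\<^sup>2"
        if x: "x \<in> {?c..?d}" for x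
      proof (cases "x = ?c")
        case False
        have "(norm (Q x *v q x + - (q'' x + \<mu> *s q x)))\<^sup>2 \<le> 2 * (norm (Q x *v q x))\<^sup>2 + 2 * (norm (- (q'' x + \<mu> *s q x)))\<^sup>2"
          by (rule power2_norm_add_le)
        also have "norm (Q x *v q x) \<le> norm (Q x) * M * B"
          using order_trans[OF B(2) mult_right_mono[OF mult_left_mono[OF M(2)[OF x]]]] B(1) by simp
        then have "2 * (norm (Q x *v q x))\<^sup>2 + 2 * (norm (- (q'' x + \<mu> *s q x)))\<^sup>2 \<le> 2 * (norm (Q x) * M * B)\<^sup>2 + 2 * M'\<^sup>2"
          unfolding norm_minus_cancel using M'(2)[OF x] by (intro add_mono mult_left_mono power_mono) auto
        finally show ?thesis
          using False x by (simp add: power_mult_distrib algebra_simps)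
      qed simp
    qed auto
  qed
qed

text \<open>
  Start with a compactly supported function that has the data of \<open>u\<close> at \<open>\<alpha>\<close> and insert cells there.
  Each cell adds the squared norm of \<open>u\<close> over one period. The residual, on the other hand, vanishes
  on the cell and is otherwise only translated and multiplied by \<open>\<rho>\<close>, so its norm never changes. No
  resolvent bound can hold for all members of this sequence.
\<close>

lemma floquet_solution_in_spectrum:
  fixes Q :: "real \<Rightarrow> complex ^ 'm ^ 'm"
  assumes Q: "\<And>a b. Q absolutely_integrable_on {a..b}"
    and Q2: "\<And>a b. (\<lambda>x. (norm (Q x))\<^sup>2) absolutely_integrable_on {a..b}"
    and per: "AE x in lebesgue. Q (x + p) = Q x" and "p > 0"
    and \<rho>: "norm \<rho> = 1" and ac: "ac_deriv u u'" "ac_deriv u' w"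
    and eq: "AE x in lebesgue. x \<in> {\<alpha>..\<alpha> + p} \<longrightarrow> w x = Q x *v u x - \<mu> *s u x"
    and bd: "u (\<alpha> + p) = \<rho> *s u \<alpha>" "u' (\<alpha> + p) = \<rho> *s u' \<alpha>"
    and t: "t \<in> {\<alpha><..<\<alpha> + p}" and nz: "u t \<noteq> 0 \<or> u' t \<noteq> 0"
  shows "\<mu> \<in> spectrum (L_op Q)"
proof (rule ccontr)
  assume "\<mu> \<notin> spectrum (L_op Q)"
  then obtain C where C: "\<And>f y. f \<in> L2 UNIV \<Longrightarrow> (y, \<lambda>x. f x + \<mu> *s y x) \<in> L_op Q \<Longrightarrow> L2_norm y \<le> C * L2_norm f"
    by (auto simp: spectrum_def resolvent_set_def)
  define res where "res y z x = Q x *v y x - z x - \<mu> *s y x" for y z x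
  define c where "c = sq_norm (\<lambda>x. indicator {\<alpha><..\<alpha> + p} x *\<^sub>R u x)"
  have cont_u: "continuous_on UNIV u" by (rule ac_deriv_continuous[OF ac(1)])
  have mc: "ac_deriv f f' \<Longrightarrow> f \<in> borel_measurable lebesgue" for f f' :: "real \<Rightarrow> complex ^ 'm"
    using ac_deriv_continuous[of f f' UNIV] continuous_imp_measurable_on_sets_lebesgue[of UNIV f] by (simp add: lebesgue_on_UNIV_eq)
  have meas_cell: "(\<lambda>x. ennreal ((norm (indicator {\<alpha><..\<alpha> + p} x *\<^sub>R u x))\<^sup>2)) \<in> borel_measurable lebesgue"
  proof -
    have [measurable]: "u \<in> borel_measurable lebesgue" "{\<alpha><..\<alpha> + p} \<in> sets lebesgue"
      using mc[OF ac(1)] by simp_all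
    show ?thesis by measurable
  qed
  have "c \<noteq> 0"
  proof
    assume "c = 0"
    then have "AE x in lebesgue. ennreal ((norm (indicator {\<alpha><..\<alpha> + p} x *\<^sub>R u x))\<^sup>2) = 0"
      unfolding c_def sq_norm_def by (subst (asm) nn_integral_0_iff_AE) (use meas_cell in auto)
    then have "AE x in lebesgue. \<not> (x \<in> {\<alpha><..<\<alpha> + p} \<and> u x \<noteq> 0)"
      by eventually_elim (auto simp: indicator_def)
    then have "negligible {x. x \<in> {\<alpha><..<\<alpha> + p} \<and> u x \<noteq> 0}"
      by (auto simp: eventually_ae_filter_negligible intro: negligible_subset)
    moreover have "open ({\<alpha><..<\<alpha> + p} \<inter> u -` (- {0}))"
      by (intro open_Int open_vimage cont_u) auto
    moreover have "{x. x \<in> {\<alpha><..<\<alpha> + p} \<and> u x \<noteq> 0} = {\<alpha><..<\<alpha> + p} \<inter> u -` (- {0})"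
      by auto
    ultimately have "{\<alpha><..<\<alpha> + p} \<inter> u -` (- {0}) = {}"
      using open_not_negligible by metis
    then have zero: "u x = 0" if "x \<in> {\<alpha><..<\<alpha> + p}" for x
      using that by auto
    have "(u has_vector_derivative u' t) (at t)"
      by (intro ac_deriv_has_vector_derivative ac ac_deriv_continuous[OF ac(2)])
    moreover have "(u has_vector_derivative 0) (at t)"
      by (rule has_vector_derivative_transform_within_open[OF has_vector_derivative_const[of 0] open_greaterThanLessThan t])
         (simp add: zero)
    ultimately have "u' t = 0"
      by (rule vector_derivative_unique_at)
    with zero[OF t] nz show False by simp
  qed
  obtain y0 y0' z0 where y0: "ac_deriv y0 y0'" "ac_deriv y0' z0" "y0 \<alpha> = u \<alpha>" "y0' \<alpha> = u' \<alpha>"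
    and fin0: "sq_norm y0 < \<infinity>" "sq_norm (res y0 z0) < \<infinity>"
    using compact_support_initial_data[OF Q2, of \<alpha> "u \<alpha>" "u' \<alpha>" \<mu>] unfolding res_def[abs_def] by blast
  have mres: "res y z \<in> borel_measurable lebesgue" if "ac_deriv y y'" "ac_deriv y' z" for y y' z
    unfolding res_def[abs_def]
    by (intro measurable_of_locally_integrable schroedinger_residual_locally_integrable[OF Q that])
  have packet: "\<exists>y y' z. ac_deriv y y' \<and> ac_deriv y' z \<and> y \<alpha> = u \<alpha> \<and> y' \<alpha> = u' \<alpha> \<and>
      sq_norm y = sq_norm y0 + of_nat n * c \<and> sq_norm (res y z) = sq_norm (res y0 z0)" for n
  proof (induction n)
    case 0
    then show ?case using y0 by auto
  next
    case (Suc n)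
    then obtain y y' z where y: "ac_deriv y y'" "ac_deriv y' z" "y \<alpha> = u \<alpha>" "y' \<alpha> = u' \<alpha>"
      and sq: "sq_norm y = sq_norm y0 + of_nat n * c" "sq_norm (res y z) = sq_norm (res y0 z0)"
      by blast
    let ?y = "insert_cell \<alpha> p \<rho> u y" and ?y' = "insert_cell \<alpha> p \<rho> u' y'" and ?z = "insert_cell \<alpha> p \<rho> w z"
    have ac': "ac_deriv ?y ?y'" "ac_deriv ?y' ?z"
      by (intro ac_deriv_insert_cell y ac bd \<open>p > 0\<close>)+
    have "AE x in lebesgue. res ?y ?z x = insert_cell \<alpha> p \<rho> (\<lambda>x. 0) (res y z) x"
      using eq AE_lebesgue_shift[OF per, of "- p"]
    proof eventually_elim
      case (elim x)
      have lin: "\<mu> *s (\<rho> *s a) = \<rho> *s (\<mu> *s a)" for a :: "complex ^ 'm"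
        by (simp add: vector_smult_assoc mult.commute)
      show ?case
        using elim by (auto simp: insert_cell_def res_def mult_scalar_vec lin vector_ssub_ldistrib)
    qed
    then have "sq_norm (res ?y ?z) = sq_norm (insert_cell \<alpha> p \<rho> (\<lambda>x. 0) (res y z))"
      unfolding sq_norm_def
    proof (intro nn_integral_cong_AE, eventually_elim)
      case (elim x)
      then show ?case by simp
    qed
    also have "\<dots> = sq_norm (res y0 z0)"
      by (subst sq_norm_insert_cell[OF mres[OF y(1,2)] _ \<open>p > 0\<close> \<rho>]) (simp_all add: sq, simp add: sq_norm_def)
    finally have 1: "sq_norm (res ?y ?z) = sq_norm (res y0 z0)" .
    have 2: "sq_norm ?y = sq_norm y0 + of_nat (Suc n) * c"
      by (subst sq_norm_insert_cell[OF mc[OF y(1)] mc[OF ac(1)] \<open>p > 0\<close> \<rho>])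
         (simp add: sq c_def[symmetric] algebra_simps)
    have 3: "?y \<alpha> = u \<alpha>" "?y' \<alpha> = u' \<alpha>"
      using y by (simp_all add: insert_cell_def)
    show ?case
      using ac' 1 2 3 by blast
  qed
  have bound: "of_nat n * c \<le> ennreal (C\<^sup>2) * sq_norm (res y0 z0)" if "c < \<infinity>" for n
  proof -
    obtain y y' z where y: "ac_deriv y y'" "ac_deriv y' z"
      and sq: "sq_norm y = sq_norm y0 + of_nat n * c" "sq_norm (res y z) = sq_norm (res y0 z0)"
      using packet by blast
    have yL: "y \<in> L2 UNIV"
      using mc[OF y(1)] fin0(1) that by (auto simp: L2_UNIV_iff sq ennreal_mult_less_top of_nat_less_top)
    have rL: "res y z \<in> L2 UNIV"
      using mres[OF y] fin0 by (auto simp: L2_UNIV_iff sq)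
    have "(y, \<lambda>x. res y z x + \<mu> *s y x) \<in> L_op Q"
      using yL L2_add_scalar_mult[OF rL yL, of \<mu>] y by (auto simp: L_op_def res_def)
    then have "L2_norm y \<le> C * L2_norm (res y z)"
      by (rule C[OF rL])
    then have "(L2_norm y)\<^sup>2 \<le> (C * L2_norm (res y z))\<^sup>2"
      using L2_norm_nonneg by (intro power_mono)
    then have "sq_norm y \<le> ennreal (C\<^sup>2) * sq_norm (res y z)"
      unfolding sq_norm_eq_L2_norm[OF yL] sq_norm_eq_L2_norm[OF rL]
      by (simp add: power_mult_distrib ennreal_leI flip: ennreal_mult)
    moreover have "of_nat n * c \<le> sq_norm y"
      unfolding sq by (rule add_increasing) simp_all
    ultimately show ?thesis
      unfolding sq(2) by (rule order_trans[rotated])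
  qed
  have "c < \<infinity>"
  proof -
    obtain M where M: "M \<ge> 0" "\<And>x. x \<in> {\<alpha>..\<alpha> + p} \<Longrightarrow> norm (u x) \<le> M"
      using continuous_on_Icc_bounded[OF continuous_on_subset[OF cont_u subset_UNIV]] by blast
    show ?thesis
      unfolding c_def
    proof (rule sq_norm_finite_of_compact_support)
      show "(\<lambda>x. M\<^sup>2) absolutely_integrable_on {\<alpha>..\<alpha> + p}" by simp
      show "(norm (indicator {\<alpha><..\<alpha> + p} x *\<^sub>R u x))\<^sup>2 \<le> M\<^sup>2" if "x \<in> {\<alpha>..\<alpha> + p}" for x
        using M(2)[OF that] by (auto simp: indicator_def intro: power_mono)
    qed (auto simp: indicator_def)
  qed
  then obtain r where r: "c = ennreal r" "r > 0"
    using \<open>c \<noteq> 0\<close> by (cases c) (auto simp: less_le)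
  obtain d where d: "ennreal (C\<^sup>2) * sq_norm (res y0 z0) = ennreal d" "d \<ge> 0"
    using fin0(2) by (cases "ennreal (C\<^sup>2) * sq_norm (res y0 z0)") (auto simp: ennreal_mult_eq_top_iff)
  have "real n * r \<le> d" for n
    using bound[OF \<open>c < \<infinity>\<close>, of n] r d
    by (simp add: ennreal_of_nat_eq_real_of_nat ennreal_le_iff flip: ennreal_mult)
  moreover obtain n where "d < real n * r"
    using reals_Archimedean3[OF r(2)] by blast
  ultimately show False
    using not_le by blast
qed

section \<open>Openness of the resolvent set\<close>

lemma ac_deriv_suminf:
  fixes y z :: "nat \<Rightarrow> real \<Rightarrow> 'b::euclidean_space"
  assumes ac: "\<And>k. ac_deriv (y k) (z k)"
    and sy: "\<And>x. summable (\<lambda>k. y k x)"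
    and sz: "\<And>x. summable (\<lambda>k. norm (z k x))"
    and int: "\<And>a b. summable (\<lambda>k. integral {a..b} (\<lambda>x. norm (z k x)))"
  shows "ac_deriv (\<lambda>x. \<Sum>k. y k x) (\<lambda>x. \<Sum>k. z k x)"
  unfolding ac_deriv_def
proof (intro allI impI)
  fix a b :: real assume "a \<le> b"
  define f where "f k x = indicator {a..b} x *\<^sub>R z k x" for k x
  have f: "integrable lebesgue (f k)" for k
    using ac_derivD(1)[OF ac[of k], of a b] by (simp add: set_integrable_def f_def[abs_def])
  have sf: "AE x in lebesgue. summable (\<lambda>k. norm (f k x))"
    using sz by (auto simp: f_def indicator_def)
  have "integral\<^sup>L lebesgue (\<lambda>x. norm (f k x)) = integral {a..b} (\<lambda>x. norm (z k x))" for k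
  proof -
    have "(LINT x:{a..b}|lebesgue. norm (z k x)) = integral {a..b} (\<lambda>x. norm (z k x))"
      using absolutely_integrable_norm[OF ac_derivD(1)[OF ac[of k], of a b]]
      by (intro set_lebesgue_integral_eq_integral(2)) (simp add: o_def)
    then show ?thesis by (simp add: set_lebesgue_integral_def f_def)
  qed
  then have sumf: "summable (\<lambda>k. integral\<^sup>L lebesgue (\<lambda>x. norm (f k x)))"
    using int by simp
  have fsum: "(\<lambda>x. \<Sum>k. f k x) = (\<lambda>x. indicator {a..b} x *\<^sub>R (\<Sum>k. z k x))"
    by (auto simp: f_def indicator_def)
  have ai: "(\<lambda>x. \<Sum>k. z k x) absolutely_integrable_on {a..b}"
    using integrable_suminf[OF f sf sumf] unfolding fsum set_integrable_def .
  have "(LINT x:{a..b}|lebesgue. z k x) = y k b - y k a" for k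
    using set_lebesgue_integral_eq_integral(2)[OF ac_derivD(1)[OF ac[of k], of a b]] ac_derivD(2)[OF ac[of k] \<open>a \<le> b\<close>] by simp
  then have fk: "integral\<^sup>L lebesgue (f k) = y k b - y k a" for k
    by (simp add: set_lebesgue_integral_def f_def[abs_def])
  have "integral {a..b} (\<lambda>x. \<Sum>k. z k x) = (LINT x:{a..b}|lebesgue. (\<Sum>k. z k x))"
    using set_lebesgue_integral_eq_integral(2)[OF ai] by simp
  also have "\<dots> = (\<Sum>k. y k b - y k a)"
    using integral_suminf[OF f sf sumf] unfolding fsum fk set_lebesgue_integral_def .
  also have "\<dots> = (\<Sum>k. y k b) - (\<Sum>k. y k a)"
    by (rule suminf_diff[OF sy sy, symmetric])
  finally show "(\<lambda>x. \<Sum>k. z k x) absolutely_integrable_on {a..b} \<and>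
      (\<Sum>k. y k b) - (\<Sum>k. y k a) = integral {a..b} (\<lambda>x. \<Sum>k. z k x)"
    using ai by simp
qed

lemma AE_lebesgue_ex_in_interval:
  fixes c d :: real
  assumes "AE x in lebesgue. P x" and "c < d"
  shows "\<exists>x\<in>{c..d}. P x"
proof -
  obtain N where N: "negligible N" "{x. \<not> P x} \<subseteq> N"
    using assms by (auto simp: eventually_ae_filter_negligible)
  have "\<not> negligible {c<..<d}"
    using \<open>c < d\<close> by (intro open_not_negligible) auto
  then have "\<not> {c<..<d} \<subseteq> N"
    using N(1) negligible_subset by blast
  then obtain x where "x \<in> {c<..<d}" "x \<notin> N"
    by blast
  then show ?thesis
    using N(2) by (intro bexI[of _ x]) auto
qed

lemma norm_increment_le:
  assumes ac: "ac_deriv y z" and "x \<in> {a..b}" "s \<in> {a..b}"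
  shows "norm (y x - y s) \<le> integral {a..b} (\<lambda>t. norm (z t))"
proof -
  have nz: "(\<lambda>t. norm (z t)) integrable_on {c..d}" for c d
    using absolutely_integrable_norm[OF ac_derivD(1)[OF ac, of c d]]
    by (auto simp: o_def dest: set_lebesgue_integral_eq_integral(1))
  have *: "norm (y d - y c) \<le> integral {a..b} (\<lambda>t. norm (z t))" if "c \<le> d" "c \<in> {a..b}" "d \<in> {a..b}" for c d
  proof -
    have "norm (y d - y c) \<le> integral {c..d} (\<lambda>t. norm (z t))"
      unfolding ac_derivD(2)[OF ac \<open>c \<le> d\<close>]
      by (intro integral_norm_bound_integral set_lebesgue_integral_eq_integral(1)[OF ac_derivD(1)[OF ac]] nz order_refl)
    also have "\<dots> \<le> integral {a..b} (\<lambda>t. norm (z t))"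
      by (rule integral_subset_le) (use that nz in auto)
    finally show ?thesis .
  qed
  show ?thesis
    using *[of s x] *[of x s] assms(2,3) by (cases "s \<le> x") (auto simp: norm_minus_commute)
qed

text \<open>
  A derivative differs from its mean value over \<open>[t', t]\<close> at most by its total variation, and the
  mean value is a difference quotient.
\<close>

lemma derivative_bound_of_two_values:
  assumes y: "ac_deriv y y'" and y': "ac_deriv y' z"
    and t: "t' \<in> {a..b}" "t \<in> {a..b}" "t' + 1 \<le> t" and x: "x \<in> {a..b}"
  shows "norm (y' x) \<le> norm (y t) + norm (y t') + integral {a..b} (\<lambda>s. norm (z s))"
proof -
  define D where "D = integral {a..b} (\<lambda>s. norm (z s))"
  define L where "L = t - t'"
  have L: "L \<ge> 1" "t' \<le> t" using t by (auto simp: L_def)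
  have y'_int: "y' integrable_on {t'..t}"
    by (intro set_lebesgue_integral_eq_integral(1) ac_derivD[OF y])
  have "L *\<^sub>R y' x = (y t - y t') - integral {t'..t} (\<lambda>s. y' s - y' x)"
    unfolding ac_derivD(2)[OF y L(2)]
    by (subst Henstock_Kurzweil_Integration.integral_diff) (use y'_int L in \<open>auto simp: L_def\<close>)
  also have "norm \<dots> \<le> norm (y t - y t') + norm (integral {t'..t} (\<lambda>s. y' s - y' x))"
    by (rule norm_triangle_ineq4)
  also have "norm (integral {t'..t} (\<lambda>s. y' s - y' x)) \<le> integral {t'..t} (\<lambda>s. D)"
  proof (rule integral_norm_bound_integral)
    show "norm (y' s - y' x) \<le> D" if "s \<in> {t'..t}" for s
      unfolding D_def using that t x by (intro norm_increment_le[OF y']) auto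
  qed (use y'_int in \<open>auto intro!: Henstock_Kurzweil_Integration.integrable_diff\<close>)
  also have "integral {t'..t} (\<lambda>s. D) = L * D"
    using L by (simp add: L_def)
  finally have "L * norm (y' x) \<le> norm (y t - y t') + L * D"
    using L by simp
  also have "\<dots> \<le> L * (norm (y t) + norm (y t')) + L * D"
    using mult_right_mono[OF L(1), of "norm (y t) + norm (y t')"] norm_triangle_ineq4[of "y t" "y t'"] by simp
  finally have "L * norm (y' x) \<le> L * (norm (y t) + norm (y t') + D)"
    by (simp add: algebra_simps)
  then show ?thesis
    using L by (simp add: D_def)
qed

text \<open>
  Two points at which the series of values converges, at distance at least \<open>1\<close>, control the
  derivatives on every bounded interval that contains them, and these control the values.
\<close>

lemma summable_values_of_second_derivatives:
  fixes y y' z :: "nat \<Rightarrow> real \<Rightarrow> 'b::euclidean_space"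
  assumes y: "\<And>k. ac_deriv (y k) (y' k)" and y': "\<And>k. ac_deriv (y' k) (z k)"
    and sz: "\<And>a b. summable (\<lambda>k. integral {a..b} (\<lambda>x. norm (z k x)))"
    and sy: "AE x in lebesgue. summable (\<lambda>k. norm (y k x))"
  shows "summable (\<lambda>k. norm (y k x))" and "summable (\<lambda>k. norm (y' k x))"
    and "summable (\<lambda>k. integral {c..d} (\<lambda>x. norm (y' k x)))"
proof -
  obtain t' where t': "t' \<in> {- 1..0}" "summable (\<lambda>k. norm (y k t'))"
    using AE_lebesgue_ex_in_interval[OF sy, of "- 1" 0] by force
  obtain t where t: "t \<in> {1..2}" "summable (\<lambda>k. norm (y k t))"
    using AE_lebesgue_ex_in_interval[OF sy, of 1 2] by force
  have nint: "(\<lambda>s. norm (y' k s)) integrable_on {a..b}" for k a b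
    using absolutely_integrable_norm[OF ac_derivD(1)[OF y[of k], of a b]]
    by (auto simp: o_def dest: set_lebesgue_integral_eq_integral(1))
  define e where "e a b k = norm (y k t) + norm (y k t') + integral {a..b} (\<lambda>s. norm (z k s))" for a b k
  have se: "summable (e a b)" for a b
    unfolding e_def by (intro summable_add t t' sz)
  have bd: "norm (y' k x) \<le> e a b k" if "a \<le> - 1" "2 \<le> b" "x \<in> {a..b}" for a b k x
    unfolding e_def by (rule derivative_bound_of_two_values[OF y y']) (use that t t' in auto)
  have ibd: "integral {a..b} (\<lambda>s. norm (y' k s)) \<le> (b - a) * e a b k" if "a \<le> - 1" "2 \<le> b" for a b k
  proof -
    have "integral {a..b} (\<lambda>s. norm (y' k s)) \<le> integral {a..b} (\<lambda>s. e a b k)"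
      by (rule integral_le) (use bd that nint in auto)
    then show ?thesis using that by simp
  qed
  define a b where "a = min (- 1) (min x c)" and "b = max 2 (max x d)"
  have ab: "a \<le> - 1" "2 \<le> b" "x \<in> {a..b}" "{c..d} \<subseteq> {a..b}"
    by (auto simp: a_def b_def)
  show "summable (\<lambda>k. norm (y' k x))"
    by (rule summable_comparison_test'[OF se[of a b]]) (use bd[OF ab(1-3)] in auto)
  show "summable (\<lambda>k. norm (y k x))"
  proof (rule summable_comparison_test'[of "\<lambda>k. norm (y k t) + (b - a) * e a b k" 0])
    show "summable (\<lambda>k. norm (y k t) + (b - a) * e a b k)"
      by (intro summable_add t summable_mult se)
    fix k
    have "norm (y k x - y k t) \<le> integral {a..b} (\<lambda>s. norm (y' k s))"
      by (rule norm_increment_le[OF y]) (use ab t in auto)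
    also have "\<dots> \<le> (b - a) * e a b k" by (rule ibd[OF ab(1,2)])
    finally show "norm (norm (y k x)) \<le> norm (y k t) + (b - a) * e a b k"
      using norm_triangle_sub[of "y k x" "y k t"] by simp
  qed
  show "summable (\<lambda>k. integral {c..d} (\<lambda>x. norm (y' k x)))"
  proof (rule summable_comparison_test'[of "\<lambda>k. (b - a) * e a b k" 0])
    show "summable (\<lambda>k. (b - a) * e a b k)"
      by (intro summable_mult se)
    fix k
    have "integral {c..d} (\<lambda>x. norm (y' k x)) \<le> integral {a..b} (\<lambda>x. norm (y' k x))"
      by (rule integral_subset_le) (use ab nint in auto)
    also have "\<dots> \<le> (b - a) * e a b k" by (rule ibd[OF ab(1,2)])
    finally show "norm (integral {c..d} (\<lambda>x. norm (y' k x))) \<le> (b - a) * e a b k"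
      using nint by (simp add: integral_nonneg)
  qed
qed

lemma L_opD:
  assumes "(y, f) \<in> L_op Q"
  obtains y' where "ac_deriv y y'" "ac_deriv y' (\<lambda>x. Q x *v y x - f x)"
proof -
  obtain y' y'' where y: "ac_deriv y y'" "ac_deriv y' y''" "AE x in lebesgue. f x = - y'' x + Q x *v y x"
    using assms by (auto simp: L_op_def)
  have "AE x in lebesgue. y'' x = Q x *v y x - f x"
    using y(3) by eventually_elim simp
  from that[OF y(1) ac_deriv_AE_cong[OF y(2) this]] show thesis .
qed

lemma L2_zero: "(\<lambda>x. 0) \<in> L2 UNIV"
  by (simp add: L2_UNIV_iff sq_norm_def)

lemma L2_scalar_mult:
  fixes g :: "real \<Rightarrow> complex ^ 'n"
  assumes "g \<in> L2 UNIV"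
  shows "(\<lambda>x. c *s g x) \<in> L2 UNIV"
  using L2_add_scalar_mult[OF L2_zero assms, of c] by simp

lemma L2_norm_scalar_mult:
  fixes g :: "real \<Rightarrow> complex ^ 'n"
  shows "(L2_norm (\<lambda>x. c *s g x))\<^sup>2 = (norm c)\<^sup>2 * (L2_norm g)\<^sup>2"
  by (simp add: L2_norm_def norm_scalar_mult power_mult_distrib)

lemma L2_norm_add_le:
  fixes f g :: "real \<Rightarrow> complex ^ 'n"
  assumes f: "f \<in> L2 UNIV" and g: "g \<in> L2 UNIV"
  shows "(L2_norm (\<lambda>x. f x + c *s g x))\<^sup>2 \<le> 2 * (L2_norm f)\<^sup>2 + 2 * ((norm c)\<^sup>2 * (L2_norm g)\<^sup>2)"
proof -
  note cg = L2_scalar_mult[OF g, of c]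
  have "ennreal ((L2_norm (\<lambda>x. f x + c *s g x))\<^sup>2) \<le> 2 * ennreal ((L2_norm f)\<^sup>2) + 2 * ennreal ((L2_norm (\<lambda>x. c *s g x))\<^sup>2)"
    using sq_norm_add_le[of f "\<lambda>x. c *s g x"] f cg
    unfolding sq_norm_eq_L2_norm[OF f, symmetric] sq_norm_eq_L2_norm[OF cg, symmetric]
      sq_norm_eq_L2_norm[OF L2_add_scalar_mult[OF f g], symmetric] by (simp add: L2_UNIV_iff)
  also have "\<dots> = ennreal (2 * (L2_norm f)\<^sup>2 + 2 * (L2_norm (\<lambda>x. c *s g x))\<^sup>2)"
    by (simp add: ennreal_mult)
  finally show ?thesis
    by (subst (asm) ennreal_le_iff) (auto simp: L2_norm_scalar_mult)
qed

lemma L2_local_integral: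
  assumes "f \<in> L2 UNIV"
  shows "(\<lambda>x. (norm (f x))\<^sup>2) integrable_on {a..b}"
    and "integral {a..b} (\<lambda>x. (norm (f x))\<^sup>2) \<le> (L2_norm f)\<^sup>2"
proof -
  have int: "integrable lebesgue (\<lambda>x. (norm (f x))\<^sup>2)"
    using assms by (simp add: L2_def lebesgue_on_UNIV_eq)
  then have ai: "(\<lambda>x. (norm (f x))\<^sup>2) absolutely_integrable_on UNIV"
    by (simp add: set_integrable_def)
  show 1: "(\<lambda>x. (norm (f x))\<^sup>2) integrable_on {a..b}"
    by (intro set_lebesgue_integral_eq_integral(1) absolutely_integrable_on_subinterval[OF ai]) simp
  have "integral {a..b} (\<lambda>x. (norm (f x))\<^sup>2) \<le> integral UNIV (\<lambda>x. (norm (f x))\<^sup>2)"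
    by (rule integral_subset_le) (use 1 set_lebesgue_integral_eq_integral(1)[OF ai] in auto)
  also have "\<dots> = (LINT x|lebesgue. (norm (f x))\<^sup>2)"
    using set_lebesgue_integral_eq_integral(2)[OF ai] by (simp add: set_lebesgue_integral_def)
  also have "\<dots> = (L2_norm f)\<^sup>2"
    by (simp add: L2_norm_def)
  finally show "integral {a..b} (\<lambda>x. (norm (f x))\<^sup>2) \<le> (L2_norm f)\<^sup>2" .
qed

lemma weighted_young:
  fixes a b w :: real
  assumes "w > 0"
  shows "a * b \<le> (w * a\<^sup>2 + b\<^sup>2 / w) / 2"
proof -
  have "0 \<le> (w * a - b)\<^sup>2 / w" using assms by simp
  also have "\<dots> = w * a\<^sup>2 + b\<^sup>2 / w - 2 * (a * b)"
    using assms by (simp add: power2_diff field_simps power2_eq_square)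
  finally show ?thesis by simp
qed

text \<open>
  The weighted Cauchy-Schwarz inequality
  \<open>(\<Sum>k. a k)\<^sup>2 \<le> (\<Sum>k. (1/4) ^ k) * (\<Sum>k. 4 ^ k * (a k)\<^sup>2)\<close>, applied pointwise to \<open>a k = norm (y k x)\<close>, bounds
  the square of the sum by \<open>\<Sum>k. 4 ^ k * (norm (y k x))\<^sup>2\<close>, where sum and integral can be exchanged. Where
  the latter series converges, Young's inequality makes the former converge absolutely. The weights still beat the decay \<open>(1/16) ^ k\<close>.
\<close>

lemma geometric_L2_series:
  fixes y :: "nat \<Rightarrow> real \<Rightarrow> complex ^ 'n"
  assumes L2: "\<And>k. y k \<in> L2 UNIV" and le: "\<And>k. (L2_norm (y k))\<^sup>2 \<le> N * (1 / 16) ^ k"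
  shows "AE x in lebesgue. summable (\<lambda>k. norm (y k x))"
    and "sq_norm (\<lambda>x. \<Sum>k. y k x) < \<infinity>"
proof -
  define h where "h k x = 4 ^ k * (norm (y k x))\<^sup>2" for k x
  have h0: "h k x \<ge> 0" for k x by (simp add: h_def)
  have meas: "y k \<in> borel_measurable lebesgue" for k using L2 by (simp add: L2_UNIV_iff)
  have mh: "(\<lambda>x. ennreal (h k x)) \<in> borel_measurable lebesgue" for k
    unfolding h_def using meas[of k] by measurable
  have "N \<ge> 0" using order_trans[OF zero_le_power2 le[of 0]] by simp
  have hk: "(\<integral>\<^sup>+ x. ennreal (h k x) \<partial>lebesgue) \<le> ennreal (N * (1 / 4) ^ k)" for k
  proof -
    have "(\<integral>\<^sup>+ x. ennreal (h k x) \<partial>lebesgue) = ennreal (4 ^ k) * sq_norm (y k)"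
      unfolding sq_norm_def using meas[of k] by (subst nn_integral_cmult[symmetric]) (auto simp: h_def ennreal_mult)
    also have "\<dots> = ennreal (4 ^ k * (L2_norm (y k))\<^sup>2)"
      by (simp add: sq_norm_eq_L2_norm[OF L2] ennreal_mult)
    also have "\<dots> \<le> ennreal (4 ^ k * (N * (1 / 16) ^ k))"
      by (intro ennreal_leI mult_left_mono le) simp
    also have "4 ^ k * (N * (1 / 16) ^ k) = N * (4 * (1 / 16)) ^ k"
      by (simp only: power_mult_distrib mult.left_commute)
    finally show ?thesis by simp
  qed
  have "(\<integral>\<^sup>+ x. (\<Sum>k. ennreal (h k x)) \<partial>lebesgue) = (\<Sum>k. \<integral>\<^sup>+ x. ennreal (h k x) \<partial>lebesgue)"
    by (rule nn_integral_suminf[OF mh])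
  also have "\<dots> \<le> (\<Sum>k. ennreal (N * (1 / 4) ^ k))"
    by (intro suminf_le hk summableI)
  also have "\<dots> = ennreal (\<Sum>k. N * (1 / 4) ^ k)"
    using \<open>N \<ge> 0\<close> by (intro suminf_ennreal2) (auto intro!: summable_mult summable_geometric)
  finally have fin: "(\<integral>\<^sup>+ x. (\<Sum>k. ennreal (h k x)) \<partial>lebesgue) < \<infinity>"
    by (rule order.strict_trans1) simp
  have "AE x in lebesgue. (\<Sum>k. ennreal (h k x)) \<noteq> \<infinity>"
    using fin mh by (intro nn_integral_noteq_infinite borel_measurable_suminf_order) auto
  then have sh: "AE x in lebesgue. summable (\<lambda>k. h k x)"
    by eventually_elim (auto intro: summable_suminf_not_top h0)
  have geo: "summable (\<lambda>k. (1 / 4 :: real) ^ k)" by (intro summable_geometric) simp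
  have sy: "summable (\<lambda>k. norm (y k x))" if "summable (\<lambda>k. h k x)" for x
  proof (rule summable_comparison_test'[of "\<lambda>k. (h k x + (1 / 4) ^ k) / 2" 0])
    show "summable (\<lambda>k. (h k x + (1 / 4) ^ k) / 2)"
      by (intro summable_divide summable_add that geo)
    show "norm (norm (y k x)) \<le> (h k x + (1 / 4) ^ k) / 2" for k
      using weighted_young[of "4 ^ k" "norm (y k x)" 1] by (simp add: h_def power_divide)
  qed
  show "AE x in lebesgue. summable (\<lambda>k. norm (y k x))"
    using sh by (rule eventually_mono) (rule sy)
  have cs: "(norm (\<Sum>k. y k x))\<^sup>2 \<le> 2 * (\<Sum>k. h k x)" if s: "summable (\<lambda>k. h k x)" for x
  proof -
    have "(norm (\<Sum>k<n. y k x))\<^sup>2 \<le> 2 * (\<Sum>k. h k x)" for n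
    proof -
      have "(norm (\<Sum>k<n. y k x))\<^sup>2 \<le> (\<Sum>k<n. (1 / 2) ^ k * (2 ^ k * norm (y k x)))\<^sup>2"
        by (intro power_mono sum_norm_le) (simp_all add: power_divide)
      also have "\<dots> \<le> (\<Sum>k<n. ((1 / 2) ^ k)\<^sup>2) * (\<Sum>k<n. (2 ^ k * norm (y k x))\<^sup>2)"
        by (rule Cauchy_Schwarz_ineq_sum)
      also have "(\<Sum>k<n. ((1 / 2) ^ k)\<^sup>2) = (\<Sum>k<n. (1 / 4 :: real) ^ k)"
        by (intro sum.cong) (auto simp: power_divide power2_eq_square simp flip: power_mult_distrib)
      also have "(\<Sum>k<n. (2 ^ k * norm (y k x))\<^sup>2) = (\<Sum>k<n. h k x)"
      proof (rule sum.cong)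
        have "(2 ^ k)\<^sup>2 = (4::real) ^ k" for k :: nat
          by (simp add: power2_eq_square flip: power_mult_distrib)
        then show "(2 ^ k * norm (y k x))\<^sup>2 = h k x" for k
          by (simp add: h_def power_mult_distrib)
      qed simp
      also have "(\<Sum>k<n. (1 / 4 :: real) ^ k) * (\<Sum>k<n. h k x) \<le> 2 * (\<Sum>k. h k x)"
      proof (intro mult_mono)
        have "(\<Sum>k<n. (1 / 4 :: real) ^ k) \<le> (\<Sum>k. (1 / 4) ^ k)"
          by (intro sum_le_suminf geo) auto
        also have "\<dots> = 4 / 3" by (subst suminf_geometric) auto
        finally show "(\<Sum>k<n. (1 / 4 :: real) ^ k) \<le> 2" by simp
        show "(\<Sum>k<n. h k x) \<le> (\<Sum>k. h k x)"
          by (intro sum_le_suminf s) (auto simp: h0)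
      qed (auto intro!: sum_nonneg h0)
      finally show ?thesis .
    qed
    moreover have "(\<lambda>n. (norm (\<Sum>k<n. y k x))\<^sup>2) \<longlonglongrightarrow> (norm (\<Sum>k. y k x))\<^sup>2"
      by (intro tendsto_power tendsto_norm summable_LIMSEQ summable_norm_cancel[OF sy[OF s]])
    ultimately show ?thesis
      by (intro LIMSEQ_le_const2) auto
  qed
  have "sq_norm (\<lambda>x. \<Sum>k. y k x) \<le> (\<integral>\<^sup>+ x. 2 * (\<Sum>k. ennreal (h k x)) \<partial>lebesgue)"
    unfolding sq_norm_def
  proof (rule nn_integral_mono_AE)
    show "AE x in lebesgue. ennreal ((norm (\<Sum>k. y k x))\<^sup>2) \<le> 2 * (\<Sum>k. ennreal (h k x))"
      using sh
    proof eventually_elim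
      case (elim x)
      have "ennreal ((norm (\<Sum>k. y k x))\<^sup>2) \<le> ennreal (2 * (\<Sum>k. h k x))"
        by (intro ennreal_leI cs elim)
      also have "\<dots> = 2 * (\<Sum>k. ennreal (h k x))"
        by (simp add: ennreal_mult suminf_nonneg elim h0 suminf_ennreal2)
      finally show ?case .
    qed
  qed
  also have "\<dots> = 2 * (\<integral>\<^sup>+ x. (\<Sum>k. ennreal (h k x)) \<partial>lebesgue)"
    using mh by (intro nn_integral_cmult borel_measurable_suminf_order) auto
  also have "\<dots> < \<infinity>"
    using fin by (simp add: ennreal_mult_less_top)
  finally show "sq_norm (\<lambda>x. \<Sum>k. y k x) < \<infinity>" .
qed

text \<open>
  Young's inequality with a free weight \<open>w\<close> separates the square integrable factors \<open>Q\<close> and \<open>y\<close>. For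
  \<open>N = const * (1/16) ^ k\<close>, the choice \<open>w = 4 ^ k\<close> makes the bound decay like \<open>(1/4) ^ k\<close>.
\<close>

lemma schroedinger_second_derivative_bound:
  fixes Q :: "real \<Rightarrow> complex ^ 'm ^ 'm"
  assumes Q2: "\<And>a b. (\<lambda>x. (norm (Q x))\<^sup>2) absolutely_integrable_on {a..b}"
  obtains K where "\<And>y g z w N. y \<in> L2 UNIV \<Longrightarrow> g \<in> L2 UNIV \<Longrightarrow> w > 0 \<Longrightarrow>
      (L2_norm y)\<^sup>2 \<le> N \<Longrightarrow> (L2_norm g)\<^sup>2 \<le> N \<Longrightarrow>
      z = (\<lambda>x. Q x *v y x - (g x + \<mu> *s y x)) \<Longrightarrow> z absolutely_integrable_on {a..b} \<Longrightarrow>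
      integral {a..b} (\<lambda>x. norm (z x)) \<le> K * (w * N + 1 / w)"
proof -
  obtain B where B: "B > 0" "\<And>(A :: complex ^ 'm ^ 'm) x. norm (A *v x) \<le> norm A * norm x * B"
    using matvec.pos_bounded by blast
  define q where "q = integral {a..b} (\<lambda>x. (norm (Q x))\<^sup>2)"
  have Q2i: "(\<lambda>x. (norm (Q x))\<^sup>2) integrable_on {a..b}"
    by (rule set_lebesgue_integral_eq_integral(1)[OF Q2])
  have "q \<ge> 0" unfolding q_def using Q2i by (rule integral_nonneg) simp
  define l where "l = integral {a..b} (\<lambda>x::real. 1 :: real)"
  have "l \<ge> 0" unfolding l_def by (rule integral_nonneg) auto
  define m where "m = norm \<mu>"
  have "m \<ge> 0" by (simp add: m_def)
  define K where "K = B + 1 + m + B * q + l + m * l"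
  show thesis
  proof (rule that[of K])
    fix y g z w N
    assume y: "y \<in> L2 UNIV" and g: "g \<in> L2 UNIV" and w: "w > (0 :: real)"
      and yN: "(L2_norm y)\<^sup>2 \<le> N" and gN: "(L2_norm g)\<^sup>2 \<le> N"
      and z: "z = (\<lambda>x. Q x *v y x - (g x + \<mu> *s y x))" and zi: "z absolutely_integrable_on {a..b}"
    define Y G where "Y x = (norm (y x))\<^sup>2" and "G x = (norm (g x))\<^sup>2" for x
    have YG: "Y integrable_on {a..b}" "G integrable_on {a..b}" "integral {a..b} Y \<le> N" "integral {a..b} G \<le> N"
      using L2_local_integral[OF y, of a b] L2_local_integral[OF g, of a b] yN gN by (auto simp: Y_def[abs_def] G_def[abs_def])
    have "N \<ge> 0" using yN order_trans zero_le_power2 by blast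
    define IY IG where "IY = integral {a..b} Y" and "IG = integral {a..b} G"
    let ?F = "\<lambda>x. B * ((w * Y x + (norm (Q x))\<^sup>2 / w) / 2) + ((w * G x + 1 / w) / 2 + m * ((w * Y x + 1 / w) / 2))"
    let ?I = "B * ((w * IY + q / w) / 2) + ((w * IG + l * (1 / w)) / 2 + m * ((w * IY + l * (1 / w)) / 2))"
    have F: "(?F has_integral ?I) {a..b}"
    proof -
      have 1: "(Y has_integral IY) {a..b}" "(G has_integral IG) {a..b}"
        "((\<lambda>x. (norm (Q x))\<^sup>2) has_integral q) {a..b}"
        using YG Q2i by (auto simp: q_def IY_def IG_def intro: integrable_integral)
      have "((\<lambda>x. 1 * (1 / w)) has_integral l * (1 / w)) {a..b}"
        unfolding l_def by (intro has_integral_mult_left integrable_integral) auto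
      then have 2: "((\<lambda>x. 1 / w) has_integral l * (1 / w)) {a..b}" by simp
      show ?thesis
        by (intro has_integral_add has_integral_mult_right has_integral_divide 1 2)
    qed
    have "integral {a..b} (\<lambda>x. norm (z x)) \<le> integral {a..b} ?F"
    proof (rule integral_le)
      show "(\<lambda>x. norm (z x)) integrable_on {a..b}"
        using absolutely_integrable_norm[OF zi] by (auto simp: o_def dest: set_lebesgue_integral_eq_integral(1))
      show "?F integrable_on {a..b}" using F by blast
      fix x
      have "norm (z x) \<le> norm (Q x *v y x) + (norm (g x) + norm (\<mu> *s y x))"
        unfolding z by (rule order_trans[OF norm_triangle_ineq4 add_left_mono[OF norm_triangle_ineq]])
      also have "\<dots> \<le> B * (norm (y x) * norm (Q x)) + (norm (g x) * 1 + m * (norm (y x) * 1))"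
        using B(2)[of "Q x" "y x"] by (simp add: norm_scalar_mult m_def mult.commute mult.left_commute)
      also have "\<dots> \<le> B * ((w * Y x + (norm (Q x))\<^sup>2 / w) / 2) + ((w * G x + 1\<^sup>2 / w) / 2 + m * ((w * Y x + 1\<^sup>2 / w) / 2))"
        unfolding Y_def G_def using B(1) \<open>m \<ge> 0\<close>
        by (intro add_mono mult_left_mono weighted_young w) auto
      finally show "norm (z x) \<le> ?F x" by (simp only: one_power2)
    qed
    also have "\<dots> = ?I"
      using F by (rule integral_unique)
    also have "\<dots> \<le> B * (w * N + q / w) + ((w * N + l * (1 / w)) + m * (w * N + l * (1 / w)))"
    proof -
      have half: "u / 2 \<le> v" if "u \<le> v" "0 \<le> v" for u v :: real
        using that by simp
      have h: "w * IY \<le> w * N" "w * IG \<le> w * N" "0 \<le> w * N" "0 \<le> q / w" "0 \<le> l * (1 / w)"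
        using YG w \<open>q \<ge> 0\<close> \<open>l \<ge> 0\<close> \<open>N \<ge> 0\<close> by (auto simp: IY_def IG_def)
      have "(w * IY + q / w) / 2 \<le> w * N + q / w" "(w * IG + l * (1 / w)) / 2 \<le> w * N + l * (1 / w)"
        "(w * IY + l * (1 / w)) / 2 \<le> w * N + l * (1 / w)"
        by (intro half add_mono add_nonneg_nonneg order_refl h)+
      then show ?thesis
        using B(1) \<open>m \<ge> 0\<close> by (intro add_mono mult_left_mono) auto
    qed
    also have "\<dots> = (B + 1 + m) * (w * N) + (B * q + l + m * l) * (1 / w)"
      by (simp add: algebra_simps)
    also have "\<dots> \<le> K * (w * N) + K * (1 / w)"
      using B(1) \<open>m \<ge> 0\<close> \<open>q \<ge> 0\<close> \<open>l \<ge> 0\<close> \<open>N \<ge> 0\<close> w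
      by (intro add_mono mult_right_mono) (auto simp: K_def)
    finally show "integral {a..b} (\<lambda>x. norm (z x)) \<le> K * (w * N + 1 / w)"
      by (simp add: algebra_simps)
  qed
qed

text \<open>
  The Neumann series: with \<open>R\<close> the inverse at \<open>\<mu>\<close> and \<open>\<epsilon> = \<nu> - \<mu>\<close>, the functions \<open>y k = R (G k)\<close>,
  \<open>G 0 = f\<close>, \<open>G (k + 1) = \<epsilon> y k\<close>, have the sum \<open>S\<close> with \<open>(L - \<mu>) S = f + \<epsilon> S\<close>. Instead of appealing to
  closedness of the operator in \<open>L\<^sub>2\<close>, the series is shown to converge pointwise together with its
  derivatives, so that the sum can be identified as a solution directly.
\<close>

lemma resolvent_set_neighbourhood:
  fixes Q :: "real \<Rightarrow> complex ^ 'm ^ 'm"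
  assumes Q2: "\<And>a b. (\<lambda>x. (norm (Q x))\<^sup>2) absolutely_integrable_on {a..b}"
    and \<mu>: "\<mu> \<in> resolvent_set (L_op Q)"
  obtains r where "r > 0" "\<And>\<nu>. norm (\<nu> - \<mu>) < r \<Longrightarrow> \<nu> \<in> resolvent_set (L_op Q)"
proof -
  obtain C0 where surj: "\<And>f. f \<in> L2 UNIV \<Longrightarrow> \<exists>y. (y, \<lambda>x. f x + \<mu> *s y x) \<in> L_op Q"
    and C0: "\<And>f y. f \<in> L2 UNIV \<Longrightarrow> (y, \<lambda>x. f x + \<mu> *s y x) \<in> L_op Q \<Longrightarrow> L2_norm y \<le> C0 * L2_norm f"
    using \<mu> by (auto simp: resolvent_set_def)
  define C where "C = max 1 C0"
  have "C \<ge> 1" by (simp add: C_def)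
  have C: "(L2_norm y)\<^sup>2 \<le> C\<^sup>2 * (L2_norm f)\<^sup>2" if "f \<in> L2 UNIV" "(y, \<lambda>x. f x + \<mu> *s y x) \<in> L_op Q" for f y
  proof -
    have "L2_norm y \<le> C * L2_norm f"
      using C0[OF that] mult_right_mono[of C0 C "L2_norm f"] L2_norm_nonneg[of f] by (auto simp: C_def)
    then have "(L2_norm y)\<^sup>2 \<le> (C * L2_norm f)\<^sup>2"
      using L2_norm_nonneg by (intro power_mono)
    then show ?thesis by (simp add: power_mult_distrib)
  qed
  obtain R where R: "\<And>f. f \<in> L2 UNIV \<Longrightarrow> (R f, \<lambda>x. f x + \<mu> *s R f x) \<in> L_op Q"
    using surj by metis
  have opL2: "y \<in> L2 UNIV" if "(y, f) \<in> L_op Q" for y f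
    using that by (simp add: L_op_def)
  \<comment> \<open>within this radius the squared norms in the Neumann series decay by the factor \<open>1/16\<close>\<close>
  show thesis
  proof (rule that[of "1 / (4 * C)"])
    show "1 / (4 * C) > 0" using \<open>C \<ge> 1\<close> by simp
    fix \<nu> assume "norm (\<nu> - \<mu>) < 1 / (4 * C)"
    define \<epsilon> where "\<epsilon> = \<nu> - \<mu>"
    have "C * norm \<epsilon> \<le> 1 / 4"
      using \<open>norm (\<nu> - \<mu>) < 1 / (4 * C)\<close> \<open>C \<ge> 1\<close> by (simp add: \<epsilon>_def field_simps)
    then have "(C * norm \<epsilon>)\<^sup>2 \<le> (1 / 4)\<^sup>2"
      using \<open>C \<ge> 1\<close> by (intro power_mono) auto
    then have C\<epsilon>: "C\<^sup>2 * (norm \<epsilon>)\<^sup>2 \<le> 1 / 16"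
      by (simp add: power_mult_distrib power_divide)
    have \<nu>: "\<nu> = \<epsilon> + \<mu>" by (simp add: \<epsilon>_def)
    have bounded: "L2_norm y \<le> 2 * C * L2_norm f" if f: "f \<in> L2 UNIV" and y: "(y, \<lambda>x. f x + \<nu> *s y x) \<in> L_op Q" for f y
    proof -
      have yL: "y \<in> L2 UNIV" using opL2[OF y] .
      have g: "(\<lambda>x. f x + \<epsilon> *s y x) \<in> L2 UNIV" by (rule L2_add_scalar_mult[OF f yL])
      have "(y, \<lambda>x. (f x + \<epsilon> *s y x) + \<mu> *s y x) \<in> L_op Q"
        using y by (simp add: \<nu> vector_sadd_rdistrib add.assoc)
      from C[OF g this] have "(L2_norm y)\<^sup>2 \<le> C\<^sup>2 * (2 * (L2_norm f)\<^sup>2 + 2 * ((norm \<epsilon>)\<^sup>2 * (L2_norm y)\<^sup>2))"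
        by (rule order_trans[OF _ mult_left_mono[OF L2_norm_add_le[OF f yL] zero_le_power2]])
      also have "\<dots> = 2 * C\<^sup>2 * (L2_norm f)\<^sup>2 + 2 * (C\<^sup>2 * (norm \<epsilon>)\<^sup>2) * (L2_norm y)\<^sup>2"
        by (simp add: algebra_simps)
      also have "\<dots> \<le> 2 * C\<^sup>2 * (L2_norm f)\<^sup>2 + 2 * (1 / 16) * (L2_norm y)\<^sup>2"
        by (intro add_left_mono mult_right_mono mult_left_mono C\<epsilon>) auto
      finally have *: "(L2_norm y)\<^sup>2 \<le> 2 * C\<^sup>2 * (L2_norm f)\<^sup>2 + 2 * (1 / 16) * (L2_norm y)\<^sup>2" .
      have "(L2_norm y)\<^sup>2 \<le> (2 * C * L2_norm f)\<^sup>2"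
      proof -
        have "(2 * C * L2_norm f)\<^sup>2 = 4 * (C\<^sup>2 * (L2_norm f)\<^sup>2)" "2 * C\<^sup>2 * (L2_norm f)\<^sup>2 = 2 * (C\<^sup>2 * (L2_norm f)\<^sup>2)"
          "0 \<le> C\<^sup>2 * (L2_norm f)\<^sup>2"
          by (simp_all add: power_mult_distrib)
        with * show ?thesis by linarith
      qed
      then show ?thesis
        using \<open>C \<ge> 1\<close> L2_norm_nonneg[of f] by (intro power2_le_imp_le[of "L2_norm y"]) auto
    qed
    have onto: "\<exists>y. (y, \<lambda>x. f x + \<nu> *s y x) \<in> L_op Q" if f: "f \<in> L2 UNIV" for f
    proof -
      define G where "G = rec_nat f (\<lambda>_ g x. \<epsilon> *s R g x)"
      define y where "y k = R (G k)" for k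
      have G0: "G 0 = f" and GS: "G (Suc k) = (\<lambda>x. \<epsilon> *s y k x)" for k
        by (simp_all add: G_def y_def)
      have GL: "G k \<in> L2 UNIV" for k
        by (induction k) (auto simp: G0 GS y_def f intro!: L2_scalar_mult opL2[OF R])
      have op: "(y k, \<lambda>x. G k x + \<mu> *s y k x) \<in> L_op Q" for k
        unfolding y_def by (rule R[OF GL])
      have yL: "y k \<in> L2 UNIV" for k by (rule opL2[OF op])
      define M where "M = (L2_norm f)\<^sup>2"
      define N where "N = C\<^sup>2 * M"
      have "M \<ge> 0" by (simp add: M_def)
      have "C\<^sup>2 \<ge> 1" using \<open>C \<ge> 1\<close> by (simp add: one_le_power)
      have GM: "(L2_norm (G k))\<^sup>2 \<le> M * (1 / 16) ^ k" for k
      proof (induction k)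
        case (Suc k)
        have "(L2_norm (G (Suc k)))\<^sup>2 \<le> (norm \<epsilon>)\<^sup>2 * (C\<^sup>2 * (L2_norm (G k))\<^sup>2)"
          unfolding GS L2_norm_scalar_mult by (intro mult_left_mono C[OF GL op]) simp
        also have "\<dots> = (C\<^sup>2 * (norm \<epsilon>)\<^sup>2) * (L2_norm (G k))\<^sup>2" by simp
        also have "\<dots> \<le> (1 / 16) * (M * (1 / 16) ^ k)"
          by (intro mult_mono C\<epsilon> Suc) auto
        finally show ?case by simp
      qed (simp add: G0 M_def)
      have yN: "(L2_norm (y k))\<^sup>2 \<le> N * (1 / 16) ^ k" for k
        using order_trans[OF C[OF GL op] mult_left_mono[OF GM]] by (simp add: N_def mult.assoc)
      have GN: "(L2_norm (G k))\<^sup>2 \<le> N * (1 / 16) ^ k" for k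
      proof -
        have "M * (1 / 16) ^ k \<le> N * (1 / 16) ^ k"
          unfolding N_def using mult_right_mono[OF \<open>C\<^sup>2 \<ge> 1\<close> \<open>M \<ge> 0\<close>] by (intro mult_right_mono) auto
        then show ?thesis using GM[of k] by linarith
      qed
      define z where "z k x = Q x *v y k x - (G k x + \<mu> *s y k x)" for k x
      have "\<exists>y'. ac_deriv (y k) y' \<and> ac_deriv y' (z k)" for k
        using L_opD[OF op[of k]] unfolding z_def[abs_def] by metis
      then obtain y' where ac: "\<And>k. ac_deriv (y k) (y' k)" and ac': "\<And>k. ac_deriv (y' k) (z k)"
        by metis
      have sz: "summable (\<lambda>k. integral {a..b} (\<lambda>x. norm (z k x)))" for a b
      proof -
        obtain K where K: "\<And>y g z w N. y \<in> L2 UNIV \<Longrightarrow> g \<in> L2 UNIV \<Longrightarrow> w > 0 \<Longrightarrow>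
          (L2_norm y)\<^sup>2 \<le> N \<Longrightarrow> (L2_norm g)\<^sup>2 \<le> N \<Longrightarrow>
          z = (\<lambda>x. Q x *v y x - (g x + \<mu> *s y x)) \<Longrightarrow> z absolutely_integrable_on {a..b} \<Longrightarrow>
          integral {a..b} (\<lambda>x. norm (z x)) \<le> K * (w * N + 1 / w)"
          using schroedinger_second_derivative_bound[OF Q2, of \<mu> a b] by blast
        show ?thesis
        proof (rule summable_comparison_test'[of "\<lambda>k. (K * (N + 1)) * (1 / 4) ^ k" 0])
          show "summable (\<lambda>k. (K * (N + 1)) * (1 / 4 :: real) ^ k)"
            by (intro summable_mult summable_geometric) simp
          fix k
          have "(\<lambda>x. norm (z k x)) integrable_on {a..b}"
            using absolutely_integrable_norm[OF ac_derivD(1)[OF ac']] by (auto simp: o_def dest: set_lebesgue_integral_eq_integral(1))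
          then have "norm (integral {a..b} (\<lambda>x. norm (z k x))) = integral {a..b} (\<lambda>x. norm (z k x))"
            by (simp add: integral_nonneg)
          also have "\<dots> \<le> K * (4 ^ k * (N * (1 / 16) ^ k) + 1 / 4 ^ k)"
            by (rule K[OF yL GL _ yN GN _ ac_derivD(1)[OF ac']]) (auto simp: z_def)
          also have "4 ^ k * (N * (1 / 16) ^ k) = N * (4 * (1 / 16)) ^ k"
            by (simp only: power_mult_distrib mult.left_commute)
          also have "K * (N * (4 * (1 / 16)) ^ k + 1 / 4 ^ k) = (K * (N + 1)) * (1 / 4) ^ k"
            by (simp add: power_divide distrib_left add_divide_distrib)
          finally show "norm (integral {a..b} (\<lambda>x. norm (z k x))) \<le> (K * (N + 1)) * (1 / 4) ^ k" .
        qed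
      qed
      note geo = geometric_L2_series[OF yL yN]
      note sums = summable_values_of_second_derivatives[OF ac ac' sz geo(1)]
      define S where "S x = (\<Sum>k. y k x)" for x
      have sG: "summable (\<lambda>k. norm (G k x))" for x
      proof -
        have "summable (\<lambda>k. norm (G (Suc k) x))"
          unfolding GS norm_scalar_mult by (intro summable_mult sums(1))
        then show ?thesis by (subst (asm) summable_Suc_iff)
      qed
      have sQ: "summable (\<lambda>k. norm (Q x *v y k x))" for x
      proof -
        obtain B where B: "\<And>v. norm (Q x *v v) \<le> norm v * B"
          using bounded_linear.bounded[OF matvec.bounded_linear_right] by blast
        show ?thesis
          by (rule summable_comparison_test'[OF summable_mult2[OF sums(1)]]) (use B in auto)
      qed
      have sm: "summable (\<lambda>k. norm (\<mu> *s y k x))" for x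
        unfolding norm_scalar_mult by (intro summable_mult sums(1))
      have szx: "summable (\<lambda>k. norm (z k x))" for x
      proof (rule summable_comparison_test'[of "\<lambda>k. norm (Q x *v y k x) + (norm (G k x) + norm (\<mu> *s y k x))" 0])
        show "summable (\<lambda>k. norm (Q x *v y k x) + (norm (G k x) + norm (\<mu> *s y k x)))"
          by (intro summable_add sQ sG sm)
        have "norm (z k x) \<le> norm (Q x *v y k x) + (norm (G k x) + norm (\<mu> *s y k x))" for k
          unfolding z_def by (rule order_trans[OF norm_triangle_ineq4 add_left_mono[OF norm_triangle_ineq]])
        then show "norm (norm (z k x)) \<le> norm (Q x *v y k x) + (norm (G k x) + norm (\<mu> *s y k x))" for k
          by simp
      qed
      have acS: "ac_deriv S (\<lambda>x. \<Sum>k. y' k x)" "ac_deriv (\<lambda>x. \<Sum>k. y' k x) (\<lambda>x. \<Sum>k. z k x)"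
        unfolding S_def[abs_def]
        by (intro ac_deriv_suminf ac ac' sums sz szx summable_norm_cancel[OF sums(1)] summable_norm_cancel[OF sums(2)])+
      have zS: "(\<Sum>k. z k x) = Q x *v S x - (f x + \<nu> *s S x)" for x
      proof -
        note y_sum = summable_norm_cancel[OF sums(1)[of x]]
        have q: "(\<Sum>k. Q x *v y k x) = Q x *v S x"
          unfolding S_def by (rule bounded_linear.suminf[OF matvec.bounded_linear_right y_sum, symmetric])
        have m: "(\<Sum>k. c *s y k x) = c *s S x" for c
          unfolding S_def by (rule bounded_linear.suminf[OF bounded_linear_scalar_mult y_sum, symmetric])
        have g: "(\<Sum>k. G k x) = f x + \<epsilon> *s S x"
          using suminf_split_head[OF summable_norm_cancel[OF sG[of x]]] by (simp add: GS G0 m algebra_simps)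
        have "(\<Sum>k. z k x) = (\<Sum>k. Q x *v y k x) - ((\<Sum>k. G k x) + (\<Sum>k. \<mu> *s y k x))"
          unfolding z_def
          by (subst suminf_add[OF summable_norm_cancel[OF sG] summable_norm_cancel[OF sm]],
              subst suminf_diff[OF summable_norm_cancel[OF sQ] summable_add[OF summable_norm_cancel[OF sG] summable_norm_cancel[OF sm]]]) simp
        then show ?thesis
          by (simp add: q m g \<nu> vector_sadd_rdistrib add.assoc)
      qed
      have SL: "S \<in> L2 UNIV"
        using geo(2) ac_deriv_continuous[OF acS(1), of UNIV] continuous_imp_measurable_on_sets_lebesgue[of UNIV S]
        by (simp add: L2_UNIV_iff S_def[abs_def] lebesgue_on_UNIV_eq)
      have "(S, \<lambda>x. f x + \<nu> *s S x) \<in> L_op Q"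
      proof -
        have "AE x in lebesgue. f x + \<nu> *s S x = - (\<Sum>k. z k x) + Q x *v S x"
          by (simp add: zS)
        with SL L2_add_scalar_mult[OF f SL, of \<nu>] acS show ?thesis
          unfolding L_op_def mem_Collect_eq prod.case by blast
      qed
      then show ?thesis by blast
    qed
    show "\<nu> \<in> resolvent_set (L_op Q)"
      using bounded onto by (auto simp: resolvent_set_def)
  qed
qed

lemma closed_real_spectrum:
  fixes Q :: "real \<Rightarrow> complex ^ 'm ^ 'm"
  assumes Q2: "\<And>a b. (\<lambda>x. (norm (Q x))\<^sup>2) absolutely_integrable_on {a..b}"
  shows "closed (real_spectrum (L_op Q))"
  unfolding closed_def open_dist
proof
  fix x assume "x \<in> - real_spectrum (L_op Q)"
  then have "complex_of_real x \<in> resolvent_set (L_op Q)"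
    by (simp add: real_spectrum_def spectrum_def)
  then obtain r where r: "r > 0" "\<And>\<nu>. norm (\<nu> - complex_of_real x) < r \<Longrightarrow> \<nu> \<in> resolvent_set (L_op Q)"
    using resolvent_set_neighbourhood[OF Q2] by blast
  show "\<exists>e>0. \<forall>y. dist y x < e \<longrightarrow> y \<in> - real_spectrum (L_op Q)"
  proof (intro exI[of _ r] conjI allI impI r(1))
    fix y assume "dist y x < r"
    then have "norm (complex_of_real y - complex_of_real x) < r"
      by (simp add: dist_norm flip: of_real_diff)
    then show "y \<in> - real_spectrum (L_op Q)"
      using r(2) by (simp add: real_spectrum_def spectrum_def)
  qed
qed

section \<open>The spectrum near squares of integers\<close>

lemma abs_sin_pi_ge:
  assumes "0 < \<epsilon>" "\<epsilon> \<le> 1 / 2" and far: "\<And>k::int. \<epsilon> \<le> \<bar>s - of_int k\<bar>"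
  shows "sin (\<epsilon> * pi) \<le> \<bar>sin (s * pi)\<bar>"
proof -
  define t where "t = s - of_int \<lfloor>s\<rfloor>"
  have t: "\<epsilon> \<le> t" "t \<le> 1 - \<epsilon>"
    using far[of "\<lfloor>s\<rfloor>"] far[of "\<lfloor>s\<rfloor> + 1"] floor_correct[of s] unfolding t_def by linarith+
  have "sin (s * pi) = sin (t * pi + of_int \<lfloor>s\<rfloor> * pi)"
    by (simp add: t_def algebra_simps)
  also have "\<dots> = sin (t * pi) * cos (of_int \<lfloor>s\<rfloor> * pi)"
    by (simp add: sin_add sin_zero_iff_int2)
  finally have "\<bar>sin (s * pi)\<bar> = \<bar>sin (t * pi)\<bar>"
    using sin_zero_iff_int2[of "of_int \<lfloor>s\<rfloor> * pi"] sin_zero_abs_cos_one[of "of_int \<lfloor>s\<rfloor> * pi"] by (simp add: abs_mult)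
  moreover have "sin (\<epsilon> * pi) \<le> sin (t * pi)"
  proof (cases "t \<le> 1 / 2")
    case True
    have "t * pi \<le> pi / 2" "\<epsilon> * pi \<le> t * pi" "0 \<le> \<epsilon> * pi"
      using mult_right_mono[OF True, of pi] t assms by simp_all
    then show ?thesis by (intro sin_monotone_2pi_le) linarith+
  next
    case False
    have "1 - t \<le> 1 / 2" "\<epsilon> \<le> 1 - t" using False t by simp_all
    then have "(1 - t) * pi \<le> pi / 2" "\<epsilon> * pi \<le> (1 - t) * pi" "0 \<le> \<epsilon> * pi"
      using mult_right_mono[of "1 - t" "1 / 2" pi] mult_right_mono[of \<epsilon> "1 - t" pi] assms by simp_all
    then have "sin (\<epsilon> * pi) \<le> sin ((1 - t) * pi)" by (intro sin_monotone_2pi_le) linarith+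
    also have "(1 - t) * pi = pi - t * pi" by (simp add: algebra_simps)
    finally show ?thesis by simp
  qed
  ultimately show ?thesis by linarith
qed

lemma sin_cos_half_ge:
  fixes s d :: real
  assumes "d \<le> \<bar>sin (s * pi)\<bar>"
  shows "d / 2 \<le> \<bar>cos (s * pi / 2)\<bar>" "d / 2 \<le> \<bar>sin (s * pi / 2)\<bar>"
proof -
  have "\<bar>sin (s * pi)\<bar> = 2 * (\<bar>sin (s * pi / 2)\<bar> * \<bar>cos (s * pi / 2)\<bar>)"
    using sin_double[of "s * pi / 2"] by (simp add: abs_mult)
  moreover have "\<bar>sin x\<bar> * \<bar>cos x\<bar> \<le> \<bar>sin x\<bar>" "\<bar>sin x\<bar> * \<bar>cos x\<bar> \<le> \<bar>cos x\<bar>" for x :: real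
    by (simp_all add: mult_left_le mult_left_le_one_le)
  ultimately show "d / 2 \<le> \<bar>cos (s * pi / 2)\<bar>" "d / 2 \<le> \<bar>sin (s * pi / 2)\<bar>"
    using assms by (smt (verit, best) field_sum_of_halves)+
qed

lemma squares_far_from_integers_in_spectrum:
  fixes Q :: "real \<Rightarrow> complex ^ 'm ^ 'm"
  assumes odd: "odd CARD('m)"
    and pt: "AE x in lebesgue. conj_mat (Q (- x)) = Q x"
    and per: "AE x in lebesgue. Q (x + pi) = Q x"
    and Q: "\<And>a b. Q absolutely_integrable_on {a..b}"
    and Q2: "\<And>a b. (\<lambda>x. (norm (Q x))\<^sup>2) absolutely_integrable_on {a..b}"
    and \<epsilon>: "0 < \<epsilon>" "\<epsilon> \<le> 1 / 2"
  obtains s0 where "s0 > 0"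
    "\<And>s. s0 \<le> s \<Longrightarrow> (\<And>k::int. \<epsilon> \<le> \<bar>s - of_int k\<bar>) \<Longrightarrow> s\<^sup>2 \<in> real_spectrum (L_op Q)"
proof -
  define \<delta> where "\<delta> = sin (\<epsilon> * pi) / 2"
  have "\<epsilon> * pi \<le> 1 / 2 * pi" using \<epsilon> by (intro mult_right_mono) auto
  then have "\<epsilon> * pi < pi" using pi_gt_zero by linarith
  then have "\<delta> > 0"
    using \<epsilon> sin_gt_zero[of "\<epsilon> * pi"] by (simp add: \<delta>_def)
  obtain s0 where "s0 > 0" and
    floquet: "\<And>s. s0 \<le> s \<Longrightarrow> \<delta> \<le> \<bar>cos (s * pi / 2)\<bar> \<Longrightarrow> \<delta> \<le> \<bar>sin (s * pi / 2)\<bar> \<Longrightarrow>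
    \<exists>u u' w \<rho>. norm \<rho> = 1 \<and> ac_deriv u u' \<and> ac_deriv u' w \<and>
      (AE x in lebesgue. x \<in> {- pi / 2..pi / 2} \<longrightarrow> w x = Q x *v u x - complex_of_real (s\<^sup>2) *s u x) \<and>
      u (pi / 2) = \<rho> *s u (- pi / 2) \<and> u' (pi / 2) = \<rho> *s u' (- pi / 2) \<and> (u 0 \<noteq> 0 \<or> u' 0 \<noteq> 0)"
    using floquet_solution_exists[OF odd pt Q \<open>\<delta> > 0\<close>] by blast
  show thesis
  proof (rule that[OF \<open>s0 > 0\<close>])
    fix s assume "s0 \<le> s" and far: "\<And>k::int. \<epsilon> \<le> \<bar>s - of_int k\<bar>"
    note far_pi = sin_cos_half_ge[OF abs_sin_pi_ge[OF \<epsilon> far]]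
    obtain u u' w \<rho> where f: "norm \<rho> = 1" "ac_deriv u u'" "ac_deriv u' w"
      "AE x in lebesgue. x \<in> {- pi / 2..pi / 2} \<longrightarrow> w x = Q x *v u x - complex_of_real (s\<^sup>2) *s u x"
      "u (pi / 2) = \<rho> *s u (- pi / 2)" "u' (pi / 2) = \<rho> *s u' (- pi / 2)" "u 0 \<noteq> 0 \<or> u' 0 \<noteq> 0"
      using floquet[OF \<open>s0 \<le> s\<close>] far_pi unfolding \<delta>_def by blast
    have half: "- pi / 2 + pi = pi / 2" by simp
    have "complex_of_real (s\<^sup>2) \<in> spectrum (L_op Q)"
      by (rule floquet_solution_in_spectrum[OF Q Q2 per pi_gt_zero f(1-3), where \<alpha> = "- pi / 2" and t = 0])
         (use f half in \<open>auto simp: \<close>)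
    then show "s\<^sup>2 \<in> real_spectrum (L_op Q)"
      by (simp add: real_spectrum_def)
  qed
qed

text \<open>
  The interval with centre near \<open>k\<^sup>2\<close> has length \<open>4 \<epsilon> k\<close>, and the integers \<open>k\<close> within \<open>\<epsilon>\<close> of the root of
  a number in \<open>[0, n]\<close> are at most \<open>sqrt n + 1\<close>. The assumption \<open>s1 \<ge> 1\<close> leaves only positive \<open>k\<close>.
\<close>

lemma measure_complement_le:
  fixes S :: "real set"
  assumes S: "closed S" and "s1 \<ge> 1" and \<epsilon>: "0 < \<epsilon>" "\<epsilon> \<le> 1 / 2"
    and far: "\<And>s. s1 \<le> s \<Longrightarrow> (\<And>k::int. \<epsilon> \<le> \<bar>s - of_int k\<bar>) \<Longrightarrow> s\<^sup>2 \<in> S"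
  shows "measure lebesgue ({0..real n} - S) \<le> s1\<^sup>2 + 8 * \<epsilon> * (real n + 1)"
proof -
  define K where "K = nat \<lfloor>sqrt (real n) + 1\<rfloor>"
  define I where "I k = {(real k - \<epsilon>)\<^sup>2..(real k + \<epsilon>)\<^sup>2}" for k :: nat
  have sub: "{0..real n} - S \<subseteq> {0..s1\<^sup>2} \<union> (\<Union>k\<in>{1..K}. I k)"
  proof
    fix x assume x: "x \<in> {0..real n} - S"
    define s where "s = sqrt x"
    have s: "s \<ge> 0" "s\<^sup>2 = x" "s \<le> sqrt (real n)" using x by (auto simp: s_def)
    show "x \<in> {0..s1\<^sup>2} \<union> (\<Union>k\<in>{1..K}. I k)"
    proof (cases "s1 \<le> s")
      case False
      then have "s\<^sup>2 \<le> s1\<^sup>2" using s by (intro power_mono) auto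
      then show ?thesis using x s by auto
    next
      case True
      then have "\<not> (\<forall>k::int. \<epsilon> \<le> \<bar>s - of_int k\<bar>)"
        using far[OF True] x s(2) by auto
      then obtain j :: int where j: "\<bar>s - of_int j\<bar> < \<epsilon>"
        by (auto simp: not_le)
      have "of_int j > (0 :: real)" using j True \<open>s1 \<ge> 1\<close> \<epsilon> by linarith
      define k where "k = nat j"
      have k: "of_int j = real k" "k \<ge> 1"
        using \<open>of_int j > (0 :: real)\<close> by (auto simp: k_def)
      have "real k \<le> sqrt (real n) + 1" using j s \<epsilon> unfolding k by linarith
      then have "k \<le> K" unfolding K_def by (rule le_nat_floor)
      moreover have "x \<in> I k"
      proof -
        have "real k \<ge> 1" using k(2) by simp
        then have "0 \<le> real k - \<epsilon>" "real k - \<epsilon> \<le> s" "s \<le> real k + \<epsilon>"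
          using j \<epsilon> unfolding k(1) by linarith+
        then show ?thesis
          using s(1) unfolding I_def s(2)[symmetric] by (auto intro: power_mono)
      qed
      ultimately show ?thesis using k by auto
    qed
  qed
  have I: "I k \<in> lmeasurable" for k unfolding I_def by simp
  have "measure lebesgue ({0..real n} - S) \<le> measure lebesgue ({0..s1\<^sup>2} \<union> (\<Union>k\<in>{1..K}. I k))"
    by (rule measure_mono_fmeasurable[OF sub]) (use S I in \<open>auto intro!: fmeasurable.finite_UN\<close>)
  also have "\<dots> \<le> measure lebesgue {0..s1\<^sup>2} + measure lebesgue (\<Union>k\<in>{1..K}. I k)"
    by (rule measure_Un_le) (use I in auto)
  also have "measure lebesgue (\<Union>k\<in>{1..K}. I k) \<le> (\<Sum>k\<in>{1..K}. measure lebesgue (I k))"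
    by (rule measure_UNION_le) (use I in auto)
  also have "(\<Sum>k\<in>{1..K}. measure lebesgue (I k)) \<le> (\<Sum>k\<in>{1..K}. 4 * \<epsilon> * real K)"
  proof (rule sum_mono)
    fix k assume k: "k \<in> {1..K}"
    have "measure lebesgue (I k) = (real k + \<epsilon>)\<^sup>2 - (real k - \<epsilon>)\<^sup>2"
    proof -
      have "(real k - \<epsilon>)\<^sup>2 \<le> (real k + \<epsilon>)\<^sup>2"
        using k \<epsilon> by (intro power_mono) auto
      then show ?thesis by (simp add: I_def)
    qed
    also have "\<dots> = 4 * \<epsilon> * real k" by (simp add: power2_sum power2_diff)
    also have "\<dots> \<le> 4 * \<epsilon> * real K" using k \<epsilon> by (intro mult_left_mono) auto
    finally show "measure lebesgue (I k) \<le> 4 * \<epsilon> * real K" .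
  qed
  also have "\<dots> = 4 * \<epsilon> * (real K)\<^sup>2" by (simp add: power2_eq_square)
  also have "\<dots> \<le> 4 * \<epsilon> * (2 * (real n + 1))"
  proof -
    have "real K \<le> sqrt (real n) + 1" unfolding K_def by (simp add: of_nat_nat)
    then have "(real K)\<^sup>2 \<le> (sqrt (real n) + 1)\<^sup>2" by (intro power_mono) auto
    also have "\<dots> \<le> 2 * (real n + 1)"
      using power2_norm_add_le[of "sqrt (real n)" 1] by simp
    finally show ?thesis using \<epsilon> by (intro mult_left_mono) auto
  qed
  finally show ?thesis by (simp add: algebra_simps)
qed

lemma complement_ratio_tendsto_0:
  fixes S :: "real set"
  assumes S: "closed S"
    and far: "\<And>\<epsilon>. 0 < \<epsilon> \<Longrightarrow> \<epsilon> \<le> 1 / 2 \<Longrightarrow> \<exists>s0>0. \<forall>s\<ge>s0. (\<forall>k::int. \<epsilon> \<le> \<bar>s - of_int k\<bar>) \<longrightarrow> s\<^sup>2 \<in> S"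
  shows "(\<forall>\<^sub>F n in sequentially. measure lebesgue (S \<inter> {0..real n}) > 0) \<and>
     (\<lambda>n::nat. measure lebesgue ({0..real n} - S) / measure lebesgue (S \<inter> {0..real n})) \<longlonglongrightarrow> 0"
proof -
  define b where "b n = measure lebesgue ({0..real n} - S)" for n :: nat
  define c where "c n = measure lebesgue (S \<inter> {0..real n})" for n :: nat
  have bc: "c n = real n - b n" for n
  proof -
    have "measure lebesgue ({0..real n} - (S \<inter> {0..real n})) = measure lebesgue {0..real n} - c n"
      unfolding c_def using S by (intro measurable_measure_Diff) auto
    moreover have "{0..real n} - (S \<inter> {0..real n}) = {0..real n} - S" by auto
    ultimately show ?thesis by (simp add: b_def)
  qed
  have small: "\<forall>\<^sub>F n in sequentially. b n \<le> e * real n \<and> n \<ge> 1" if "e > 0" for e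
  proof -
    define \<epsilon> where "\<epsilon> = min (1 / 2) (e / 32)"
    have \<epsilon>: "0 < \<epsilon>" "\<epsilon> \<le> 1 / 2" "\<epsilon> \<le> e / 32" using that by (auto simp: \<epsilon>_def)
    obtain s0 where s0: "\<And>s. s0 \<le> s \<Longrightarrow> (\<And>k::int. \<epsilon> \<le> \<bar>s - of_int k\<bar>) \<Longrightarrow> s\<^sup>2 \<in> S"
      using far[OF \<epsilon>(1,2)] by blast
    define s1 where "s1 = max 1 s0"
    have b_le: "b n \<le> s1\<^sup>2 + 8 * \<epsilon> * (real n + 1)" for n
      unfolding b_def by (rule measure_complement_le[OF S _ \<epsilon>(1,2)]) (auto simp: s1_def intro: s0)
    obtain n0 :: nat where n0: "2 * s1\<^sup>2 / e \<le> real n0" using real_arch_simple by blast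
    show ?thesis
      using eventually_ge_at_top[of "max 1 n0"]
    proof eventually_elim
      case (elim n)
      then have n: "n \<ge> 1" "real n \<ge> real n0" by auto
      have "2 * s1\<^sup>2 \<le> e * real n"
        using n0 n \<open>e > 0\<close> order_trans[OF n0 n(2)] by (simp add: pos_divide_le_eq mult.commute)
      moreover have "8 * \<epsilon> * (real n + 1) \<le> 8 * (e / 32) * (2 * real n)"
        using \<epsilon> n by (intro mult_mono) auto
      ultimately have "b n \<le> e * real n"
        using b_le[of n] by simp
      then show ?case using n by simp
    qed
  qed
  have pos: "\<forall>\<^sub>F n in sequentially. c n > 0"
    using small[of "1 / 2", simplified]
  proof eventually_elim
    case (elim n)
    then show ?case unfolding bc by linarith
  qed
  have "(\<lambda>n. b n / c n) \<longlonglongrightarrow> 0"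
  proof (rule tendstoI)
    fix r :: real assume "r > 0"
    define e where "e = min (1 / 2) (r / 4)"
    have e: "e > 0" "e \<le> 1 / 2" "e \<le> r / 4" using \<open>r > 0\<close> by (auto simp: e_def)
    show "\<forall>\<^sub>F n in sequentially. dist (b n / c n) 0 < r"
      using small[OF e(1)]
    proof eventually_elim
      case (elim n)
      then have n: "real n \<ge> 1" by simp
      have b0: "b n \<ge> 0" by (simp add: b_def)
      have "e * real n \<le> 1 / 2 * real n" "e * real n \<le> r / 4 * real n"
        using e n by (intro mult_right_mono; simp)+
      then have "real n / 2 \<le> c n" and br: "b n \<le> r / 4 * real n"
        using elim unfolding bc by linarith+
      then have "c n > 0" using n by linarith
      have "b n \<le> r / 2 * c n"
      proof -
        have "b n \<le> r / 2 * (real n / 2)" using br by simp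
        also have "\<dots> \<le> r / 2 * c n"
          using \<open>real n / 2 \<le> c n\<close> \<open>r > 0\<close> by (intro mult_left_mono) auto
        finally show ?thesis .
      qed
      also have "\<dots> < r * c n"
        using \<open>r > 0\<close> \<open>c n > 0\<close> by simp
      finally have "b n / c n < r"
        using \<open>c n > 0\<close> by (simp add: pos_divide_less_eq)
      then show ?case
        using b0 \<open>c n > 0\<close> by (simp add: dist_norm)
    qed
  qed
  then show ?thesis
    using pos unfolding b_def c_def by blast
qed

(* The first conjunct makes the quotients in the limit meaningful: in Isabelle x / 0 = 0 and
   non-measurable sets have measure 0, so positivity of the denominator says that, from some n
   on, the sets involved are measurable and the division is a genuine one. *)
theorem corollary1:
  fixes Q :: "real \<Rightarrow> complex ^ 'm ^ 'm"
  assumes "odd CARD('m)"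
    and "\<And>i j. AE x in lebesgue. cnj (Q (- x) $ i $ j) = Q x $ i $ j"
    and "\<And>i j. AE x in lebesgue. Q (x + pi) $ i $ j = Q x $ i $ j"
    and "\<And>i j. (\<lambda>x. Q x $ i $ j) \<in> L2 {0..pi}"
  shows "(\<forall>\<^sub>F n in sequentially.
            measure lebesgue (real_spectrum (L_op Q) \<inter> {0..real n}) > 0) \<and>
         (\<lambda>n::nat. measure lebesgue ({0..real n} - real_spectrum (L_op Q)) /
                   measure lebesgue (real_spectrum (L_op Q) \<inter> {0..real n}))
           \<longlonglongrightarrow> 0"
proof -
  have "AE x in lebesgue. \<forall>i\<in>UNIV. \<forall>j\<in>UNIV. cnj (Q (- x) $ i $ j) = Q x $ i $ j"
    by (intro AE_finite_allI assms) auto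
  then have pt: "AE x in lebesgue. conj_mat (Q (- x)) = Q x"
    by eventually_elim (simp add: conj_mat_def vec_eq_iff)
  have "AE x in lebesgue. \<forall>i\<in>UNIV. \<forall>j\<in>UNIV. Q (x + pi) $ i $ j = Q x $ i $ j"
    by (intro AE_finite_allI assms) auto
  then have per: "AE x in lebesgue. Q (x + pi) = Q x"
    by eventually_elim (simp add: vec_eq_iff)
  note Q = potential_locally_L2[OF per assms(4)]
  show ?thesis
  proof (rule complement_ratio_tendsto_0)
    show "closed (real_spectrum (L_op Q))"
      by (rule closed_real_spectrum[OF Q(2)])
    fix \<epsilon> :: real assume "0 < \<epsilon>" "\<epsilon> \<le> 1 / 2"
    then show "\<exists>s0>0. \<forall>s\<ge>s0. (\<forall>k::int. \<epsilon> \<le> \<bar>s - of_int k\<bar>) \<longrightarrow> s\<^sup>2 \<in> real_spectrum (L_op Q)"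
      using squares_far_from_integers_in_spectrum[OF assms(1) pt per Q] by metis
  qed
qed

end
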